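(* Let $\Omega\subset\mathbb{R}^2$ be a bounded domain with smooth boundary $\gamma=\partial\Omega$, and let $\beta>0$ with Larmor radius $r=1/\beta$ satisfy the curvature assumption $r<r_0/2$, where $r_0$ is the maximal radius of a tubular neighbourhood of $\gamma$. Suppose that the magnetic billiard flow $g^t$ in $\Omega$ admits a non-constant polynomial in momenta integral $\Phi$. Then each of the parallel curves $\gamma_{+r}$ and $\gamma_{-r}$ is a real oval of an affine algebraic curve which is non-singular in $\mathbb{C}^2$.
   Context: $\gamma$ is a simple closed $C^\infty$ curve, parametrized counterclockwise by arc length $s$; $J$ is the counterclockwise rotation by $\pi/2$ and $n(s)=J\dot\gamma(s)$ is the unit normal; $k$ denotes the curvature of $\gamma$. For real $t$ the parallel curve is $\gamma_t(s)=\gamma(s)+t\,n(s)$. The number $r_0$ is the largest radius for which the tubular neighbourhood of $\gamma$ is diffeomorphic to its normal bundle (so $\gamma_t$ is a smooth embedded curve for $|t|<r_0$, and $r_0\le 1/\max|k|$). Magnetic billiard with constant field of magnitude $\beta$: a particle moves inside $\Omega$ with unit speed along arcs of circles of radius $r=1/\beta$ traversed counterclockwise (Larmor arcs); on hitting $\gamma$ the velocity is reflected, $v\mapsto v-2\langle n,v\rangle n$. $g^t$ denotes the resulting flow on unit tangent vectors. Let $\Omega_+$ be the closed annulus bounded by $\gamma$ and $\gamma_{+2r}$ (the region swept by all Larmor arcs lying in $\Omega$ that intersect $\partial\Omega$). A polynomial in momenta integral is a function $\Phi(x,v)=\sum_{0\le k+l\le N}a_{kl}(x)v_1^kv_2^l$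 on unit tangent vectors $(x,v)$ with $x\in\Omega_+$, with coefficients $a_{kl}\in C^\infty(\overline{\Omega_+})$, such that: (1) $\Phi$ is constant along the magnetic flow between collisions, i.e. for every $x\in\gamma$ and every inward unit vector $v$ at $x$, $\Phi(g^t(x,v))=\Phi(x,v)$ (for $t$ before the next collision); (2) $\Phi(x,v)=\Phi(x,v-2\langle n,v\rangle n)$ for every $x\in\partial\Omega$ and unit $v$ at $x$. *)

theory Defs
  imports "HOL-Complex_Analysis.Complex_Analysis"
begin

text \<open>The plane R^2 is identified with the complex numbers; J is multiplication by i.\<close>

definition vd :: "(real \<Rightarrow> complex) \<Rightarrow> real \<Rightarrow> complex" where
  "vd g t = vector_derivative g (at t)"

definition smooth_curve :: "(real \<Rightarrow> complex) \<Rightarrow> bool" where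
  "smooth_curve g \<longleftrightarrow> (\<forall>m t. ((vd ^^ m) g) differentiable (at t))"

definition simple_closed_arclength :: "(real \<Rightarrow> complex) \<Rightarrow> real \<Rightarrow> bool" where
  "simple_closed_arclength g L \<longleftrightarrow>
     L > 0 \<and> smooth_curve g \<and> (\<forall>s. g (s + L) = g s) \<and> inj_on g {0..<L}
     \<and> (\<forall>s. norm (vd g s) = 1)"

definition loop :: "(real \<Rightarrow> complex) \<Rightarrow> real \<Rightarrow> real \<Rightarrow> complex" where
  "loop g L t = g (L * t)"

definition dom_of :: "(real \<Rightarrow> complex) \<Rightarrow> real \<Rightarrow> complex set" where
  "dom_of g L = inside (g ` {0..L})"

definition ccw :: "(real \<Rightarrow> complex) \<Rightarrow> real \<Rightarrow> bool" where
  "ccw g L \<longleftrightarrow> (\<forall>z \<in> dom_of g L. winding_number (loop g L) z = 1)"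

definition nrm :: "(real \<Rightarrow> complex) \<Rightarrow> real \<Rightarrow> complex" where
  "nrm g s = \<i> * vd g s"

definition curv :: "(real \<Rightarrow> complex) \<Rightarrow> real \<Rightarrow> real" where
  "curv g s = inner (vd (vd g) s) (nrm g s)"

definition par :: "(real \<Rightarrow> complex) \<Rightarrow> real \<Rightarrow> real \<Rightarrow> complex" where
  "par g t s = g s + of_real t * nrm g s"

text \<open>The map (s,t) -> gamma(s) + t n(s) from the open normal bundle of radius rho is a
  diffeomorphism onto its image: injective with non-vanishing Jacobian (1 - t k(s)).\<close>
definition tube_ok :: "(real \<Rightarrow> complex) \<Rightarrow> real \<Rightarrow> real \<Rightarrow> bool" where
  "tube_ok g L \<rho> \<longleftrightarrow>
     (\<forall>s t. \<bar>t\<bar> < \<rho> \<longrightarrow> 1 - t * curv g s \<noteq> 0)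
     \<and> inj_on (\<lambda>(s, t). par g t s) ({0..<L} \<times> {-\<rho><..<\<rho>})"

definition r0 :: "(real \<Rightarrow> complex) \<Rightarrow> real \<Rightarrow> real" where
  "r0 g L = Sup {\<rho>. \<rho> > 0 \<and> tube_ok g L \<rho>}"

definition omega_plus :: "(real \<Rightarrow> complex) \<Rightarrow> real \<Rightarrow> complex set" where
  "omega_plus g r = {par g t s | s t. 0 \<le> t \<and> t \<le> 2 * r}"

definition larmor_pos :: "real \<Rightarrow> complex \<Rightarrow> complex \<Rightarrow> real \<Rightarrow> complex" where
  "larmor_pos r x v t = x - \<i> * of_real r * v * (exp (\<i> * of_real (t / r)) - 1)"

definition larmor_vel :: "real \<Rightarrow> complex \<Rightarrow> real \<Rightarrow> complex" where
  "larmor_vel r v t = v * exp (\<i> * of_real (t / r))"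

definition pdir :: "complex \<Rightarrow> (complex \<Rightarrow> real) \<Rightarrow> complex \<Rightarrow> real" where
  "pdir d f x = deriv (\<lambda>t. f (x + of_real t * d)) 0"

fun ipart :: "complex list \<Rightarrow> (complex \<Rightarrow> real) \<Rightarrow> complex \<Rightarrow> real" where
  "ipart [] f = f"
| "ipart (d # ds) f = pdir d (ipart ds f)"

definition cinf_on :: "complex set \<Rightarrow> (complex \<Rightarrow> real) \<Rightarrow> bool" where
  "cinf_on U f \<longleftrightarrow> (\<forall>ds. set ds \<subseteq> {1, \<i>} \<longrightarrow>
      continuous_on U (ipart ds f)
      \<and> (\<forall>d \<in> {1, \<i>}. \<forall>x \<in> U. (\<lambda>t. ipart ds f (x + of_real t * d)) differentiable (at 0)))"

definition cinf_closed :: "complex set \<Rightarrow> (complex \<Rightarrow> real) \<Rightarrow> bool" where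
  "cinf_closed S f \<longleftrightarrow> (\<exists>U h. open U \<and> S \<subseteq> U \<and> cinf_on U h \<and> (\<forall>x\<in>S. h x = f x))"

definition poly_mom :: "nat \<Rightarrow> (nat \<Rightarrow> nat \<Rightarrow> complex \<Rightarrow> real) \<Rightarrow> complex \<Rightarrow> complex \<Rightarrow> real" where
  "poly_mom N a x v = (\<Sum>k\<le>N. \<Sum>l\<le>N - k. a k l x * Re v ^ k * Im v ^ l)"

definition poly_integral ::
  "(real \<Rightarrow> complex) \<Rightarrow> real \<Rightarrow> real \<Rightarrow> nat \<Rightarrow> (nat \<Rightarrow> nat \<Rightarrow> complex \<Rightarrow> real) \<Rightarrow> bool" where
  "poly_integral g L r N a \<longleftrightarrow>
     (\<forall>k l. k + l \<le> N \<longrightarrow> cinf_closed (omega_plus g r) (a k l))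
     \<and> (\<forall>s v t. norm v = 1 \<and> inner v (nrm g s) > 0 \<and> t > 0
           \<and> (\<forall>\<tau>\<in>{0<..<t}. larmor_pos r (g s) v \<tau> \<in> dom_of g L)
         \<longrightarrow> poly_mom N a (larmor_pos r (g s) v t) (larmor_vel r v t) = poly_mom N a (g s) v)
     \<and> (\<forall>s v. norm v = 1 \<longrightarrow>
         poly_mom N a (g s) v = poly_mom N a (g s) (v - 2 * of_real (inner (nrm g s) v) * nrm g s))"

definition nonconstant_on_phase :: "complex set \<Rightarrow> (complex \<Rightarrow> complex \<Rightarrow> real) \<Rightarrow> bool" where
  "nonconstant_on_phase S \<Phi> \<longleftrightarrow>
     (\<exists>x v y w. x \<in> S \<and> y \<in> S \<and> norm v = 1 \<and> norm w = 1 \<and> \<Phi> x v \<noteq> \<Phi> y w)"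

definition bpoly :: "nat \<Rightarrow> (nat \<Rightarrow> nat \<Rightarrow> real) \<Rightarrow> complex \<Rightarrow> complex \<Rightarrow> complex" where
  "bpoly N c z w = (\<Sum>i\<le>N. \<Sum>j\<le>N. of_real (c i j) * z ^ i * w ^ j)"

definition real_zeros :: "nat \<Rightarrow> (nat \<Rightarrow> nat \<Rightarrow> real) \<Rightarrow> complex set" where
  "real_zeros N c = {p. bpoly N c (of_real (Re p)) (of_real (Im p)) = 0}"

definition nonsingular_C2 :: "nat \<Rightarrow> (nat \<Rightarrow> nat \<Rightarrow> real) \<Rightarrow> bool" where
  "nonsingular_C2 N c \<longleftrightarrow> (\<forall>z w. bpoly N c z w = 0 \<longrightarrow>
      deriv (\<lambda>z'. bpoly N c z' w) z \<noteq> 0 \<or> deriv (\<lambda>w'. bpoly N c z w') w \<noteq> 0)"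

definition nonsing_alg_oval :: "complex set \<Rightarrow> bool" where
  "nonsing_alg_oval C \<longleftrightarrow> (\<exists>N c. (\<exists>i j. c i j \<noteq> 0) \<and> nonsingular_C2 N c
       \<and> (\<exists>p \<in> C. C = connected_component_set (real_zeros N c) p))"

end

theory Submission
  imports Defs
    "HOL-Computational_Algebra.Field_as_Ring"
    "HOL-Computational_Algebra.Polynomial_Factorial"
begin

text \<open>A Larmor circle is determined by its centre \<open>P\<close>, so the integral \<open>\<Phi>\<close> descends to a function \<open>F\<close> on
  the annulus of points at distance less than \<open>r\<close> from \<open>\<gamma>\<close>. On every circle of radius \<open>r\<close> the function
  \<open>F\<close> is locally a trigonometric polynomial of degree at most \<open>N\<close>; the product of the operators
  \<open>d/d\<theta> - i j\<close> over \<open>\<bar>j\<bar> \<le> N\<close> annihilates it, and the top Fourier coefficient in \<open>\<theta>\<close> of the resulting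
  identity gives \<open>\<partial>\<^sub>z^(2 N + 1) F = 0\<close>. As \<open>F\<close> is real, it is a polynomial.

  The reflection law says that \<open>F\<close>, restricted to the circle of radius \<open>r\<close> about \<open>\<gamma>(s)\<close>, is even with
  respect to the normal at \<open>\<gamma>(s)\<close>. Hence \<open>F\<close> is a constant \<open>c\<close> on each of \<open>\<gamma>\<^sub>+\<^sub>r\<close> and \<open>\<gamma>\<^sub>-\<^sub>r\<close>. Write \<open>F - c = f^m g\<close> with \<open>f\<close>
  irreducible, vanishing on the parallel curve, and not dividing \<open>g\<close>. The first odd-order term of the
  expansion of \<open>F - c\<close> along the circle shows that \<open>(f\<^sub>n\<^sup>3 - \<rho> H(f))^m g\<^sup>3\<close> is a nonzero constant on the
  curve (\<open>\<rho>\<close> being \<open>r\<close> or \<open>- r\<close>), where \<open>f\<^sub>n\<^sup>2 = \<bar>\<nabla>f\<bar>\<^sup>2\<close> and \<open>H(f)\<close> is the Hessian form on the tangent. Eliminating the square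
  root gives a polynomial divisible by \<open>f\<close> that does not vanish at a singular complex zero of \<open>f\<close>.
  Irreducibility over curves that are merely \<open>C\<^sup>\<infinity>\<close> is handled through polynomials vanishing to infinite
  order at a point of the curve: they form a prime ideal.\<close>

section \<open>Bivariate real polynomials\<close>

text \<open>Role of the curvature assumption: the tube is injective beyond distance 2
  \<open>r\<close>. Hence a Larmor circle whose centre is closer than \<open>r\<close> to the curve
  has only one inward crossing, so \<open>F\<close> is well defined; its innermost point lies in the
  domain and its outermost point outside. That the normal points into the domain is not a
  hypothesis: it has to be extracted from winding numbers.

  Origin of the constant: let w be the normal derivative of f along the parallel curve and \<mu> = 1
  - \<rho> k. Evenness on the circles up to third order says m (3 w' / w - \<mu>' / \<mu>) + 3 g' /
  g = 0, so w^(3 m) g^3 / \<mu>^m is constant. The curvature k is not a polynomial in the point, but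
  differentiating f = 0 twice along the curve turns w^3 / \<mu> into the polynomial expression of
  the overview. The constant is non-zero because f divides neither g nor both of its own partial
  derivatives.\<close>

definition upe :: "real poly \<Rightarrow> 'a::real_normed_field \<Rightarrow> 'a" where
  "upe q z = poly (map_poly of_real q) z"

text \<open>The inner polynomials carry the first variable and the outer one the second, so
  \<open>degree\<close> is the degree in the second variable. The field stays general because one
  polynomial is evaluated along a real curve and also at complex points, where singularities must be
  excluded.\<close>

definition ev :: "real poly poly \<Rightarrow> 'a::real_normed_field \<Rightarrow> 'a \<Rightarrow> 'a" where
  "ev p z w = poly (map_poly (\<lambda>q. upe q z) p) w"

definition dx :: "real poly poly \<Rightarrow> real poly poly" where
  "dx p = map_poly pderiv p"

definition dy :: "real poly poly \<Rightarrow> real poly poly" where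
  "dy p = pderiv p"

lemma upe_0 [simp]: "upe 0 z = 0"
  by (simp add: upe_def)

lemma upe_pCons [simp]: "upe (pCons a q) z = of_real a + z * upe q z"
  by (simp add: upe_def map_poly_pCons)

lemma upe_1 [simp]: "upe 1 z = 1"
  by (simp add: one_pCons)

lemma upe_add [simp]: "upe (p + q) z = upe p z + upe q z"
proof (induction p arbitrary: q)
  case (pCons a p)
  obtain b r where "q = pCons b r" by (rule pCons_cases)
  then show ?case by (simp add: pCons.IH algebra_simps)
qed simp

lemma upe_smult [simp]: "upe (smult c q) z = of_real c * upe q z"
  by (induction q) (auto simp: algebra_simps)

lemma upe_mult [simp]: "upe (p * q) z = upe p z * upe q z"
  by (induction p) (auto simp: algebra_simps)

lemma upe_real: "upe q (x::real) = poly q x"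
  by (induction q) auto

lemma ev_0 [simp]: "ev 0 z w = 0"
  by (simp add: ev_def)

lemma ev_pCons [simp]: "ev (pCons q p) z w = upe q z + w * ev p z w"
  by (simp add: ev_def map_poly_pCons)

lemma ev_1 [simp]: "ev 1 z w = 1"
  by (simp add: one_pCons)

lemma ev_add [simp]: "ev (p + q) z w = ev p z w + ev q z w"
proof (induction p arbitrary: q)
  case (pCons a p)
  obtain b r where "q = pCons b r" by (rule pCons_cases)
  then show ?case by (simp add: pCons.IH algebra_simps)
qed simp

lemma ev_smult [simp]: "ev (smult c q) z w = upe c z * ev q z w"
  by (induction q) (auto simp: algebra_simps)

lemma ev_minus [simp]: "ev (- q) z w = - ev q z w"
  using ev_add[of q "- q" z w] by (simp add: add_eq_0_iff2 minus_unique)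

lemma ev_diff [simp]: "ev (p - q) z w = ev p z w - ev q z w"
  using ev_add[of p "- q" z w] by simp

lemma ev_mult [simp]: "ev (p * q) z w = ev p z w * ev q z w"
  by (induction p) (auto simp: algebra_simps)

lemma ev_power [simp]: "ev (p ^ n) z w = ev p z w ^ n"
  by (induction n) auto

lemma dx_pCons: "dx (pCons q p) = pCons (pderiv q) (dx p)"
  by (simp add: dx_def map_poly_pCons)

lemma dx_0 [simp]: "dx 0 = 0"
  by (simp add: dx_def)

lemma dx_dy: "dx (dy p) = dy (dx p)"
  by (rule poly_eqI) (simp add: dx_def dy_def coeff_map_poly coeff_pderiv mult.commute
      of_nat_poly pderiv_smult pderiv_mult pderiv_pCons flip: of_nat_Suc)

lemma upe_chain:
  assumes "(f has_field_derivative f') (at t)"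
  shows "((\<lambda>t. upe q (f t)) has_field_derivative (upe (pderiv q) (f t) * f')) (at t)"
proof (induction q)
  case (pCons a q)
  have "((\<lambda>t. of_real a + f t * upe q (f t)) has_field_derivative
      (0 + (f' * upe q (f t) + (upe (pderiv q) (f t) * f') * f t))) (at t)"
    by (intro DERIV_add DERIV_mult assms pCons.IH) auto
  then show ?case by (simp add: pderiv_pCons algebra_simps)
qed simp

lemma ev_chain:
  assumes "(f has_field_derivative f') (at t)" "(g has_field_derivative g') (at t)"
  shows "((\<lambda>t. ev p (f t) (g t)) has_field_derivative
           (ev (dx p) (f t) (g t) * f' + ev (dy p) (f t) (g t) * g')) (at t)"
proof (induction p)
  case (pCons q p)
  have "((\<lambda>t. upe q (f t) + g t * ev p (f t) (g t)) has_field_derivative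
      (upe (pderiv q) (f t) * f' + (g' * ev p (f t) (g t)
        + (ev (dx p) (f t) (g t) * f' + ev (dy p) (f t) (g t) * g') * g t))) (at t)"
    by (intro DERIV_add DERIV_mult assms upe_chain pCons.IH)
  then show ?case by (simp add: dx_pCons dy_def pderiv_pCons algebra_simps)
qed (simp add: dy_def)

lemma upe_zero_infinite:
  assumes "infinite A" "\<And>x. x \<in> A \<Longrightarrow> upe q (x::real) = 0"
  shows "q = 0"
proof (rule ccontr)
  assume "q \<noteq> 0"
  then have "finite {x. poly q x = 0}" by (rule poly_roots_finite)
  moreover have "A \<subseteq> {x. poly q x = 0}" using assms by (auto simp: upe_real)
  ultimately show False using assms(1) finite_subset by blast
qed

lemma ev_zero_infinite:
  assumes "infinite A" "infinite B"
    and "\<And>x y. x \<in> A \<Longrightarrow> y \<in> B \<Longrightarrow> ev p (x::real) y = 0"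
  shows "p = 0"
proof (rule poly_eqI)
  fix j
  have "upe (coeff p j) x = 0" if "x \<in> A" for x :: real
  proof -
    let ?q = "map_poly (\<lambda>q. upe q x) p"
    have "?q = 0"
    proof (rule ccontr)
      assume "?q \<noteq> 0"
      then have "finite {y. poly ?q y = 0}" by (rule poly_roots_finite)
      moreover have "B \<subseteq> {y. poly ?q y = 0}" using assms(3)[OF that] by (auto simp: ev_def)
      ultimately show False using assms(2) finite_subset by blast
    qed
    then have "coeff ?q j = 0" by simp
    then show ?thesis by (simp add: coeff_map_poly)
  qed
  then have "coeff p j = 0" by (rule upe_zero_infinite[OF assms(1)])
  then show "coeff p j = coeff 0 j" by simp
qed

lemma poly_sum_le: "degree q \<le> n \<Longrightarrow> poly q (z::'a::comm_ring_1) = (\<Sum>i\<le>n. coeff q i * z ^ i)"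
  unfolding poly_altdef by (rule sum.mono_neutral_left) (auto simp: coeff_eq_0)

lemma upe_sum: "degree q \<le> n \<Longrightarrow> upe q z = (\<Sum>i\<le>n. of_real (coeff q i) * z ^ i)"
proof -
  assume a: "degree q \<le> n"
  have "degree (map_poly of_real q :: 'a poly) \<le> n"
    using map_poly_degree_leq[of of_real q] a by (metis order_trans)
  then show ?thesis unfolding upe_def
    by (subst poly_sum_le) (auto simp: coeff_map_poly)
qed

lemma ev_sum: "degree p \<le> n \<Longrightarrow> ev p z w = (\<Sum>j\<le>n. upe (coeff p j) z * w ^ j)"
proof -
  assume a: "degree p \<le> n"
  have "degree (map_poly (\<lambda>q. upe q z) p) \<le> n"
    using map_poly_degree_leq[of "\<lambda>q. upe q z" p] a by (metis order_trans)
  then show ?thesis unfolding ev_def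
    by (subst poly_sum_le) (auto simp: coeff_map_poly)
qed

lemma ev_eq_bpoly: "\<exists>N. \<forall>z w. bpoly N (\<lambda>i j. coeff (coeff p j) i) z w = ev p z w"
proof -
  \<comment> \<open>\<open>bpoly\<close> bounds both exponents by one number, so \<open>N\<close>
    must dominate the degree of \<open>p\<close> and those of all its coefficients.\<close>
  define N where "N = Max (insert (degree p) ((\<lambda>j. degree (coeff p j)) ` {..degree p}))"
  have 1: "degree p \<le> N" by (simp add: N_def)
  have 2: "degree (coeff p j) \<le> N" for j
  proof (cases "j \<le> degree p")
    case True
    then show ?thesis unfolding N_def by (intro Max_ge) auto
  qed (simp add: coeff_eq_0)
  have "bpoly N (\<lambda>i j. coeff (coeff p j) i) z w = ev p z w" for z w
    unfolding bpoly_def ev_sum[OF 1] upe_sum[OF 2]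
    by (subst sum.swap) (simp add: sum_distrib_right)
  then show ?thesis by blast
qed

section \<open>Flatness along a smooth curve\<close>

primrec times_differentiable :: "nat \<Rightarrow> (real \<Rightarrow> real) \<Rightarrow> bool" where
  "times_differentiable 0 h = True"
| "times_differentiable (Suc n) h = (\<exists>h'. (\<forall>t. (h has_field_derivative h' t) (at t)) \<and> times_differentiable n h')"

definition smooth1 :: "(real \<Rightarrow> real) \<Rightarrow> bool" where
  "smooth1 h \<longleftrightarrow> (\<forall>n. times_differentiable n h)"

lemma times_differentiable_Suc_imp: "times_differentiable (Suc n) h \<Longrightarrow> times_differentiable n h"
  by (induction n arbitrary: h) (simp, metis times_differentiable.simps(2))

lemma times_differentiable_const: "times_differentiable n (\<lambda>t. c)"
  by (induction n arbitrary: c) (auto intro!: exI[of _ "\<lambda>_. 0"])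

lemma times_differentiable_add: "times_differentiable n f \<Longrightarrow> times_differentiable n g \<Longrightarrow> times_differentiable n (\<lambda>t. f t + g t)"
proof (induction n arbitrary: f g)
  case (Suc n)
  then obtain f' g' where
    "\<forall>t. (f has_field_derivative f' t) (at t)" "times_differentiable n f'"
    "\<forall>t. (g has_field_derivative g' t) (at t)" "times_differentiable n g'" by auto
  with Suc.IH[of f' g'] show ?case
    by (auto intro!: exI[of _ "\<lambda>t. f' t + g' t"] DERIV_add)
qed simp

lemma times_differentiable_mult: "times_differentiable n f \<Longrightarrow> times_differentiable n g \<Longrightarrow> times_differentiable n (\<lambda>t. f t * g t)"
proof (induction n arbitrary: f g)
  case (Suc n)
  obtain f' g' where *:
    "\<forall>t. (f has_field_derivative f' t) (at t)" "times_differentiable n f'"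
    "\<forall>t. (g has_field_derivative g' t) (at t)" "times_differentiable n g'" using Suc.prems by auto
  have "times_differentiable n f" "times_differentiable n g" using Suc.prems times_differentiable_Suc_imp by blast+
  then have "times_differentiable n (\<lambda>t. f' t * g t + g' t * f t)"
    by (intro times_differentiable_add Suc.IH *)
  with * show ?case
    by (auto intro!: exI[of _ "\<lambda>t. f' t * g t + g' t * f t"] DERIV_mult)
qed simp

lemma smooth1_const [simp]: "smooth1 (\<lambda>t. c)"
  by (simp add: smooth1_def times_differentiable_const)

lemma smooth1_add [intro]: "smooth1 f \<Longrightarrow> smooth1 g \<Longrightarrow> smooth1 (\<lambda>t. f t + g t)"
  by (simp add: smooth1_def times_differentiable_add)

lemma smooth1_mult [intro]: "smooth1 f \<Longrightarrow> smooth1 g \<Longrightarrow> smooth1 (\<lambda>t. f t * g t)"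
  by (simp add: smooth1_def times_differentiable_mult)

lemma smooth1_diff [intro]: "smooth1 f \<Longrightarrow> smooth1 g \<Longrightarrow> smooth1 (\<lambda>t. f t - g t)"
  using smooth1_add[of f "\<lambda>t. (-1) * g t"] smooth1_mult[of "\<lambda>_. -1" g] by simp

lemma smooth1_DERIV:
  assumes "smooth1 h"
  shows "(h has_field_derivative deriv h t) (at t)" and "smooth1 (deriv h)"
proof -
  have d: "(h has_field_derivative deriv h t) (at t)" for t
    using assms unfolding smooth1_def by (metis times_differentiable.simps(2) DERIV_imp_deriv)
  then show "(h has_field_derivative deriv h t) (at t)" .
  have "times_differentiable n (deriv h)" for n
  proof -
    obtain h' where h': "\<forall>t. (h has_field_derivative h' t) (at t)" "times_differentiable n h'"
      using assms unfolding smooth1_def by (metis times_differentiable.simps(2))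
    then have "h' = deriv h" by (auto simp: fun_eq_iff intro!: DERIV_imp_deriv[symmetric])
    with h' show ?thesis by simp
  qed
  then show "smooth1 (deriv h)" by (simp add: smooth1_def)
qed

lemma smooth1I:
  assumes "\<And>t. (h has_field_derivative h' t) (at t)" "smooth1 h'"
  shows "smooth1 h"
  unfolding smooth1_def
proof
  fix n show "times_differentiable n h" using assms by (cases n) (auto simp: smooth1_def)
qed

lemma smooth1_funpow: "smooth1 h \<Longrightarrow> smooth1 ((deriv ^^ n) h)"
  by (induction n) (auto intro: smooth1_DERIV)

lemma smooth1_cont: "smooth1 h \<Longrightarrow> isCont h t"
  using smooth1_DERIV(1) DERIV_isCont by blast

lemma smooth1_upe: "smooth1 x \<Longrightarrow> smooth1 (\<lambda>t. upe q (x t))"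
  by (induction q) auto

lemma smooth1_ev: "smooth1 x \<Longrightarrow> smooth1 y \<Longrightarrow> smooth1 (\<lambda>t. ev p (x t) (y t))"
  by (induction p) (auto intro!: smooth1_upe)

text \<open>Maclaurin's formula leaves only its remainder, evaluated at a point squeezed towards
  \<open>t0\<close>. This limit stands in for the leading term of a power series, since the curve
  need not be analytic.\<close>

lemma smooth1_taylor_limit:
  assumes h: "smooth1 h" and z: "\<And>k. k < m \<Longrightarrow> (deriv ^^ k) h t0 = 0"
  shows "((\<lambda>t. h t / (t - t0) ^ m) \<longlongrightarrow> (deriv ^^ m) h t0 / fact m) (at t0)"
proof (rule tendstoI)
  fix e :: real assume e: "e > 0"
  let ?D = "\<lambda>n t. (deriv ^^ n) h (t0 + t)"
  have "((\<lambda>t. (deriv ^^ m) h t / fact m) \<longlongrightarrow> (deriv ^^ m) h t0 / fact m) (at t0)"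
    using smooth1_cont[OF smooth1_funpow[OF h]] by (intro tendsto_intros) (auto simp: isCont_def)
  from tendstoD[OF this e] obtain d where d: "d > 0"
    "\<And>t. t \<noteq> t0 \<Longrightarrow> dist t t0 < d \<Longrightarrow> dist ((deriv ^^ m) h t / fact m) ((deriv ^^ m) h t0 / fact m) < e"
    unfolding eventually_at by auto
  have "dist (h t / (t - t0) ^ m) ((deriv ^^ m) h t0 / fact m) < e"
    if t: "t \<noteq> t0" "dist t t0 < d" for t
  proof -
    have D: "((deriv ^^ k) h has_field_derivative (deriv ^^ Suc k) h s) (at s)" for k s
      using smooth1_DERIV(1)[OF smooth1_funpow[OF h]] by simp
    have "\<forall>k s. k < m \<and> \<bar>s\<bar> \<le> \<bar>t - t0\<bar> \<longrightarrow> DERIV (?D k) s :> ?D (Suc k) s"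
    proof (intro allI impI)
      fix k s
      have "((\<lambda>s. (deriv ^^ k) h (t0 + s)) has_field_derivative (deriv ^^ Suc k) h (t0 + s) * 1) (at s)"
        by (rule DERIV_chain'[where f="\<lambda>s. t0 + s", OF _ D]) (auto intro!: derivative_eq_intros)
      then show "DERIV (?D k) s :> ?D (Suc k) s" by simp
    qed
    from Maclaurin_bi_le[of ?D "\<lambda>s. h (t0 + s)" m "t - t0", OF _ this]
    obtain s where s: "\<bar>s\<bar> \<le> \<bar>t - t0\<bar>"
      "h t = (\<Sum>k<m. ?D k 0 / fact k * (t - t0) ^ k) + ?D m s / fact m * (t - t0) ^ m"
      by auto
    have "(\<Sum>k<m. ?D k 0 / fact k * (t - t0) ^ k) = 0"
      using z by (intro sum.neutral) auto
    with s t have "h t / (t - t0) ^ m = (deriv ^^ m) h (t0 + s) / fact m" by simp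
    moreover have "dist ((deriv ^^ m) h (t0 + s) / fact m) ((deriv ^^ m) h t0 / fact m) < e"
      using d(2)[of "t0 + s"] s t e by (cases "s = 0") (auto simp: dist_real_def)
    ultimately show ?thesis by simp
  qed
  with d(1) show "\<forall>\<^sub>F t in at t0. dist (h t / (t - t0) ^ m) ((deriv ^^ m) h t0 / fact m) < e"
    unfolding eventually_at by blast
qed

text \<open>Vanishing to infinite order, phrased by decay rather than by derivatives, so that
  products need no Leibniz rule.\<close>

definition flat :: "(real \<Rightarrow> real) \<Rightarrow> real \<Rightarrow> bool" where
  "flat h t0 \<longleftrightarrow> (\<forall>m. ((\<lambda>t. h t / (t - t0) ^ m) \<longlongrightarrow> 0) (at t0))"

lemma flat_cases:
  assumes "smooth1 h"
  obtains "flat h t0" | m c where "c \<noteq> 0" "((\<lambda>t. h t / (t - t0) ^ m) \<longlongrightarrow> c) (at t0)"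
proof (cases "\<forall>k. (deriv ^^ k) h t0 = 0")
  case True
  then have "flat h t0"
    unfolding flat_def using smooth1_taylor_limit[OF assms, of _ t0] by fastforce
  then show ?thesis using that by blast
next
  case False
  define m where "m = (LEAST k. (deriv ^^ k) h t0 \<noteq> 0)"
  have "(deriv ^^ m) h t0 \<noteq> 0" unfolding m_def using False by (metis (mono_tags, lifting) LeastI)
  moreover have "\<And>k. k < m \<Longrightarrow> (deriv ^^ k) h t0 = 0" unfolding m_def using not_less_Least by blast
  ultimately show ?thesis
    using smooth1_taylor_limit[OF assms, of m t0] that(2)[of "(deriv ^^ m) h t0 / fact m" m] by simp
qed

lemma lim_ratio_nonflat:
  assumes "c \<noteq> 0" "((\<lambda>t. h t / (t - t0) ^ m) \<longlongrightarrow> c) (at t0)"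
  shows "\<not> flat h t0"
proof
  assume "flat h t0"
  then have "((\<lambda>t. h t / (t - t0) ^ m) \<longlongrightarrow> 0) (at t0)" by (simp add: flat_def)
  with assms show False using tendsto_unique[of "at t0"] by (metis at_neq_bot)
qed

lemma nonflat_nonzero:
  assumes "smooth1 h" "\<not> flat h t0"
  shows "\<forall>\<^sub>F t in at t0. h t \<noteq> 0"
proof (rule flat_cases[OF assms(1), of t0])
  fix m and c :: real
  assume c: "c \<noteq> 0" "((\<lambda>t. h t / (t - t0) ^ m) \<longlongrightarrow> c) (at t0)"
  from tendsto_imp_eventually_ne[OF c(2) c(1)] show ?thesis
    by (rule eventually_mono) auto
qed (use assms in auto)

lemma flat_zero: "flat h t0 \<Longrightarrow> isCont h t0 \<Longrightarrow> h t0 = 0"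
  unfolding flat_def isCont_def by (drule spec[of _ 0]) (simp add: LIM_unique)

lemma flat_deriv:
  assumes "flat h t0" "(h has_field_derivative d) (at t0)"
  shows "d = 0"
proof -
  have "h t0 = 0" using flat_zero[OF assms(1)] assms(2) DERIV_isCont by blast
  then have "((\<lambda>t. h t / (t - t0)) \<longlongrightarrow> d) (at t0)"
    using assms(2) unfolding has_field_derivative_iff by simp
  moreover have "((\<lambda>t. h t / (t - t0)) \<longlongrightarrow> 0) (at t0)"
    using assms(1) unfolding flat_def by (metis (no_types, lifting) ext power_one_right)
  ultimately show ?thesis using LIM_unique by blast
qed

lemma flat_add: "flat f t0 \<Longrightarrow> flat g t0 \<Longrightarrow> flat (\<lambda>t. f t + g t) t0"
  unfolding flat_def add_divide_distrib using tendsto_add[of _ 0 _ _ 0] by fastforce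

lemma flat_mult:
  assumes "flat f t0" "isCont g t0"
  shows "flat (\<lambda>t. f t * g t) t0"
  unfolding flat_def
proof
  fix m
  have "((\<lambda>t. f t / (t - t0) ^ m * g t) \<longlongrightarrow> 0 * g t0) (at t0)"
    using assms unfolding flat_def isCont_def by (intro tendsto_mult) auto
  then show "((\<lambda>t. f t * g t / (t - t0) ^ m) \<longlongrightarrow> 0) (at t0)" by simp
qed

text \<open>Leading coefficients multiply, so germs of finite order have a product of finite order.
  The flat germs thus form a prime ideal, although smooth germs have zero divisors.\<close>

lemma flat_prime:
  assumes "smooth1 f" "smooth1 g" "flat (\<lambda>t. f t * g t) t0"
  shows "flat f t0 \<or> flat g t0"
proof (rule ccontr)
  assume n: "\<not> ?thesis"
  obtain m c where c: "c \<noteq> 0" "((\<lambda>t. f t / (t - t0) ^ m) \<longlongrightarrow> c) (at t0)"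
    using flat_cases[OF assms(1)] n by metis
  obtain k d where d: "d \<noteq> 0" "((\<lambda>t. g t / (t - t0) ^ k) \<longlongrightarrow> d) (at t0)"
    using flat_cases[OF assms(2)] n by metis
  have "((\<lambda>t. f t * g t / (t - t0) ^ (m + k)) \<longlongrightarrow> c * d) (at t0)"
    using tendsto_mult[OF c(2) d(2)] by (simp add: power_add)
  with c d have "\<not> flat (\<lambda>t. f t * g t) t0" by (intro lim_ratio_nonflat[of "c * d"]) auto
  with assms show False by simp
qed

lemma flat_const_iff [simp]: "flat (\<lambda>t. c) t0 \<longleftrightarrow> c = 0"
  using flat_zero[of "\<lambda>t. c" t0] by (auto simp: flat_def)

lemma flat_power:
  assumes "smooth1 f" "flat (\<lambda>t. f t ^ n) t0"
  shows "flat f t0"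
  using assms(2)
proof (induction n)
  case (Suc n)
  have "smooth1 (\<lambda>t. f t ^ k)" for k
    by (induction k) (auto intro!: smooth1_mult assms)
  then show ?case using flat_prime[of f "\<lambda>t. f t ^ n" t0] assms(1) Suc by auto
qed auto

text \<open>Once the full power of X - x(t0) is split off, the cofactor is non-zero at x(t0) and
  hence not flat; primality passes flatness to x - x(t0).\<close>

lemma flat_upe:
  assumes "smooth1 x" "R \<noteq> 0" "flat (\<lambda>t. upe R (x t)) t0"
  shows "flat (\<lambda>t. x t - x t0) t0"
proof -
  let ?l = "[:- x t0, 1:]"
  obtain q where q: "R = ?l ^ order (x t0) R * q" "\<not> ?l dvd q"
    using order_decomp[OF assms(2), of "x t0"] by blast
  define n where "n = order (x t0) R"
  have upp: "upe (?l ^ n) s = (s - x t0) ^ n" for s :: real and n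
    by (induction n) (simp_all only: power_0 power_Suc upe_mult, auto)
  have s: "smooth1 (\<lambda>t. x t - x t0)" by (intro smooth1_diff assms) simp
  have sp: "smooth1 (\<lambda>t. (x t - x t0) ^ k)" for k
    by (induction k) (auto intro!: smooth1_mult s)
  have "flat (\<lambda>t. (x t - x t0) ^ n * upe q (x t)) t0"
    using assms(3) q(1) unfolding n_def[symmetric] by (simp add: upp)
  then have "flat (\<lambda>t. (x t - x t0) ^ n) t0 \<or> flat (\<lambda>t. upe q (x t)) t0"
    by (rule flat_prime[OF sp smooth1_upe[OF assms(1)]])
  moreover have "\<not> flat (\<lambda>t. upe q (x t)) t0"
  proof
    assume "flat (\<lambda>t. upe q (x t)) t0"
    then have "upe q (x t0) = 0"
      using flat_zero[OF _ smooth1_cont[OF smooth1_upe[OF assms(1)]]] by metis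
    with q(2) show False by (simp add: upe_real dvd_iff_poly_eq_0)
  qed
  ultimately show ?thesis using flat_power[OF s] by blast
qed

section \<open>The ideal of polynomials that are flat on a regular curve at one parameter\<close>

locale regular_curve =
  fixes x y :: "real \<Rightarrow> real"
  assumes sx: "smooth1 x" and sy: "smooth1 y"
    and reg: "deriv x t \<noteq> 0 \<or> deriv y t \<noteq> 0"
begin

definition fl :: "real poly poly \<Rightarrow> real \<Rightarrow> bool" where
  "fl p t0 = flat (\<lambda>t. ev p (x t) (y t)) t0"

lemma smooth1_ev_curve: "smooth1 (\<lambda>t. ev p (x t) (y t))"
  by (rule smooth1_ev[OF sx sy])

lemma fl_mult_iff: "fl (p * q) t0 \<longleftrightarrow> fl p t0 \<or> fl q t0"
  unfolding fl_def ev_mult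
  using flat_prime[OF smooth1_ev_curve smooth1_ev_curve] flat_mult[OF _ smooth1_cont[OF smooth1_ev_curve]]
  by (metis (no_types, lifting) ext mult.commute)

lemma fl_add: "fl p t0 \<Longrightarrow> fl q t0 \<Longrightarrow> fl (p + q) t0"
  unfolding fl_def ev_add by (rule flat_add)

lemma fl_diff: "fl p t0 \<Longrightarrow> fl q t0 \<Longrightarrow> fl (p - q) t0"
  using fl_add[of p t0 "(-1) * q"] fl_mult_iff[of "-1" q t0] by simp

lemma fl_zero: "fl p t0 \<Longrightarrow> ev p (x t0) (y t0) = 0"
  unfolding fl_def using flat_zero smooth1_cont[OF smooth1_ev_curve] by blast

lemma fl_1: "\<not> fl 1 t0"
  by (simp add: fl_def)

lemma fl_prime_factor: "p \<noteq> 0 \<Longrightarrow> fl p t0 \<Longrightarrow> \<exists>f. prime_elem f \<and> f dvd p \<and> fl f t0"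
proof (induction p rule: prime_divisors_induct)
  case (unit p)
  then obtain q where "1 = p * q" by (auto simp: dvd_def)
  then show ?case using unit fl_mult_iff[of p q t0] fl_1 by metis
next
  case (factor q p)
  then show ?case
    by (metis dvd_mult dvd_triv_left fl_mult_iff mult_zero_right prime_imp_prime_elem)
qed simp

text \<open>On a regular curve the prime ideal of flat polynomials is principal. Take a non-zero
  element of least degree in the second variable. If that degree is positive, pseudo-division makes
  a flat prime factor of it divide every flat polynomial. If it is zero, x - x(t0) is flat, and then
  y - y(t0) cannot be flat as well, since the velocity is non-zero.\<close>

lemma fl_dvd:
  assumes f: "prime_elem f" "fl f t0" and g: "fl g t0"
  shows "f dvd g"
proof -
  \<comment> \<open>It suffices to find a flat non-unit \<open>e\<close> dividing all flat
    polynomials: \<open>f\<close> is a multiple of \<open>e\<close>, and its primality makes it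
    divide \<open>e\<close> in return.\<close>
  have *: "f dvd g" if e: "fl e t0" "\<not> is_unit e" "\<And>h. fl h t0 \<Longrightarrow> e dvd h" for e
  proof -
    obtain k where k: "f = e * k" using e(3)[OF f(2)] by (auto simp: dvd_def)
    then have "f dvd e \<or> f dvd k" using f(1) by (metis prime_elem_dvd_multD dvd_refl)
    then have "f dvd e"
    proof
      assume "f dvd k"
      then obtain l where "k = f * l" by (auto simp: dvd_def)
      with k have "f * 1 = f * (e * l)" by (simp add: mult.left_commute)
      then have "1 = e * l" using f(1) by (metis mult_cancel_left prime_elem_not_zeroI)
      with e(2) show ?thesis by (metis dvdI)
    qed
    from dvd_trans[OF this e(3)[OF g]] show ?thesis .
  qed
  define P where "P p \<longleftrightarrow> p \<noteq> 0 \<and> fl p t0" for p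
  have Pf: "P f" using f by (auto simp: P_def)
  define e0 where "e0 = arg_min degree P"
  have e0: "P e0" "\<And>h. P h \<Longrightarrow> degree e0 \<le> degree h"
    using arg_min_nat_lemma[of P f degree] Pf by (auto simp: e0_def)
  show ?thesis
  proof (cases "degree e0 = 0")
    case False
    obtain e where e: "prime_elem e" "e dvd e0" "fl e t0"
      using fl_prime_factor e0(1) unfolding P_def by blast
    have de: "degree e > 0" using e0(2)[of e] e False by (auto simp: P_def)
    have dm: "degree e \<le> degree e0" using e e0(1) by (auto simp: P_def intro: dvd_imp_degree_le)
    have "e dvd h" if h: "fl h t0" for h
    proof -
      have e': "e \<noteq> 0" using e by auto
      \<comment> \<open>Division over polynomials in the first variable costs a factor
        \<open>a\<close>. The prime \<open>e\<close> cannot divide it, having positive degree in the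
        second variable.\<close>
      obtain a q where aq: "a \<noteq> 0" "smult a h = e * q + pseudo_mod h e"
        using pseudo_mod(1)[OF e'] by blast
      have r: "pseudo_mod h e = 0 \<or> degree (pseudo_mod h e) < degree e"
        by (rule pseudo_mod(2)[OF e'])
      have "pseudo_mod h e = [:a:] * h - e * q" using aq(2) by simp
      then have "fl (pseudo_mod h e) t0"
        using h e(3) by (metis fl_diff fl_mult_iff)
      then have "pseudo_mod h e = 0"
        using r e0(2)[of "pseudo_mod h e"] dm unfolding P_def by linarith
      with aq have "[:a:] * h = e * q" by simp
      then have "e dvd [:a:] * h" by simp
      then have "e dvd [:a:] \<or> e dvd h" using e(1) prime_elem_dvd_multD by blast
      moreover have "\<not> e dvd [:a:]"
        using de aq(1) dvd_imp_degree_le[of e "[:a:]"] by auto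
      ultimately show ?thesis by blast
    qed
    then show ?thesis using *[of e] e by auto
  next
    case True
    then obtain R where R: "e0 = [:R:]" by (metis degree_eq_zeroE)
    have R0: "R \<noteq> 0" using R e0(1) by (auto simp: P_def)
    have "flat (\<lambda>t. upe R (x t)) t0" using e0(1) R by (auto simp: P_def fl_def)
    then have flx: "flat (\<lambda>t. x t - x t0) t0" by (rule flat_upe[OF sx R0])
    have "((\<lambda>t. x t - x t0) has_field_derivative deriv x t0 - 0) (at t0)"
      by (intro DERIV_diff smooth1_DERIV sx) simp
    then have "deriv x t0 = 0" using flat_deriv[OF flx] by simp
    then have y': "deriv y t0 \<noteq> 0" using reg by blast
    define l where "l = [:[:- x t0, 1:]:]"
    have fll: "fl l t0" using flx by (simp add: l_def fl_def)
    have "l dvd h" if h: "fl h t0" for h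
    proof -
      \<comment> \<open>Substituting the constant x(t0) changes \<open>h\<close> by a multiple of
        the flat \<open>l\<close>, so the univariate polynomial \<open>H\<close> is flat along
        y.\<close>
      define h1 where "h1 = map_poly (\<lambda>q. [:poly q (x t0):]) h"
      define H where "H = map_poly (\<lambda>q. poly q (x t0)) h"
      have "l dvd h - h1"
        unfolding l_def const_poly_dvd_iff
        by (auto simp: h1_def coeff_map_poly dvd_iff_poly_eq_0)
      then have "fl (h - h1) t0" using fll by (metis dvdE fl_mult_iff)
      then have "fl (h - (h - h1)) t0" by (rule fl_diff[OF h])
      then have "fl h1 t0" by simp
      moreover have "ev h1 u v = upe H v" for u v :: real
        unfolding h1_def H_def by (induction h) (auto simp: map_poly_pCons)
      ultimately have fH: "flat (\<lambda>t. upe H (y t)) t0" by (simp add: fl_def)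
      have "H = 0"
      proof (rule ccontr)
        assume "H \<noteq> 0"
        from flat_upe[OF sy this fH] have "flat (\<lambda>t. y t - y t0) t0" .
        moreover have "((\<lambda>t. y t - y t0) has_field_derivative deriv y t0 - 0) (at t0)"
          by (intro DERIV_diff smooth1_DERIV sy) simp
        ultimately show False using flat_deriv y' by fastforce
      qed
      then have "poly (coeff h n) (x t0) = 0" for n
        using coeff_map_poly[of "\<lambda>q. poly q (x t0)" h n] by (simp add: H_def)
      then show ?thesis unfolding l_def const_poly_dvd_iff by (simp add: dvd_iff_poly_eq_0)
    qed
    moreover have "\<not> is_unit l" using fll fl_mult_iff fl_1 by (metis dvdE)
    ultimately show ?thesis using *[of l] fll by blast
  qed
qed

text \<open>A factor flat at one parameter is carried along the whole curve by connectedness. The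
  set of parameters where f is flat is open: g is not flat there, as f does not divide it, so f^m g
  = 0 forces f to vanish nearby. It is closed: a smooth function that is not flat has no zeros in
  some punctured neighbourhood.\<close>

lemma minimal_polynomial:
  assumes u0: "u \<noteq> 0" and u: "\<And>t. ev u (x t) (y t) = 0"
  shows "\<exists>f g m. prime_elem f \<and> u = f ^ m * g \<and> m > 0 \<and> \<not> f dvd g \<and>
    (\<forall>t. ev f (x t) (y t) = 0) \<and> (\<forall>h t. fl h t \<longrightarrow> f dvd h)"
proof -
  have "fl u 0" by (simp add: fl_def u)
  then obtain f where f: "prime_elem f" "f dvd u" "fl f 0" using fl_prime_factor[OF u0] by blast
  have nu: "\<not> is_unit f" using f(1) by auto
  obtain g where g: "u = f ^ multiplicity f u * g" "\<not> f dvd g"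
    using multiplicity_decompose'[OF u0 nu] by metis
  define m where "m = multiplicity f u"
  have m: "m > 0" unfolding m_def using f(2) g by (metis gr0I mult_1 power_0)
  let ?Z = "{t. fl f t}"
  have "open ?Z"
    unfolding open_dist
  proof
    fix t1 assume "t1 \<in> ?Z"
    then have t1: "fl f t1" by simp
    then have "\<not> fl g t1" using fl_dvd[OF f(1) t1] g(2) by blast
    then have "\<forall>\<^sub>F t in at t1. ev g (x t) (y t) \<noteq> 0"
      unfolding fl_def by (rule nonflat_nonzero[OF smooth1_ev_curve])
    then obtain d where d: "d > 0" "\<And>t. t \<noteq> t1 \<Longrightarrow> dist t t1 < d \<Longrightarrow> ev g (x t) (y t) \<noteq> 0"
      unfolding eventually_at by auto
    have z: "ev f (x t) (y t) = 0" if "dist t t1 < d" for t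
    proof (cases "t = t1")
      case True then show ?thesis using fl_zero[OF t1] by simp
    next
      case False
      have "ev f (x t) (y t) ^ m * ev g (x t) (y t) = 0"
        using u[of t] g(1) unfolding m_def[symmetric] by simp
      then show ?thesis using d(2)[OF False that] by simp
    qed
    have "t \<in> ?Z" if t: "dist t t1 < d" for t
    proof -
      have "\<forall>\<^sub>F s in at t. dist s t1 < d"
        using eventually_at_in_open'[of "ball t1 d" t] t by (simp add: dist_commute)
      then have "\<forall>\<^sub>F s in at t. ev f (x s) (y s) = 0" by (rule eventually_mono) (rule z)
      then have "((\<lambda>s. ev f (x s) (y s) / (s - t) ^ k) \<longlongrightarrow> 0) (at t)" for k
        by (intro tendsto_eventually) (auto elim!: eventually_mono)
      then show ?thesis by (simp add: fl_def flat_def)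
    qed
    with d(1) show "\<exists>e>0. \<forall>t. dist t t1 < e \<longrightarrow> t \<in> ?Z" by blast
  qed
  moreover have "closed ?Z"
    unfolding closed_def open_dist
  proof
    fix t1 assume "t1 \<in> - ?Z"
    then have "\<forall>\<^sub>F t in at t1. ev f (x t) (y t) \<noteq> 0"
      unfolding fl_def by (intro nonflat_nonzero[OF smooth1_ev_curve]) (simp add: fl_def)
    then obtain d where d: "d > 0" "\<And>t. t \<noteq> t1 \<Longrightarrow> dist t t1 < d \<Longrightarrow> ev f (x t) (y t) \<noteq> 0"
      unfolding eventually_at by auto
    then have "t \<in> - ?Z" if "dist t t1 < d" for t
      using that \<open>t1 \<in> - ?Z\<close> fl_zero[of f t] by (cases "t = t1") auto
    with d(1) show "\<exists>e>0. \<forall>t. dist t t1 < e \<longrightarrow> t \<in> - ?Z" by blast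
  qed
  ultimately have "?Z = UNIV" using f(3) clopen[of ?Z] by auto
  then have fa: "fl f t" for t by auto
  show ?thesis
    using f(1) g(1)[folded m_def] m g(2) fl_zero[OF fa] fl_dvd[OF f(1) fa] by blast
qed

end

section \<open>The invariant of a reflection-symmetric polynomial\<close>

lemma cubic_remainder:
  assumes "\<And>t::real. (h has_field_derivative h1 t) (at t)" "\<And>t. (h1 has_field_derivative h2 t) (at t)"
    "\<And>t. (h2 has_field_derivative h3 t) (at t)" and h: "smooth1 h" and "h 0 = 0" "h1 0 = 0"
  shows "((\<lambda>t. (h t - h2 0 / 2 * t\<^sup>2) / t ^ 3) \<longlongrightarrow> h3 0 / 6) (at 0)"
proof -
  define c where "c = h2 0"
  define r where "r = (\<lambda>t. h t - c / 2 * (t * t))"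
  have sr: "smooth1 r"
    unfolding r_def by (intro smooth1_diff smooth1_mult h) (auto intro: smooth1I[of _ "\<lambda>_. 1"])
  have d: "(r has_field_derivative (h1 t - c * t)) (at t)"
          "((\<lambda>t. h1 t - c * t) has_field_derivative (h2 t - c)) (at t)"
          "((\<lambda>t. h2 t - c) has_field_derivative h3 t) (at t)" for t
    unfolding r_def by (auto intro!: derivative_eq_intros assms)
  have e: "deriv r = (\<lambda>t. h1 t - c * t)" "deriv (\<lambda>t. h1 t - c * t) = (\<lambda>t. h2 t - c)"
          "deriv (\<lambda>t. h2 t - c) = h3"
    using d by (auto simp: fun_eq_iff intro!: DERIV_imp_deriv)
  have r0: "r 0 = 0" using assms by (simp add: r_def)
  have z: "(deriv ^^ j) r 0 = 0" if "j < 3" for j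
  proof -
    consider "j = 0" | "j = 1" | "j = 2" using \<open>j < 3\<close> by linarith
    then show ?thesis
      by cases (use assms r0 in \<open>auto simp: e numeral_2_eq_2\<close>, simp add: c_def)
  qed
  have "((\<lambda>t. r t / (t - 0) ^ 3) \<longlongrightarrow> (deriv ^^ 3) r 0 / fact 3) (at 0)"
    by (rule smooth1_taylor_limit[OF sr z])
  moreover have "(deriv ^^ 3) r 0 = h3 0" by (simp add: numeral_3_eq_3 e)
  ultimately show ?thesis by (simp add: r_def c_def fact_numeral power2_eq_square)
qed

text \<open>Write h = t^2 a with a(0) = A and a'(0) = B. Since t^2 is even, a^m g is even too, so
  its derivative m A^(m-1) B g(0) + A^m g'(0) at 0 vanishes; cancel A^(m-1).\<close>

lemma even_cubic_relation:
  fixes h g :: "real \<Rightarrow> real"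
  assumes lim: "((\<lambda>t. (h t - A * t\<^sup>2) / t ^ 3) \<longlongrightarrow> B) (at 0)"
    and g: "(g has_field_derivative g1) (at 0)"
    and even: "\<And>t. h t ^ m * g t = h (- t) ^ m * g (- t)" and A: "A \<noteq> 0" and m: "m > 0"
  shows "of_nat m * B * g 0 + A * g1 = 0"
proof -
  \<comment> \<open>The value \<open>A\<close> at 0 makes the quotient differentiable there, with
    derivative \<open>B\<close> by \<open>lim\<close>.\<close>
  define a where "a = (\<lambda>t. if t = 0 then A else h t / t\<^sup>2)"
  have "(a has_field_derivative B) (at 0)"
    unfolding has_field_derivative_iff
  proof (rule Lim_transform_eventually[OF lim])
    show "\<forall>\<^sub>F t in at 0. (h t - A * t\<^sup>2) / t ^ 3 = (a (t) - a 0) / (t - 0)"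
      unfolding eventually_at
      by (rule exI[of _ 1]) (auto simp: a_def field_simps power2_eq_square power3_eq_cube)
  qed
  then have d: "((\<lambda>t. a t ^ m * g t) has_field_derivative (of_nat m * (B * A ^ (m - 1)) * g 0 + g1 * A ^ m)) (at 0)"
    by (auto intro!: derivative_eq_intros g simp: a_def)
  have e: "a (- t) ^ m * g (- t) = a t ^ m * g t" for t
  proof (cases "t = 0")
    case False
    then show ?thesis using even[of t] by (simp add: a_def power_divide)
  qed simp
  have "((\<lambda>t. a (- t) ^ m * g (- t)) has_field_derivative - (of_nat m * (B * A ^ (m - 1)) * g 0 + g1 * A ^ m)) (at 0)"
    using DERIV_mirror[of "\<lambda>t. a t ^ m * g t" _ 0] d by simp
  then have "of_nat m * (B * A ^ (m - 1)) * g 0 + g1 * A ^ m = 0"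
    using DERIV_unique[OF d, of "- (of_nat m * (B * A ^ (m - 1)) * g 0 + g1 * A ^ m)"]
    unfolding e by linarith
  moreover have "A ^ m = A * A ^ (m - 1)" using m by (cases m) auto
  ultimately have "A ^ (m - 1) * (of_nat m * B * g 0 + A * g1) = 0" by (simp add: algebra_simps)
  with A show ?thesis by simp
qed

section \<open>Gradient, Hessian form and elimination of the square root\<close>

lemma upe_of_real: "upe q (of_real a) = of_real (upe q a)"
  by (induction q) auto

lemma ev_of_real: "ev p (of_real a) (of_real b) = of_real (ev p a b)"
  by (induction p) (auto simp: upe_of_real)

definition gradsq :: "real poly poly \<Rightarrow> real poly poly" where
  "gradsq f = (dx f)\<^sup>2 + (dy f)\<^sup>2"

text \<open>The Hessian applied to the gradient turned by a right angle: on a level curve, the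
  second tangential derivative times the squared length of the gradient.\<close>

definition hess :: "real poly poly \<Rightarrow> real poly poly" where
  "hess f = dx (dx f) * (dy f)\<^sup>2 - 2 * dy (dx f) * dx f * dy f + dy (dy f) * (dx f)\<^sup>2"

lemma ev_numeral [simp]: "ev (numeral k) z w = numeral k"
proof -
  have n: "ev (of_nat j) z w = of_nat j" for j by (induction j) auto
  show ?thesis using n[of "numeral k"] by simp
qed

lemma ev_gradsq: "ev (gradsq f) z w = (ev (dx f) z w)\<^sup>2 + (ev (dy f) z w)\<^sup>2"
  by (simp add: gradsq_def)

lemma ev_hess: "ev (hess f) z w = ev (dx (dx f)) z w * (ev (dy f) z w)\<^sup>2
   - 2 * ev (dy (dx f)) z w * ev (dx f) z w * ev (dy f) z w + ev (dy (dy f)) z w * (ev (dx f) z w)\<^sup>2"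
  by (simp add: hess_def)

text \<open>The pair (A, B) encodes A + w B = (w S + H)^n in the ring obtained by adjoining a square
  root w of S.\<close>

primrec conj_pow :: "nat \<Rightarrow> 'a::comm_ring_1 \<Rightarrow> 'a \<Rightarrow> 'a \<times> 'a" where
  "conj_pow 0 S H = (1, 0)"
| "conj_pow (Suc n) S H = (let (A, B) = conj_pow n S H in (H * A + S * S * B, S * A + H * B))"

lemma conj_pow_eq:
  fixes w :: "'a::real_normed_field"
  assumes "w\<^sup>2 = ev S a b"
  shows "ev (fst (conj_pow n S H)) a b + w * ev (snd (conj_pow n S H)) a b = (w * ev S a b + ev H a b) ^ n"
proof (induction n)
  case (Suc n)
  have "(H' * A + S' * S' * B) + w * (S' * A + H' * B) = (w * S' + H') * (A + w * B)"
    if "w\<^sup>2 = S'" for A B S' H' :: 'a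
    unfolding that[symmetric] by (simp add: algebra_simps power2_eq_square)
  from this[OF assms] show ?case
    by (simp add: Suc[symmetric] Let_def case_prod_beta)
qed simp

lemma conj_pow_zero:
  assumes "ev S a b = 0" "ev H a b = 0" "n > 0"
  shows "ev (fst (conj_pow n S H)) a b = 0" "ev (snd (conj_pow n S H)) a b = 0"
  using assms by (cases n; simp add: Let_def case_prod_beta)+

text \<open>A prime polynomial depends on at least one variable, and the derivative in that variable
  is non-zero of smaller degree in it.\<close>

lemma prime_not_dvd_gradient:
  assumes "prime_elem f"
  shows "\<not> f dvd dx f \<or> \<not> f dvd dy f"
proof (cases "degree f = 0")
  case False
  then have "dy f \<noteq> 0" by (simp add: dy_def pderiv_eq_0_iff)
  moreover have "degree (dy f) < degree f" using False by (simp add: dy_def degree_pderiv)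
  ultimately show ?thesis using dvd_imp_degree_le by (metis not_le)
next
  case True
  then obtain R where R: "f = [:R:]" by (metis degree_eq_zeroE)
  have "\<not> f dvd dx f"
  proof
    assume "f dvd dx f"
    then have "R dvd pderiv R"
      using R by (simp add: dx_pCons const_poly_dvd_const_poly_iff)
    moreover have "degree R \<noteq> 0"
    proof
      assume "degree R = 0"
      then obtain c where c: "R = [:c:]" by (metis degree_eq_zeroE)
      have "c \<noteq> 0" using assms R c by auto
      then have "is_unit f" unfolding R c by (simp add: is_unit_const_poly_iff dvd_field_iff)
      with assms show False by auto
    qed
    then have "pderiv R \<noteq> 0" "degree (pderiv R) < degree R"
      by (auto simp: pderiv_eq_0_iff degree_pderiv)
    ultimately show False using dvd_imp_degree_le by (metis not_le)
  qed
  then show ?thesis ..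
qed

text \<open>The equations for \<open>T1\<close> and \<open>T2\<close> are the Frenet equations of a
  unit-speed curve (X, Y). The offset \<open>\<rho>\<close> is signed so that both parallel curves
  are instances, and 1 - \<open>\<rho>\<close> k is the signed speed of the parallel curve.\<close>

locale parallel_frame =
  fixes X Y T1 T2 k :: "real \<Rightarrow> real" and \<rho> :: real
  assumes DX: "(X has_field_derivative T1 t) (at t)"
    and DY: "(Y has_field_derivative T2 t) (at t)"
    and DT1: "(T1 has_field_derivative - k t * T2 t) (at t)"
    and DT2: "(T2 has_field_derivative k t * T1 t) (at t)"
    and sT1: "smooth1 T1" and sT2: "smooth1 T2" and sk: "smooth1 k"
    and unit: "(T1 t)\<^sup>2 + (T2 t)\<^sup>2 = 1"
    and \<rho>0: "\<rho> \<noteq> 0" and mu_ne: "1 - \<rho> * k t \<noteq> 0"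
begin

definition \<mu> where "\<mu> t = 1 - \<rho> * k t"
definition x where "x t = X t - \<rho> * T2 t"
definition y where "y t = Y t + \<rho> * T1 t"

lemma mu0: "\<mu> t \<noteq> 0" using mu_ne by (simp add: \<mu>_def)

lemma Dk: "(k has_field_derivative deriv k t) (at t)"
  by (rule smooth1_DERIV[OF sk])

lemma Dmu: "(\<mu> has_field_derivative - \<rho> * deriv k t) (at t)"
  unfolding \<mu>_def by (auto intro!: derivative_eq_intros Dk)

lemma Dx: "(x has_field_derivative \<mu> t * T1 t) (at t)"
  unfolding x_def \<mu>_def by (auto intro!: derivative_eq_intros DX DT2 simp: algebra_simps)

lemma Dy: "(y has_field_derivative \<mu> t * T2 t) (at t)"
  unfolding y_def \<mu>_def by (auto intro!: derivative_eq_intros DY DT1 simp: algebra_simps)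

sublocale regular_curve x y
proof
  have sm: "smooth1 \<mu>" unfolding \<mu>_def[abs_def] by (intro smooth1_diff smooth1_mult sk) auto
  show "smooth1 x" by (rule smooth1I[OF Dx]) (intro smooth1_mult sm sT1)
  show "smooth1 y" by (rule smooth1I[OF Dy]) (intro smooth1_mult sm sT2)
  fix t
  have "deriv x t = \<mu> t * T1 t" "deriv y t = \<mu> t * T2 t"
    using Dx Dy DERIV_imp_deriv by blast+
  then show "deriv x t \<noteq> 0 \<or> deriv y t \<noteq> 0" using unit[of t] mu0[of t] by auto
qed

abbreviation E where "E p t \<equiv> ev p (x t) (y t)"

lemma DE: "((\<lambda>t. E p t) has_field_derivative \<mu> t * (E (dx p) t * T1 t + E (dy p) t * T2 t)) (at t)"
  using ev_chain[OF Dx Dy, of p t] by (simp add: algebra_simps)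

text \<open>(\<open>cx\<close>, \<open>cy\<close>) runs round the circle of radius
  |\<open>\<rho>\<close>| about the base point, starting on the parallel curve at t = 0; reflection
  in the normal is the change of sign of t.\<close>

definition cx where "cx s t = X s + \<rho> * (sin t * T1 s - cos t * T2 s)"
definition cy where "cy s t = Y s + \<rho> * (cos t * T1 s + sin t * T2 s)"

lemma c0 [simp]: "cx s 0 = x s" "cy s 0 = y s"
  by (auto simp: cx_def cy_def x_def y_def)

lemma Dc: "(cx s has_field_derivative \<rho> * (cos t * T1 s + sin t * T2 s)) (at t)"
          "(cy s has_field_derivative \<rho> * (cos t * T2 s - sin t * T1 s)) (at t)"
  unfolding cx_def cy_def by (auto intro!: derivative_eq_intros simp: algebra_simps)

definition sym_poly where
  "sym_poly p \<longleftrightarrow> (\<forall>s t. ev p (cx s t) (cy s t) = ev p (cx s (- t)) (cy s (- t)))"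

lemma Dec: "((\<lambda>t. ev p (cx s t) (cy s t)) has_field_derivative
   (\<rho> * (ev (dx p) (cx s t) (cy s t) * (cos t * T1 s + sin t * T2 s)
        + ev (dy p) (cx s t) (cy s t) * (cos t * T2 s - sin t * T1 s)))) (at t)"
  using ev_chain[OF Dc(1)[where s=s and t=t] Dc(2)[where s=s and t=t], of p] by (simp add: algebra_simps)

lemma smooth1_sin_cos: "smooth1 sin" "smooth1 cos"
proof -
  have "times_differentiable n (\<lambda>t. a * sin t + b * cos t)" for a b n
  proof (induction n arbitrary: a b)
    case (Suc n)
    then show ?case
      by (auto intro!: exI[of _ "\<lambda>t. (- b) * sin t + a * cos t"] derivative_eq_intros)
  qed simp
  from this[of _ 1 0] this[of _ 0 1] show "smooth1 sin" "smooth1 cos"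
    by (auto simp: smooth1_def)
qed

lemma smooth1_circle: "smooth1 (\<lambda>t. ev p (cx s t) (cy s t))"
  unfolding cx_def cy_def
  by (intro smooth1_ev smooth1_add smooth1_mult smooth1_diff smooth1_const smooth1_sin_cos)

text \<open>At t = 0 the circle is tangent to the parallel curve, so evenness on the circle kills
  the derivative of p along the curve.\<close>

lemma sym_poly_const:
  assumes "sym_poly p"
  obtains c where "\<And>t. E p t = c"
proof -
  have t0: "E (dx p) s * T1 s + E (dy p) s * T2 s = 0" for s
  proof -
    let ?d = "\<rho> * (E (dx p) s * T1 s + E (dy p) s * T2 s)"
    have d: "((\<lambda>t. ev p (cx s t) (cy s t)) has_field_derivative ?d) (at 0)"
      using Dec[of p s 0] by simp
    have "((\<lambda>t. ev p (cx s (- t)) (cy s (- t))) has_field_derivative - ?d) (at 0)"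
      using DERIV_mirror[of "\<lambda>t. ev p (cx s t) (cy s t)" _ 0] d by simp
    moreover have "(\<lambda>t. ev p (cx s (- t)) (cy s (- t))) = (\<lambda>t. ev p (cx s t) (cy s t))"
      using assms by (auto simp: sym_poly_def)
    ultimately have "?d = - ?d" using DERIV_unique[OF d] by metis
    then have "?d = 0" by linarith
    with \<rho>0 show ?thesis by simp
  qed
  have "((\<lambda>t. E p t) has_field_derivative 0) (at t)" for t
    using DE[of p t] t0[of t] by simp
  then have "E p t = E p 0" for t using DERIV_isconst_all[of "E p" t 0] by blast
  then show ?thesis using that by blast
qed

text \<open>\<open>w\<close> is the normal derivative of f. Differentiating f = 0 along the parallel
  curve yields the first two claims and a third-order companion. Inserted into the cubic relation on
  the circle, they eliminate the second and third tangential derivatives of f; what remains is a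
  logarithmic derivative, integrated in the third claim.\<close>

lemma sym_poly_relation:
  assumes f: "\<And>t. E f t = 0" and sym: "sym_poly (f ^ m * g)" and m: "m > 0"
  defines "w \<equiv> \<lambda>t. E (dy f) t * T1 t - E (dx f) t * T2 t"
  shows "E (dx f) t * T1 t + E (dy f) t * T2 t = 0"
    and "\<mu> t * (E (dx (dx f)) t * (T1 t)\<^sup>2 + 2 * E (dy (dx f)) t * T1 t * T2 t + E (dy (dy f)) t * (T2 t)\<^sup>2)
           + k t * w t = 0"
    and "\<exists>C. \<forall>t. w t ^ (3 * m) * E g t ^ 3 / \<mu> t ^ m = C"
proof -
  have t0: "E (dx f) s * T1 s + E (dy f) s * T2 s = 0" for s
  proof -
    have "((\<lambda>t. E f t) has_field_derivative 0) (at s)" by (simp add: f)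
    from DERIV_unique[OF DE this] mu0[of s] show ?thesis by simp
  qed
  then show "E (dx f) t * T1 t + E (dy f) t * T2 t = 0" .
  \<comment> \<open>Derivatives of f in the directions tangent-tangent, then tangent-normal, then
    three times tangent.\<close>
  let ?tt = "\<lambda>s. E (dx (dx f)) s * (T1 s)\<^sup>2 + 2 * E (dy (dx f)) s * T1 s * T2 s + E (dy (dy f)) s * (T2 s)\<^sup>2"
  let ?tn = "\<lambda>s. (E (dy (dy f)) s - E (dx (dx f)) s) * T1 s * T2 s + E (dy (dx f)) s * ((T1 s)\<^sup>2 - (T2 s)\<^sup>2)"
  let ?ttt = "\<lambda>s. E (dx (dx (dx f))) s * T1 s ^ 3 + 3 * E (dy (dx (dx f))) s * (T1 s)\<^sup>2 * T2 s
     + 3 * E (dy (dy (dx f))) s * T1 s * (T2 s)\<^sup>2 + E (dy (dy (dy f))) s * T2 s ^ 3"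
  have tt: "\<mu> s * ?tt s + k s * w s = 0" for s
  proof -
    have "((\<lambda>t. E (dx f) t * T1 t + E (dy f) t * T2 t) has_field_derivative (\<mu> s * ?tt s + k s * w s)) (at s)"
      by (auto intro!: derivative_eq_intros DE DT1 DT2 simp: dx_dy w_def power2_eq_square) (simp add: algebra_simps)
    moreover have "((\<lambda>t. E (dx f) t * T1 t + E (dy f) t * T2 t) has_field_derivative 0) (at s)"
      by (simp add: t0)
    ultimately show ?thesis by (rule DERIV_unique)
  qed
  then show "\<mu> t * ?tt t + k t * w t = 0" .
  have Dw: "(w has_field_derivative \<mu> s * ?tn s) (at s)" for s
  proof -
    have "(w has_field_derivative (\<mu> s * ?tn s - k s * (E (dx f) s * T1 s + E (dy f) s * T2 s))) (at s)"
      unfolding w_def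
      by (auto intro!: derivative_eq_intros DE DT1 DT2 simp: dx_dy power2_eq_square) (simp add: algebra_simps)
    then show ?thesis by (simp add: t0)
  qed
  have ttt: "- \<rho> * deriv k s * ?tt s + \<mu> s * (\<mu> s * ?ttt s + 2 * k s * ?tn s) + deriv k s * w s
       + k s * (\<mu> s * ?tn s) = 0" for s
  proof -
    have "((\<lambda>t. \<mu> t * ?tt t + k t * w t) has_field_derivative
      (- \<rho> * deriv k s * ?tt s + \<mu> s * (\<mu> s * ?ttt s + 2 * k s * ?tn s) + deriv k s * w s
       + k s * (\<mu> s * ?tn s))) (at s)"
      by (auto intro!: derivative_eq_intros DE DT1 DT2 Dmu Dk Dw simp: dx_dy)
         (simp add: algebra_simps power2_eq_square power3_eq_cube)
    moreover have "((\<lambda>t. \<mu> t * ?tt t + k t * w t) has_field_derivative 0) (at s)"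
      by (simp add: tt)
    ultimately show ?thesis by (rule DERIV_unique)
  qed
  define g' where "g' s = \<mu> s * (E (dx g) s * T1 s + E (dy g) s * T2 s)" for s
  have Dg: "((\<lambda>t. E g t) has_field_derivative g' s) (at s)" for s
    unfolding g'_def by (rule DE)
  \<comment> \<open>The second alternative is the logarithmic derivative of w^(3 m) g^3 / \<mu>^m
    times w g \<mu>. Where w = 0, the factor w^(3 m - 1) makes the derivative of the quotient vanish
    anyway.\<close>
  have key: "w s = 0 \<or> of_nat m * E g s * (3 * (\<mu> s * ?tn s) * \<mu> s + \<rho> * deriv k s * w s) + 3 * w s * g' s * \<mu> s = 0" for s
  proof (cases "w s = 0")
    case False
    let ?e = "\<lambda>p t. ev p (cx s t) (cy s t)"
    define a b where "a t = cos t * T1 s + sin t * T2 s" and "b t = cos t * T2 s - sin t * T1 s" for t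
    define h1 where "h1 t = \<rho> * (?e (dx f) t * a t + ?e (dy f) t * b t)" for t
    define h2 where "h2 t = \<rho>\<^sup>2 * (?e (dx (dx f)) t * (a t)\<^sup>2 + 2 * ?e (dy (dx f)) t * a t * b t + ?e (dy (dy f)) t * (b t)\<^sup>2)
        + \<rho> * (?e (dx f) t * b t - ?e (dy f) t * a t)" for t
    define h3 where "h3 t = \<rho> ^ 3 * (?e (dx (dx (dx f))) t * a t ^ 3 + 3 * ?e (dy (dx (dx f))) t * (a t)\<^sup>2 * b t
        + 3 * ?e (dy (dy (dx f))) t * a t * (b t)\<^sup>2 + ?e (dy (dy (dy f))) t * b t ^ 3)
        + 3 * \<rho>\<^sup>2 * ((?e (dx (dx f)) t - ?e (dy (dy f)) t) * a t * b t + ?e (dy (dx f)) t * ((b t)\<^sup>2 - (a t)\<^sup>2))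
        - \<rho> * (?e (dx f) t * a t + ?e (dy f) t * b t)" for t
    have ab0: "a 0 = T1 s" "b 0 = T2 s" by (simp_all add: a_def b_def)
    have Da: "(a has_field_derivative b t) (at t)" "(b has_field_derivative - a t) (at t)" for t
      unfolding a_def b_def by (auto intro!: derivative_eq_intros)
    have De: "(?e p has_field_derivative \<rho> * (?e (dx p) t * a t + ?e (dy p) t * b t)) (at t)" for p t
      unfolding a_def b_def by (rule Dec)
    have d1: "(?e f has_field_derivative h1 t) (at t)" for t
      unfolding h1_def by (rule De)
    have d2: "(h1 has_field_derivative h2 t) (at t)" for t
      unfolding h1_def[abs_def] h2_def
      by (auto intro!: derivative_eq_intros De Da simp: dx_dy) (simp add: algebra_simps power2_eq_square)
    have d3: "(h2 has_field_derivative h3 t) (at t)" for t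
      unfolding h2_def[abs_def] h3_def
      by (auto intro!: derivative_eq_intros De Da simp: dx_dy) (simp add: algebra_simps power2_eq_square power3_eq_cube)
    have h10: "h1 0 = 0" using t0[of s] by (simp add: h1_def ab0)
    have h20: "h2 0 = \<rho>\<^sup>2 * ?tt s - \<rho> * w s" by (simp add: h2_def ab0 w_def algebra_simps)
    have h30: "h3 0 = \<rho> ^ 3 * ?ttt s - 3 * \<rho>\<^sup>2 * ?tn s"
    proof -
      have "h3 0 = \<rho> ^ 3 * ?ttt s - 3 * \<rho>\<^sup>2 * ?tn s - \<rho> * (E (dx f) s * T1 s + E (dy f) s * T2 s)"
        by (simp add: h3_def ab0 algebra_simps)
      then show ?thesis by (simp add: t0)
    qed
    have lim: "((\<lambda>t. (?e f t - h2 0 / 2 * t\<^sup>2) / t ^ 3) \<longlongrightarrow> h3 0 / 6) (at 0)"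
      by (rule cubic_remainder[OF d1 d2 d3 smooth1_circle]) (simp_all add: f h10)
    \<comment> \<open>The quadratic coefficient on the circle is therefore - \<rho> w / (2 \<mu>),
      which is non-zero wherever w is.\<close>
    have mu_h20: "\<mu> s * h2 0 = - \<rho> * w s"
    proof -
      have "\<mu> s * h2 0 = \<rho>\<^sup>2 * (\<mu> s * ?tt s) - \<rho> * w s * \<mu> s" by (simp add: h20 algebra_simps)
      also have "\<mu> s * ?tt s = - k s * w s" using tt[of s] by simp
      finally show ?thesis by (simp add: \<mu>_def algebra_simps power2_eq_square)
    qed
    then have "h2 0 / 2 \<noteq> 0" using False \<rho>0 by auto
    moreover have "((\<lambda>t. ?e g t) has_field_derivative \<rho> * (E (dx g) s * T1 s + E (dy g) s * T2 s)) (at 0)"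
      using Dec[of g s 0] by simp
    moreover have "?e f t ^ m * ?e g t = ?e f (- t) ^ m * ?e g (- t)" for t
      using sym[unfolded sym_poly_def, rule_format, of s t] by simp
    ultimately have R: "of_nat m * (h3 0 / 6) * E g s + h2 0 / 2 * (\<rho> * (E (dx g) s * T1 s + E (dy g) s * T2 s)) = 0"
      using even_cubic_relation[OF lim, of "?e g"] m by simp
    \<comment> \<open>Multiplication by \<mu>^3 lets \<open>ttt\<close> and \<open>tt\<close>
      replace the tangential derivatives; the rest is 1 - \<rho> k = \<mu>.\<close>
    have mu_h30: "\<mu> s ^ 3 * h3 0 = - \<rho>\<^sup>2 * (3 * (\<mu> s * ?tn s) * \<mu> s + \<rho> * deriv k s * w s)"
    proof -
      have "\<mu> s ^ 3 * h3 0 = \<rho> ^ 3 * \<mu> s * (\<mu> s * (\<mu> s * ?ttt s)) - 3 * \<rho>\<^sup>2 * \<mu> s ^ 3 * ?tn s"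
        by (simp add: h30 algebra_simps power3_eq_cube)
      also have "\<mu> s * (\<mu> s * ?ttt s) = \<rho> * deriv k s * ?tt s - 3 * k s * \<mu> s * ?tn s - deriv k s * w s"
        using ttt[of s] by (simp only: algebra_simps)
      also have "\<rho> ^ 3 * \<mu> s * (\<rho> * deriv k s * ?tt s - 3 * k s * \<mu> s * ?tn s - deriv k s * w s) - 3 * \<rho>\<^sup>2 * \<mu> s ^ 3 * ?tn s
        = \<rho> ^ 3 * (\<rho> * deriv k s * (\<mu> s * ?tt s) - 3 * k s * (\<mu> s)\<^sup>2 * ?tn s - \<mu> s * deriv k s * w s) - 3 * \<rho>\<^sup>2 * \<mu> s ^ 3 * ?tn s"
        by (simp only: algebra_simps power2_eq_square)
      also have "\<mu> s * ?tt s = - k s * w s" using tt[of s] by simp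
      also have "\<rho> ^ 3 * (\<rho> * deriv k s * (- k s * w s) - 3 * k s * (\<mu> s)\<^sup>2 * N - \<mu> s * deriv k s * w s) - 3 * \<rho>\<^sup>2 * \<mu> s ^ 3 * N
         = - \<rho>\<^sup>2 * (3 * (\<mu> s * N) * \<mu> s + \<rho> * deriv k s * w s)" for N
        unfolding \<mu>_def by (simp add: algebra_simps power2_eq_square power3_eq_cube)
      finally show ?thesis .
    qed
    have "0 = 6 * \<mu> s ^ 3 * (of_nat m * (h3 0 / 6) * E g s + h2 0 / 2 * (\<rho> * (E (dx g) s * T1 s + E (dy g) s * T2 s)))"
      by (simp only: R mult_zero_right)
    also have "\<dots> = of_nat m * (\<mu> s ^ 3 * h3 0) * E g s + 3 * (\<mu> s * h2 0) * \<mu> s * \<rho> * g' s"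
      by (simp add: g'_def algebra_simps power3_eq_cube)
    also have "\<dots> = - \<rho>\<^sup>2 * (of_nat m * E g s * (3 * (\<mu> s * ?tn s) * \<mu> s + \<rho> * deriv k s * w s) + 3 * w s * g' s * \<mu> s)"
      unfolding mu_h30 mu_h20 by (simp add: algebra_simps power2_eq_square)
    finally show ?thesis using \<rho>0 by simp
  qed simp
  have "((\<lambda>t. w t ^ (3 * m) * E g t ^ 3 / \<mu> t ^ m) has_field_derivative 0) (at s)" for s
  proof -
    obtain j where j: "m = Suc j" using m by (cases m) auto
    define ms gs ws w' kk where "ms = \<mu> s" and "gs = E g s" and "ws = w s" and "w' = \<mu> s * ?tn s" and "kk = deriv k s"
    have d: "((\<lambda>t. w t ^ (3 * m) * E g t ^ 3 / \<mu> t ^ m) has_field_derivative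
      ((of_nat (3 * m) * (w' * ws ^ (3 * m - Suc 0)) * gs ^ 3 + of_nat 3 * (g' s * gs ^ (3 - Suc 0)) * ws ^ (3 * m)) * ms ^ m
        - (ws ^ (3 * m) * gs ^ 3) * (of_nat m * (- \<rho> * kk * ms ^ (m - Suc 0)))) / (ms ^ m * ms ^ m)) (at s)"
      unfolding ms_def gs_def ws_def w'_def kk_def
      by (intro DERIV_divide DERIV_mult DERIV_power Dw Dg Dmu power_not_zero mu0)
    have e: "(of_nat (3 * m) * (w' * ws ^ (3 * m - Suc 0)) * gs ^ 3 + of_nat 3 * (g' s * gs ^ (3 - Suc 0)) * ws ^ (3 * m)) * ms ^ m
        - (ws ^ (3 * m) * gs ^ 3) * (of_nat m * (- \<rho> * kk * ms ^ (m - Suc 0)))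
      = ws ^ (3 * m - 1) * gs\<^sup>2 * ms ^ (m - 1) * (of_nat m * gs * (3 * w' * ms + \<rho> * kk * ws) + 3 * ws * g' s * ms)"
    proof -
      have e1: "ws ^ (3 * m) = ws * ws ^ (3 * m - 1)"
        using power_minus_mult[of "3 * m" ws] m by (simp add: mult.commute)
      have e2: "ms ^ m = ms * ms ^ (m - 1)" by (simp add: j)
      show ?thesis unfolding e1 e2 by (simp add: algebra_simps power2_eq_square power3_eq_cube)
    qed
    have z: "ws ^ (3 * m - 1) * gs\<^sup>2 * ms ^ (m - 1) * (of_nat m * gs * (3 * w' * ms + \<rho> * kk * ws) + 3 * ws * g' s * ms) = 0"
      using key[of s] unfolding ms_def gs_def ws_def w'_def kk_def by (auto simp: j)
    show ?thesis using d unfolding e z by simp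
  qed
  then have "w t ^ (3 * m) * E g t ^ 3 / \<mu> t ^ m = w 0 ^ (3 * m) * E g 0 ^ 3 / \<mu> 0 ^ m" for t
    using DERIV_isconst_all[of "\<lambda>t. w t ^ (3 * m) * E g t ^ 3 / \<mu> t ^ m" t 0] by blast
  then show "\<exists>C. \<forall>t. w t ^ (3 * m) * E g t ^ 3 / \<mu> t ^ m = C" by blast
qed

theorem sym_poly_nonsingular:
  assumes sym: "sym_poly p" and nc: "\<And>c. p \<noteq> [:[:c:]:]"
  shows "\<exists>f. (\<forall>t. E f t = 0) \<and>
    (\<forall>z w::complex. ev f z w = 0 \<longrightarrow> ev (dx f) z w \<noteq> 0 \<or> ev (dy f) z w \<noteq> 0)"
proof -
  obtain c where c: "\<And>t. E p t = c" using sym_poly_const[OF sym] by blast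
  define u where "u = p - [:[:c:]:]"
  have u0: "u \<noteq> 0" using nc[of c] by (simp add: u_def)
  have uz: "E u t = 0" for t by (simp add: u_def c)
  have symu: "sym_poly u"
    unfolding sym_poly_def
  proof (intro allI)
    fix s t
    show "ev u (cx s t) (cy s t) = ev u (cx s (- t)) (cy s (- t))"
      using sym[unfolded sym_poly_def, rule_format, of s t] by (simp add: u_def)
  qed
  obtain f g m where fgm: "prime_elem f \<and> u = f ^ m * g \<and> m > 0 \<and> \<not> f dvd g \<and>
    (\<forall>t. E f t = 0) \<and> (\<forall>h t. fl h t \<longrightarrow> f dvd h)"
    using minimal_polynomial[OF u0 uz] by (elim exE)
  then have f: "prime_elem f" "u = f ^ m * g" "m > 0" "\<not> f dvd g" "E f t = 0"
    and dv: "fl h t \<Longrightarrow> f dvd h" for h t by auto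
  have symfg: "sym_poly (f ^ m * g)" using symu f(2) by simp
  define w where "w t = E (dy f) t * T1 t - E (dx f) t * T2 t" for t
  note rel = sym_poly_relation[OF f(5) symfg f(3), folded w_def]
  obtain C where C: "\<And>t. w t ^ (3 * m) * E g t ^ 3 / \<mu> t ^ m = C" using rel(3) by blast
  have dxw: "E (dx f) t = - w t * T2 t" and dyw: "E (dy f) t = w t * T1 t" for t
  proof -
    have "E (dx f) t = E (dx f) t * ((T1 t)\<^sup>2 + (T2 t)\<^sup>2)" by (simp add: unit)
    also have "\<dots> = T1 t * (E (dx f) t * T1 t + E (dy f) t * T2 t) - w t * T2 t"
      by (simp add: w_def algebra_simps power2_eq_square)
    finally show "E (dx f) t = - w t * T2 t" by (simp add: rel(1))
    have "E (dy f) t = E (dy f) t * ((T1 t)\<^sup>2 + (T2 t)\<^sup>2)" by (simp add: unit)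
    also have "\<dots> = T2 t * (E (dx f) t * T1 t + E (dy f) t * T2 t) + w t * T1 t"
      by (simp add: w_def algebra_simps power2_eq_square)
    finally show "E (dy f) t = w t * T1 t" by (simp add: rel(1))
  qed
  \<comment> \<open>f divides neither g nor one of its partial derivatives q. Neither restriction is
    then flat at 0, so both are non-zero at a common parameter nearby; as the gradient is w times
    the normal, w is non-zero there.\<close>
  have C0: "C \<noteq> 0"
  proof
    assume "C = 0"
    obtain q where q: "q = dx f \<or> q = dy f" "\<not> f dvd q" using prime_not_dvd_gradient[OF f(1)] by blast
    have nz: "\<forall>\<^sub>F t in at 0. E h t \<noteq> 0" if "\<not> f dvd h" for h
    proof (rule nonflat_nonzero[OF smooth1_ev_curve])
      show "\<not> flat (\<lambda>t. E h t) 0" using dv[of h 0] that unfolding fl_def by blast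
    qed
    have "\<forall>\<^sub>F t in at (0::real). E q t \<noteq> 0 \<and> E g t \<noteq> 0"
      by (rule eventually_conj[OF nz[OF q(2)] nz[OF f(4)]])
    from eventually_happens'[OF at_neq_bot this]
    obtain t where t: "E q t \<noteq> 0" "E g t \<noteq> 0" by blast
    have "w t \<noteq> 0" using t(1) q(1) dxw[of t] dyw[of t] by auto
    with C[of t] \<open>C = 0\<close> t(2) mu0[of t] show False by simp
  qed
  define S where "S = gradsq f"
  define H where "H = [:[:- \<rho>:]:] * hess f"
  have ES: "E S t = (w t)\<^sup>2" for t
  proof -
    have "E S t = (w t)\<^sup>2 * ((T1 t)\<^sup>2 + (T2 t)\<^sup>2)"
      unfolding S_def ev_gradsq dxw dyw by (simp add: algebra_simps power2_eq_square)
    then show ?thesis by (simp add: unit)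
  qed
  \<comment> \<open>This removes the curvature: the second-order relation and \<mu> = 1 - \<rho> k
    turn w^3 / \<mu> into an expression in w and derivatives of f only.\<close>
  have EH: "w t * E S t + E H t = w t ^ 3 / \<mu> t" for t
  proof -
    let ?tt = "E (dx (dx f)) t * (T1 t)\<^sup>2 + 2 * E (dy (dx f)) t * T1 t * T2 t + E (dy (dy f)) t * (T2 t)\<^sup>2"
    have "E (hess f) t = (w t)\<^sup>2 * ?tt"
      unfolding ev_hess dxw dyw by (simp add: algebra_simps power2_eq_square)
    then have "\<mu> t * (w t * E S t + E H t) = \<mu> t * w t ^ 3 - \<rho> * (w t)\<^sup>2 * (\<mu> t * ?tt)"
      by (simp add: ES H_def algebra_simps power2_eq_square power3_eq_cube)
    also have "\<mu> t * ?tt = - k t * w t" using rel(2)[of t] by simp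
    also have "\<mu> t * w t ^ 3 - \<rho> * (w t)\<^sup>2 * (- k t * w t) = w t ^ 3"
      by (simp add: \<mu>_def algebra_simps power2_eq_square power3_eq_cube)
    finally show ?thesis using mu0[of t] by (simp add: nonzero_eq_divide_eq mult.commute)
  qed
  define A B where "A = fst (conj_pow m S H)" and "B = snd (conj_pow m S H)"
  \<comment> \<open>The norm of (A + w B) g^3 - C over the adjunction of w, that is, its product
    with the conjugate under w -> - w. Where S = H = 0, both A and B vanish because m > 0, and only
    C^2 is left.\<close>
  define P where "P = (A * g ^ 3 - [:[:C:]:])\<^sup>2 - S * (B * g ^ 3)\<^sup>2"
  have EP: "E P t = 0" for t
  proof -
    have "(E A t + w t * E B t) * E g t ^ 3 = C"
    proof -
      have "E A t + w t * E B t = (w t ^ 3 / \<mu> t) ^ m"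
        unfolding A_def B_def conj_pow_eq[OF ES[symmetric]] EH ..
      then show ?thesis using C[of t] by (simp add: power_divide power_mult)
    qed
    then have "E A t * E g t ^ 3 - C = - (w t * (E B t * E g t ^ 3))" by (simp add: algebra_simps)
    then have "(E A t * E g t ^ 3 - C)\<^sup>2 = (w t)\<^sup>2 * (E B t * E g t ^ 3)\<^sup>2" by (simp add: power_mult_distrib)
    then show ?thesis by (simp add: P_def ES)
  qed
  then have "fl P 0" by (simp add: fl_def)
  then have "f dvd P" by (rule dv)
  then obtain Q where Q: "P = f * Q" by (auto simp: dvd_def)
  have "ev (dx f) z v \<noteq> 0 \<or> ev (dy f) z v \<noteq> 0" if z: "ev f z v = 0" for z v :: complex
  proof (rule ccontr)
    assume "\<not> ?thesis"
    then have g: "ev (dx f) z v = 0" "ev (dy f) z v = 0" by auto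
    have "ev S z v = 0" "ev H z v = 0"
      by (simp_all add: S_def H_def ev_gradsq ev_hess g)
    then have "ev A z v = 0" "ev B z v = 0"
      unfolding A_def B_def using conj_pow_zero f(3) by blast+
    then have "ev P z v = (of_real C)\<^sup>2" by (simp add: P_def)
    moreover have "ev P z v = 0" by (simp add: Q z)
    ultimately show False using C0 by simp
  qed
  then show ?thesis by (intro exI[of _ f] conjI allI impI f(5))
qed

end

section \<open>Ovals\<close>

text \<open>In the plane both vectors lie on one line, so their determinant is zero; Lagrange's
  identity turns this into equality in Cauchy-Schwarz.\<close>

lemma abs_inner_orthogonal_line:
  fixes a b u :: complex
  assumes "inner a u = 0" "inner b u = 0" "u \<noteq> 0"
  shows "\<bar>inner a b\<bar> = norm a * norm b"
proof -
  have a: "Re a * Re u + Im a * Im u = 0" and b: "Re b * Re u + Im b * Im u = 0"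
    using assms by (auto simp: inner_complex_def)
  have "(Re a * Im b - Im a * Re b) * Re u = 0" "(Re a * Im b - Im a * Re b) * Im u = 0"
    using a b by algebra+
  then have c: "Re a * Im b - Im a * Re b = 0" using assms(3) by (auto simp: complex_eq_iff)
  have "(inner a b)\<^sup>2 + (Re a * Im b - Im a * Re b)\<^sup>2 = (norm a)\<^sup>2 * (norm b)\<^sup>2"
    unfolding cmod_power2 inner_complex_def by algebra
  then have "(inner a b)\<^sup>2 = (norm a * norm b)\<^sup>2" unfolding c by (simp add: power_mult_distrib)
  then have "\<bar>inner a b\<bar> = \<bar>norm a * norm b\<bar>" by (simp only: power2_eq_iff abs_eq_iff)
  then show ?thesis by simp
qed

text \<open>\<open>V\<close> and the complement of \<open>C\<close> are open, together cover the
  component, and have no common point inside \<open>Z\<close>.\<close>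

lemma isolated_compact_component:
  fixes C Z V :: "complex set"
  assumes C: "connected C" "compact C" "p \<in> C" "C \<subseteq> Z" and V: "open V" "C \<subseteq> V" "Z \<inter> V \<subseteq> C"
  shows "C = connected_component_set Z p"
proof
  show "C \<subseteq> connected_component_set Z p" by (rule connected_component_maximal[OF C(3,1,4)])
  let ?K = "connected_component_set Z p"
  have K: "connected ?K" "?K \<subseteq> Z" "p \<in> ?K"
    using C by (auto simp: connected_component_subset connected_component_refl_eq)
  have "open (- C)" using compact_imp_closed[OF C(2)] by (rule open_Compl)
  then have "V \<inter> ?K = {} \<or> (- C) \<inter> ?K = {}"
    using connectedD[OF K(1) V(1), of "- C"] K(2) V(2,3) by blast
  then show "?K \<subseteq> C" using C(3) V(2) K(3) by blast
qed

lemma continuous_on_ev: "continuous_on A (\<lambda>z::complex. ev p (Re z) (Im z))"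
proof -
  have "continuous_on A (\<lambda>z::complex. upe q (Re z))" for q
    by (induction q) (auto intro!: continuous_intros)
  then show ?thesis by (induction p) (auto intro!: continuous_intros)
qed

context parallel_frame
begin

definition pc :: "real \<Rightarrow> complex" where "pc t = Complex (x t) (y t)"

lemma pc_deriv: "(pc has_vector_derivative Complex (\<mu> t * T1 t) (\<mu> t * T2 t)) (at t)"
  unfolding pc_def has_vector_derivative_complex_iff
  using Dx Dy by (simp add: comp_def)

text \<open>Let z be another zero near the curve and q its nearest curve point. Both z - q and the
  gradient at q are normal to the curve. Rolle's theorem makes the gradient orthogonal to z - q at
  some point of the segment, but there it is still too close to its non-zero value at q.\<close>

lemma isolated_in_zero_set:
  assumes f: "\<And>t. E f t = 0" and grad: "\<And>t. E (dx f) t \<noteq> 0 \<or> E (dy f) t \<noteq> 0"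
    and per: "range pc = pc ` {0..L}"
  obtains e where "e > 0" "\<And>z. ev f (Re z) (Im z) = 0 \<Longrightarrow> infdist z (pc ` {0..L}) < e \<Longrightarrow> z \<in> pc ` {0..L}"
proof -
  define C where "C = pc ` {0..L}"
  have cont: "continuous_on S pc" for S
    using pc_deriv by (meson continuous_at_imp_continuous_on has_vector_derivative_continuous)
  have cC: "compact C" unfolding C_def by (intro compact_continuous_image cont compact_Icc)
  have C0: "C \<noteq> {}" unfolding C_def per[symmetric] by simp
  define G where "G z = Complex (ev (dx f) (Re z) (Im z)) (ev (dy f) (Re z) (Im z))" for z
  have contG: "continuous_on S G" for S
    unfolding G_def by (intro continuous_on_Complex continuous_on_ev)
  \<comment> \<open>The least gradient length on the compact curve is the margin used for uniform
    continuity.\<close>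
  obtain q0 where q0: "q0 \<in> C" "\<And>q. q \<in> C \<Longrightarrow> norm (G q0) \<le> norm (G q)"
    using continuous_attains_inf[OF cC C0, of "\<lambda>q. norm (G q)"] contG by (auto intro: continuous_on_norm)
  have w0: "norm (G q0) > 0"
    using q0(1) grad by (auto simp: C_def G_def pc_def complex_eq_iff)
  obtain R where "\<forall>q\<in>C. norm q \<le> R" using compact_imp_bounded[OF cC] unfolding bounded_iff by blast
  then have R: "C \<subseteq> cball 0 R" by auto
  \<comment> \<open>Distances capped by 1 keep all segments inside this one ball.\<close>
  have "uniformly_continuous_on (cball 0 (R + 1)) G"
    by (intro compact_uniformly_continuous contG) auto
  then obtain d where d: "d > 0" "\<And>z z'. z \<in> cball 0 (R + 1) \<Longrightarrow> z' \<in> cball 0 (R + 1) \<Longrightarrow> dist z' z < d \<Longrightarrow> dist (G z') (G z) < norm (G q0)"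
    using w0 unfolding uniformly_continuous_on_def by meson
  have main: "z \<in> C" if z: "ev f (Re z) (Im z) = 0" "infdist z C < min 1 d" for z
  proof (rule ccontr)
    assume nz: "z \<notin> C"
    obtain q where q: "q \<in> C" "infdist z C = dist z q"
      using infdist_attains_inf[OF compact_imp_closed[OF cC] C0] by blast
    obtain s where s: "q = pc s" using q(1) by (auto simp: C_def)
    have zq: "z \<noteq> q" using nz q by auto
    have orth: "inner (z - q) (Complex (T1 s) (T2 s)) = 0"
    proof -
      have min: "inner (z - pc s) (z - pc s) \<le> inner (z - pc t) (z - pc t)" for t
      proof -
        have "pc t \<in> C" using per by (auto simp: C_def)
        then have "infdist z C \<le> dist z (pc t)" by (rule infdist_le)
        then have "norm (z - pc s) \<le> norm (z - pc t)" using q(2) s by (simp add: dist_norm)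
        then show ?thesis by (simp add: norm_le)
      qed
      let ?D = "- 2 * inner (z - pc s) (Complex (\<mu> s * T1 s) (\<mu> s * T2 s))"
      have dd: "((\<lambda>t. (Re z - x t)\<^sup>2 + (Im z - y t)\<^sup>2) has_field_derivative
         (2 * (Re z - x s) * (- (\<mu> s * T1 s)) + 2 * (Im z - y s) * (- (\<mu> s * T2 s)))) (at s)"
        by (auto intro!: derivative_eq_intros Dx Dy) (simp add: algebra_simps)
      have mn: "(Re z - x s)\<^sup>2 + (Im z - y s)\<^sup>2 \<le> (Re z - x t)\<^sup>2 + (Im z - y t)\<^sup>2" for t
        using min[of t] by (simp add: pc_def inner_complex_def power2_eq_square)
      have "2 * (Re z - x s) * (- (\<mu> s * T1 s)) + 2 * (Im z - y s) * (- (\<mu> s * T2 s)) = 0"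
        by (rule DERIV_local_min[OF dd zero_less_one]) (simp add: mn)
      then have "\<mu> s * ((Re z - x s) * T1 s + (Im z - y s) * T2 s) = 0" by (simp add: algebra_simps)
      then show ?thesis using mu0[of s] s by (simp add: inner_complex_def pc_def)
    qed
    have Gorth: "inner (G q) (Complex (T1 s) (T2 s)) = 0"
    proof -
      have "((\<lambda>t. E f t) has_field_derivative 0) (at s)" by (simp add: f)
      from DERIV_unique[OF DE this] mu0[of s] show ?thesis
        by (simp add: G_def s pc_def inner_complex_def)
    qed
    have T0: "Complex (T1 s) (T2 s) \<noteq> 0" using unit[of s] by (auto simp: complex_eq_iff)
    have big: "\<bar>inner (G q) (z - q)\<bar> = norm (G q) * norm (z - q)"
      by (rule abs_inner_orthogonal_line[OF Gorth orth T0])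
    define l where "l t = q + of_real t * (z - q)" for t :: real
    define h where "h t = ev f (Re (l t)) (Im (l t))" for t
    have Dh: "(h has_field_derivative inner (G (l t)) (z - q)) (at t)" for t
    proof -
      have "((\<lambda>t. Re (l t)) has_field_derivative Re (z - q)) (at t)"
        "((\<lambda>t. Im (l t)) has_field_derivative Im (z - q)) (at t)"
        unfolding l_def by (auto intro!: derivative_eq_intros)
      from ev_chain[OF this, of f] show ?thesis
        by (simp add: h_def[abs_def] G_def inner_complex_def)
    qed
    have "h 0 = h 1" using z(1) f[of s] by (simp add: h_def l_def s pc_def)
    moreover have "continuous_on {0..1} h"
      using Dh DERIV_isCont by (blast intro: continuous_at_imp_continuous_on)
    moreover have "h differentiable (at t)" for t
      using Dh real_differentiable_def by blast
    ultimately have "\<exists>t>0. t < 1 \<and> DERIV h t :> 0" by (intro Rolle) auto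
    then obtain t where t': "0 < t" "t < 1" "DERIV h t :> 0" by blast
    then have t: "0 < t" "t < 1" "inner (G (l t)) (z - q) = 0"
      using DERIV_unique[OF Dh t'(3)] by simp_all
    have dl: "dist (l t) q < min 1 d"
    proof -
      have "dist (l t) q = t * norm (z - q)" using t by (simp add: l_def dist_norm norm_mult)
      also have "\<dots> \<le> norm (z - q)" using t by (simp add: mult_left_le_one_le)
      also have "\<dots> < min 1 d" using z(2) q(2) by (simp add: dist_norm)
      finally show ?thesis .
    qed
    have "q \<in> cball 0 R" using q(1) R by auto
    moreover have "norm (l t) \<le> norm q + dist (l t) q"
      using norm_triangle_ineq[of q "l t - q"] by (simp add: dist_norm)
    ultimately have "dist (G (l t)) (G q) < norm (G q0)"
      using dl by (intro d(2)) auto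
    then have "dist (G (l t)) (G q) < norm (G q)" using q0(2)[OF q(1)] by linarith
    then have "norm (G (l t) - G q) * norm (z - q) < norm (G q) * norm (z - q)"
      using zq by (simp add: dist_norm)
    moreover have "\<bar>inner (G (l t) - G q) (z - q)\<bar> \<le> norm (G (l t) - G q) * norm (z - q)"
      by (rule Cauchy_Schwarz_ineq2)
    moreover have "inner (G (l t) - G q) (z - q) = - inner (G q) (z - q)"
      using t(3) by (simp add: inner_diff_left)
    ultimately show False using big by simp
  qed
  show ?thesis
  proof (rule that)
    show "min 1 d > 0" using d(1) by simp
    fix z assume "ev f (Re z) (Im z) = 0" "infdist z (pc ` {0..L}) < min 1 d"
    from main[unfolded C_def, OF this] show "z \<in> pc ` {0..L}" .
  qed
qed

theorem sym_poly_oval: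
  assumes sym: "sym_poly p" and nc: "\<And>c. p \<noteq> [:[:c:]:]"
    and L: "L > 0" and per: "range pc = pc ` {0..L}"
  shows "nonsing_alg_oval (pc ` {0..L})"
proof -
  obtain f where fns: "(\<forall>t. E f t = 0) \<and>
    (\<forall>z w::complex. ev f z w = 0 \<longrightarrow> ev (dx f) z w \<noteq> 0 \<or> ev (dy f) z w \<noteq> 0)"
    using sym_poly_nonsingular[OF sym nc] by (elim exE)
  then have f: "E f t = 0"
    and ns: "ev f z w = 0 \<Longrightarrow> ev (dx f) z w \<noteq> 0 \<or> ev (dy f) z w \<noteq> 0" for t and z w :: complex
    by blast+
  have grad: "E (dx f) t \<noteq> 0 \<or> E (dy f) t \<noteq> 0" for t
    using ns[of "of_real (x t)" "of_real (y t)"] f[of t] by (simp add: ev_of_real)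
  obtain e where e: "e > 0" "\<And>z. ev f (Re z) (Im z) = 0 \<Longrightarrow> infdist z (pc ` {0..L}) < e \<Longrightarrow> z \<in> pc ` {0..L}"
    using isolated_in_zero_set[OF f grad per] by blast
  define c where "c i j = coeff (coeff f j) i" for i j
  obtain N where N: "\<And>z w. bpoly N c z w = ev f z w"
    using ev_eq_bpoly[of f] by (auto simp: c_def[abs_def])
  have f0: "f \<noteq> 0" using ns[of 0 0] by (auto simp: dy_def)
  have c0: "\<exists>i j. c i j \<noteq> 0"
    using f0 unfolding c_def by (metis leading_coeff_neq_0)
  have nsing: "nonsingular_C2 N c"
    unfolding nonsingular_C2_def N
  proof (intro allI impI)
    fix z w :: complex assume z: "ev f z w = 0"
    have "((\<lambda>z. ev f z w) has_field_derivative ev (dx f) z w) (at z)"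
      using ev_chain[of "\<lambda>z. z" 1 z "\<lambda>_. w" 0 f] by simp
    moreover have "((\<lambda>w. ev f z w) has_field_derivative ev (dy f) z w) (at w)"
      using ev_chain[of "\<lambda>_. z" 0 w "\<lambda>w. w" 1 f] by simp
    ultimately show "deriv (\<lambda>z'. ev f z' w) z \<noteq> 0 \<or> deriv (\<lambda>w'. ev f z w') w \<noteq> 0"
      using ns[OF z] by (simp add: DERIV_imp_deriv)
  qed
  have Z: "real_zeros N c = {z. ev f (Re z) (Im z) = 0}"
    unfolding real_zeros_def N ev_of_real by simp
  have cont: "continuous_on S pc" for S
    using pc_deriv by (meson continuous_at_imp_continuous_on has_vector_derivative_continuous)
  let ?C = "pc ` {0..L}"
  have C0: "?C \<noteq> {}" using L by auto
  have cC: "compact ?C" by (intro compact_continuous_image cont compact_Icc)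
  have "?C = connected_component_set (real_zeros N c) (pc 0)"
  proof (rule isolated_compact_component)
    show "connected ?C" by (intro connected_continuous_image cont connected_Icc)
    show "compact ?C" by (rule cC)
    show "pc 0 \<in> ?C" using L by auto
    show "?C \<subseteq> real_zeros N c" using f by (auto simp: Z pc_def)
    show "open {z. infdist z ?C < e}"
      by (intro open_Collect_less continuous_intros)
    show "?C \<subseteq> {z. infdist z ?C < e}" using e(1) by auto
    show "real_zeros N c \<inter> {z. infdist z ?C < e} \<subseteq> ?C" using e(2) by (auto simp: Z)
  qed
  moreover have "pc 0 \<in> ?C" using L by auto
  ultimately have "\<exists>p \<in> ?C. ?C = connected_component_set (real_zeros N c) p" by (rule bexI)
  then show ?thesis unfolding nonsing_alg_oval_def using c0 nsing by blast
qed

end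

section \<open>Formal jets and harmonics on circles\<close>

type_synonym jet_family = "nat \<Rightarrow> nat \<Rightarrow> complex \<Rightarrow> complex"

text \<open>\<open>q a b\<close> plays the role of the partial derivative of order \<open>a\<close> in the first and \<open>b\<close> in the
  second coordinate of \<open>q 0 0\<close>.\<close>

definition jet :: "complex set \<Rightarrow> jet_family \<Rightarrow> bool" where
  "jet U q \<longleftrightarrow> (\<forall>a b. \<forall>x\<in>U. (q a b has_derivative
     (\<lambda>h. of_real (Re h) * q (Suc a) b x + of_real (Im h) * q a (Suc b) x)) (at x))"

definition dz :: "jet_family \<Rightarrow> jet_family" where
  "dz q a b x = (q (Suc a) b x - \<i> * q a (Suc b) x) / 2"

definition dzb :: "jet_family \<Rightarrow> jet_family" where
  "dzb q a b x = (q (Suc a) b x + \<i> * q a (Suc b) x) / 2"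

definition lin :: "complex \<Rightarrow> jet_family \<Rightarrow> complex \<Rightarrow> jet_family \<Rightarrow> jet_family" where
  "lin c q d q' a b x = c * q a b x + d * q' a b x"

text \<open>The real derivative in direction h, written through the two complex derivatives so that
  its powers expand into mixed ones.\<close>

definition ddir :: "complex \<Rightarrow> jet_family \<Rightarrow> jet_family" where
  "ddir h q = lin h (dz q) (cnj h) (dzb q)"

lemma ddir_eq: "ddir h q a b x = of_real (Re h) * q (Suc a) b x + of_real (Im h) * q a (Suc b) x"
  unfolding ddir_def lin_def dz_def dzb_def
  by (simp add: complex_eq_iff field_simps)

lemma jetD: "jet U q \<Longrightarrow> x \<in> U \<Longrightarrow> (q a b has_derivative (\<lambda>h. ddir h q a b x)) (at x)"
  unfolding jet_def ddir_eq by blast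

lemma jet_lin: "jet U q \<Longrightarrow> jet U q' \<Longrightarrow> jet U (lin c q d q')"
  unfolding jet_def
proof (intro allI ballI)
  fix a b x
  assume q: "\<forall>a b. \<forall>x\<in>U. (q a b has_derivative
      (\<lambda>h. of_real (Re h) * q (Suc a) b x + of_real (Im h) * q a (Suc b) x)) (at x)"
    and q': "\<forall>a b. \<forall>x\<in>U. (q' a b has_derivative
      (\<lambda>h. of_real (Re h) * q' (Suc a) b x + of_real (Im h) * q' a (Suc b) x)) (at x)" and x: "x \<in> U"
  have "((\<lambda>y. c * q a b y + d * q' a b y) has_derivative
      (\<lambda>h. c * (of_real (Re h) * q (Suc a) b x + of_real (Im h) * q a (Suc b) x)
         + d * (of_real (Re h) * q' (Suc a) b x + of_real (Im h) * q' a (Suc b) x))) (at x)"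
    using q q' x by (intro has_derivative_add has_derivative_mult_right) auto
  then show "(lin c q d q' a b has_derivative
      (\<lambda>h. of_real (Re h) * lin c q d q' (Suc a) b x + of_real (Im h) * lin c q d q' a (Suc b) x)) (at x)"
    by (simp add: lin_def[abs_def] algebra_simps)
qed

lemma jet_shift: "jet U q \<Longrightarrow> jet U (\<lambda>a b. q (a + m) (b + n))"
  by (simp add: jet_def)

lemma dz_lin_shift: "dz q = lin (1/2) (\<lambda>a b. q (a + 1) (b + 0)) (- \<i> / 2) (\<lambda>a b. q (a + 0) (b + 1))"
  "dzb q = lin (1/2) (\<lambda>a b. q (a + 1) (b + 0)) (\<i> / 2) (\<lambda>a b. q (a + 0) (b + 1))"
  by (auto simp: fun_eq_iff dz_def dzb_def lin_def field_simps)

lemma jet_dz: "jet U q \<Longrightarrow> jet U (dz q)" and jet_dzb: "jet U q \<Longrightarrow> jet U (dzb q)"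
  unfolding dz_lin_shift by (intro jet_lin jet_shift; assumption)+

lemma jet_ddir: "jet U q \<Longrightarrow> jet U (ddir h q)"
  unfolding ddir_def by (intro jet_lin jet_dz jet_dzb)

lemma jet_funpow: "(\<And>q. jet U q \<Longrightarrow> jet U (f q)) \<Longrightarrow> jet U q \<Longrightarrow> jet U ((f ^^ n) q)"
  by (induction n) auto

lemma dz_dzb: "dz (dzb q) = dzb (dz q)"
  by (auto simp: fun_eq_iff dz_def dzb_def field_simps)

lemma dz_dzb_funpow: "dzb ((dz ^^ n) q) = (dz ^^ n) (dzb q)"
  by (induction n) (auto simp: dz_dzb[symmetric])

lemma ddir_lin: "ddir h (lin c q d q') = lin c (ddir h q) d (ddir h q')"
  by (auto simp: fun_eq_iff ddir_eq lin_def algebra_simps)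

lemma ddir_funpow_lin: "(ddir h ^^ n) (lin c q d q') = lin c ((ddir h ^^ n) q) d ((ddir h ^^ n) q')"
  by (induction n) (auto simp: ddir_lin)

lemma jet_zero_imp:
  assumes "jet U p" "open U" "\<And>x. x \<in> U \<Longrightarrow> p 0 0 x = 0" "x \<in> U"
  shows "dz p 0 0 x = 0" "dzb p 0 0 x = 0"
proof -
  have "(p 0 0 has_derivative (\<lambda>h. 0)) (at x)"
    by (rule has_derivative_transform_within_open[OF _ assms(2,4)]) (auto simp: assms(3))
  then have "(\<lambda>h. ddir h p 0 0 x) = (\<lambda>h. 0)"
    using jetD[OF assms(1,4)] has_derivative_unique by blast
  then have "ddir 1 p 0 0 x = 0" "ddir \<i> p 0 0 x = 0" by metis+
  then show "dz p 0 0 x = 0" "dzb p 0 0 x = 0"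
    by (simp_all add: ddir_eq dz_def dzb_def)
qed

text \<open>Conjugation exchanges the two complex derivatives of real data, so the M-th conjugate
  derivative vanishes as well. Further derivatives of a function that is zero on an open set are
  zero.\<close>

lemma mixed_zero:
  assumes q: "jet U q" and U: "open U" and real: "\<And>a b x. cnj (q a b x) = q a b x"
    and z: "\<And>x. x \<in> U \<Longrightarrow> (dz ^^ M) q 0 0 x = 0" and ab: "a \<ge> M \<or> b \<ge> M" and x: "x \<in> U"
  shows "(dz ^^ a) ((dzb ^^ b) q) 0 0 x = 0"
proof -
  have J: "jet U ((dz ^^ i) ((dzb ^^ j) q))" for i j
    by (intro jet_funpow jet_dz jet_dzb q)
  have up: "(dz ^^ (a' + i)) ((dzb ^^ (b' + j)) q) 0 0 x = 0"
    if "\<And>x. x \<in> U \<Longrightarrow> (dz ^^ a') ((dzb ^^ b') q) 0 0 x = 0" "x \<in> U" for a' b' i j x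
    using that(2)
  proof (induction i arbitrary: x)
    case 0
    then show ?case
    proof (induction j arbitrary: x)
      case 0 then show ?case using that(1) by simp
    next
      case (Suc j)
      have "dzb ((dz ^^ a') ((dzb ^^ (b' + j)) q)) 0 0 x = 0"
        using jet_zero_imp(2)[OF J U _ Suc.prems] Suc.IH by simp
      then show ?case by (simp add: dz_dzb_funpow)
    qed
  next
    case (Suc i)
    have "dz ((dz ^^ (a' + i)) ((dzb ^^ (b' + j)) q)) 0 0 x = 0"
      using jet_zero_imp(1)[OF J U _ Suc.prems] Suc.IH by simp
    then show ?case by simp
  qed
  have c: "cnj ((dzb ^^ n) q a b x) = (dz ^^ n) q a b x" for n a b x
  proof (induction n arbitrary: a b)
    case (Suc n)
    then show ?case by (simp add: dz_def dzb_def)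
  qed (simp add: real)
  have zb: "(dzb ^^ M) q 0 0 x = 0" if "x \<in> U" for x
    using c[of M 0 0 x] z[OF that] by simp
  from ab show ?thesis
  proof
    assume "a \<ge> M"
    then show ?thesis using up[of M 0 x "a - M" b] z x by simp
  next
    assume "b \<ge> M"
    then show ?thesis using up[of 0 M x a "b - M"] zb x by simp
  qed
qed

text \<open>In the full expansion into mixed derivatives, each term contains at least M derivatives
  of one of the two kinds.\<close>

lemma ddir_funpow_zero:
  assumes "jet U q" "open U" "\<And>a b x. cnj (q a b x) = q a b x"
    and "\<And>x. x \<in> U \<Longrightarrow> (dz ^^ M) q 0 0 x = 0" and x: "x \<in> U"
  shows "a + b + k \<ge> 2 * M \<Longrightarrow> (ddir h ^^ k) ((dz ^^ a) ((dzb ^^ b) q)) 0 0 x = 0"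
proof (induction k arbitrary: a b)
  case 0
  then have "a \<ge> M \<or> b \<ge> M" by linarith
  then show ?case using mixed_zero[OF assms(1-4) _ x] by simp
next
  case (Suc k)
  have "(ddir h ^^ Suc k) ((dz ^^ a) ((dzb ^^ b) q))
     = (ddir h ^^ k) (lin h ((dz ^^ Suc a) ((dzb ^^ b) q)) (cnj h) ((dz ^^ a) ((dzb ^^ Suc b) q)))"
    by (simp add: funpow_swap1 ddir_def dz_dzb_funpow)
  then show ?case using Suc.IH[of "Suc a" b] Suc.IH[of a "Suc b"] Suc.prems
    by (simp add: ddir_funpow_lin) (simp add: lin_def)
qed

definition bivariate_polynomial :: "(complex \<Rightarrow> real) \<Rightarrow> bool" where
  "bivariate_polynomial h \<longleftrightarrow> (\<exists>p. \<forall>z. h z = ev p (Re z) (Im z))"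

lemma bivariate_polynomial_const: "bivariate_polynomial (\<lambda>z. c)"
  unfolding bivariate_polynomial_def by (rule exI[of _ "[:[:c:]:]"]) simp

lemma bivariate_polynomial_Re: "bivariate_polynomial Re"
  unfolding bivariate_polynomial_def by (rule exI[of _ "[:[:0, 1:]:]"]) simp

lemma bivariate_polynomial_Im: "bivariate_polynomial Im"
  unfolding bivariate_polynomial_def by (rule exI[of _ "[:0, 1:]"]) simp

lemma bivariate_polynomial_add: "bivariate_polynomial f \<Longrightarrow> bivariate_polynomial g \<Longrightarrow> bivariate_polynomial (\<lambda>z. f z + g z)"
  unfolding bivariate_polynomial_def by (metis ev_add)

lemma bivariate_polynomial_mult: "bivariate_polynomial f \<Longrightarrow> bivariate_polynomial g \<Longrightarrow> bivariate_polynomial (\<lambda>z. f z * g z)"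
  unfolding bivariate_polynomial_def by (metis ev_mult)

lemma bivariate_polynomial_sum: "(\<And>i. i \<in> A \<Longrightarrow> bivariate_polynomial (f i)) \<Longrightarrow> bivariate_polynomial (\<lambda>z. \<Sum>i\<in>A. f i z)"
  by (induction A rule: infinite_finite_induct) (auto intro: bivariate_polynomial_const bivariate_polynomial_add)

lemma bivariate_polynomial_ddir: "bivariate_polynomial (\<lambda>z. Re ((ddir (z - P) ^^ k) q a b P))"
proof (induction k arbitrary: a b)
  case 0
  then show ?case by (simp add: bivariate_polynomial_const)
next
  case (Suc k)
  have "bivariate_polynomial (\<lambda>z. (Re z + - Re P) * Re ((ddir (z - P) ^^ k) q (Suc a) b P)
     + (Im z + - Im P) * Re ((ddir (z - P) ^^ k) q a (Suc b) P))"
    by (intro bivariate_polynomial_add bivariate_polynomial_mult bivariate_polynomial_const bivariate_polynomial_Re bivariate_polynomial_Im Suc.IH)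
  moreover have "Re ((ddir (z - P) ^^ Suc k) q a b P) = (Re z + - Re P) * Re ((ddir (z - P) ^^ k) q (Suc a) b P)
     + (Im z + - Im P) * Re ((ddir (z - P) ^^ k) q a (Suc b) P)" for z
    unfolding funpow.simps o_apply by (subst ddir_eq) simp
  ultimately show ?case by simp
qed

text \<open>High directional derivatives vanish throughout the ball, so Taylor's formula along each
  ray from the centre has no remainder.\<close>

lemma jet_polynomial_on_ball:
  assumes q: "jet (ball P R) q" and real: "\<And>a b x. cnj (q a b x) = q a b x"
    and z: "\<And>x. x \<in> ball P R \<Longrightarrow> (dz ^^ M) q 0 0 x = 0"
  shows "\<exists>p. \<forall>z\<in>ball P R. Re (q 0 0 z) = ev p (Re z) (Im z)"
proof -
  \<comment> \<open>\<open>Maclaurin\<close> asks for a positive order, also when \<open>M\<close>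
    is 0.\<close>
  define K where "K = 2 * M + 1"
  have T: "Re (q 0 0 z) = (\<Sum>k<K. Re ((ddir (z - P) ^^ k) q 0 0 P) * (1 / fact k))" if zB: "z \<in> ball P R" for z
  proof -
    define w where "w = z - P"
    define l where "l t = P + of_real t * w" for t :: real
    define D where "D k t = Re ((ddir w ^^ k) q 0 0 (l t))" for k t
    have lB: "l t \<in> ball P R" if "0 \<le> t" "t \<le> 1" for t
    proof -
      have "dist P (l t) = t * norm w" using that by (simp add: l_def dist_norm norm_mult)
      also have "\<dots> \<le> norm w" using that by (simp add: mult_left_le_one_le)
      also have "\<dots> < R" using zB by (simp add: w_def dist_norm norm_minus_commute)
      finally show ?thesis by simp
    qed
    have DD: "DERIV (D k) t :> D (Suc k) t" if "0 \<le> t" "t \<le> 1" for k t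
    proof -
      have "((ddir w ^^ k) q 0 0 has_derivative (\<lambda>h. ddir h ((ddir w ^^ k) q) 0 0 (l t))) (at (l t))"
        by (intro jetD[OF jet_funpow[OF jet_ddir q]] lB that)
      moreover have "(l has_derivative (\<lambda>s. of_real s * w)) (at t)"
        unfolding l_def by (auto intro!: derivative_eq_intros)
      ultimately have "((\<lambda>t. (ddir w ^^ k) q 0 0 (l t)) has_derivative
          (\<lambda>s. ddir (of_real s * w) ((ddir w ^^ k) q) 0 0 (l t))) (at t)"
        using has_derivative_compose by fastforce
      then have "(D k has_derivative (\<lambda>s. Re (ddir (of_real s * w) ((ddir w ^^ k) q) 0 0 (l t)))) (at t)"
        unfolding D_def by (rule has_derivative_Re)
      moreover have "(\<lambda>s. Re (ddir (of_real s * w) ((ddir w ^^ k) q) 0 0 (l t))) = (*) (D (Suc k) t)"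
        by (auto simp: D_def ddir_eq algebra_simps)
      ultimately show ?thesis by (simp add: has_field_derivative_def)
    qed
    have "\<exists>t. 0 < t \<and> t < 1 \<and> D 0 1 = (\<Sum>k<K. D k 0 / fact k * 1 ^ k) + D K t / fact K * 1 ^ K"
      by (rule Maclaurin) (auto simp: K_def intro: DD)
    then obtain t where t: "0 < t" "t < 1"
      "D 0 1 = (\<Sum>k<K. D k 0 / fact k * 1 ^ k) + D K t / fact K * 1 ^ K" by blast
    have "D K t = 0"
      using ddir_funpow_zero[OF q open_ball real z, of "l t" 0 0 K w] lB[of t] t
      by (simp add: D_def K_def)
    moreover have "l 0 = P" "l 1 = z" by (auto simp: l_def w_def)
    ultimately show ?thesis using t(3) by (simp add: D_def w_def)
  qed
  have "bivariate_polynomial (\<lambda>z. \<Sum>k<K. Re ((ddir (z - P) ^^ k) q 0 0 P) * (1 / fact k))"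
    by (intro bivariate_polynomial_sum bivariate_polynomial_mult bivariate_polynomial_const bivariate_polynomial_ddir)
  then obtain p where p: "\<And>z. (\<Sum>k<K. Re ((ddir (z - P) ^^ k) q 0 0 P) * (1 / fact k)) = ev p (Re z) (Im z)"
    unfolding bivariate_polynomial_def by (elim exE) (rule that, erule spec)
  show ?thesis
    by (intro exI[of _ p] ballI) (subst T, assumption, rule p)
qed

section \<open>Fourier modes along circles\<close>

lemma sum_shift_two:
  fixes A B C :: "nat \<Rightarrow> complex"
  assumes "\<And>j. j > n \<Longrightarrow> A j = 0" "\<And>j. j > n \<Longrightarrow> B j = 0"
  shows "(\<Sum>j\<le>n + 2. E ^ j * (A j + (if j = 0 then 0 else B (j - 1)) + (if j < 2 then 0 else C (j - 2))))
       = (\<Sum>j\<le>n. E ^ j * (A j + E * B j + E\<^sup>2 * C j))"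
proof -
  have 1: "(\<Sum>j\<le>n + 2. E ^ j * A j) = (\<Sum>j\<le>n. E ^ j * A j)"
    by (simp add: assms)
  have 2: "(\<Sum>j\<le>n + 2. E ^ j * (if j = 0 then 0 else B (j - 1))) = (\<Sum>j\<le>n. E ^ j * (E * B j))"
    unfolding add_2_eq_Suc' sum.atMost_Suc_shift[of _ "Suc n"] by (simp add: assms mult.left_commute mult.assoc)
  have 3: "(\<Sum>j\<le>n + 2. E ^ j * (if j < 2 then 0 else C (j - 2))) = (\<Sum>j\<le>n. E ^ j * (E\<^sup>2 * C j))"
    unfolding add_2_eq_Suc' sum.atMost_Suc_shift
    by (simp add: mult.left_commute power2_eq_square mult.assoc)
  have "(\<Sum>j\<le>n + 2. E ^ j * (A j + (if j = 0 then 0 else B (j - 1)) + (if j < 2 then 0 else C (j - 2))))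
    = (\<Sum>j\<le>n + 2. E ^ j * A j) + (\<Sum>j\<le>n + 2. E ^ j * (if j = 0 then 0 else B (j - 1)))
      + (\<Sum>j\<le>n + 2. E ^ j * (if j < 2 then 0 else C (j - 2)))"
    by (simp only: distrib_left sum.distrib)
  also have "\<dots> = (\<Sum>j\<le>n. E ^ j * (A j + E * B j + E\<^sup>2 * C j))"
    unfolding 1 2 3 by (simp only: distrib_left sum.distrib)
  finally show ?thesis .
qed


definition jzero :: jet_family where "jzero a b x = 0"

lemma jet_jzero: "jet U jzero"
  by (simp add: jet_def jzero_def[abs_def])

lemma dz_jzero [simp]: "dz jzero = jzero" "dzb jzero = jzero"
  by (auto simp: fun_eq_iff dz_def dzb_def jzero_def)

lemma lin_apply: "lin c q d q' a b x = c * q a b x + d * q' a b x"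
  by (simp add: lin_def)

text \<open>Multiplying by \<open>cis \<theta>\<close> at each differentiation keeps the exponents non-negative, and the
  constants \<open>2 * m - N\<close> are chosen so that step \<open>j\<close> annihilates the harmonic \<open>j - N\<close>.\<close>

lemma circle_harmonics:
  fixes b :: "complex \<Rightarrow> nat \<Rightarrow> complex"
  assumes q: "jet U q" and I: "open I" and XU: "\<forall>x\<in>X. \<forall>\<theta>\<in>I. x + \<i> * of_real r * cis \<theta> \<in> U"
    and trig: "\<forall>x\<in>X. \<forall>\<theta>\<in>I.
        q 0 0 (x + \<i> * of_real r * cis \<theta>) = (\<Sum>j\<le>2 * N. b x j * cis ((real j - real N) * \<theta>))"
  shows "\<exists>H. (\<forall>j. jet U (H j)) \<and> (\<forall>j>2 * m. H j = jzero)
     \<and> H (2 * m) = (\<lambda>a b x. of_real ((- r) ^ m) * (dz ^^ m) q a b x)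
     \<and> (\<forall>x\<in>X. \<forall>\<theta>\<in>I. (\<Sum>j\<le>2 * m. cis \<theta> ^ j * H j 0 0 (x + \<i> * of_real r * cis \<theta>))
         = (\<Sum>j\<le>2 * N. b x j * (\<Prod>l<m. \<i> * of_int (int j - int l)) * cis ((real m + real j - real N) * \<theta>)))"
proof (induction m)
  case 0
  show ?case
    by (rule exI[of _ "\<lambda>j. if j = 0 then q else jzero"]) (auto simp: q jet_jzero trig)
next
  case (Suc m)
  then obtain H where H: "\<And>j. jet U (H j)" "\<And>j. j > 2 * m \<Longrightarrow> H j = jzero"
    "H (2 * m) = (\<lambda>a b x. of_real ((- r) ^ m) * (dz ^^ m) q a b x)"
    and sumH: "\<And>x \<theta>. x \<in> X \<Longrightarrow> \<theta> \<in> I \<Longrightarrow> (\<Sum>j\<le>2 * m. cis \<theta> ^ j * H j 0 0 (x + \<i> * of_real r * cis \<theta>))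
         = (\<Sum>j\<le>2 * N. b x j * (\<Prod>l<m. \<i> * of_int (int j - int l)) * cis ((real m + real j - real N) * \<theta>))"
    by blast
  define \<kappa> where "\<kappa> = 2 * real m - real N"
  define A where "A j = lin (- of_real r) (dzb (H j)) 0 jzero" for j
  define B where "B j = lin (\<i> * of_real (real j - \<kappa>)) (H j) 0 jzero" for j
  define C where "C j = lin (- of_real r) (dz (H j)) 0 jzero" for j
  \<comment> \<open>With E = cis \<theta>, the operator E (d/d\<theta> - \<i> \<kappa>) sends E^j
    H_j to E^j A_j + E^(j+1) B_j + E^(j+2) C_j. Here the terms are collected by powers of E.\<close>
  define H' where "H' j = lin 1 (A j) 1 (lin 1 (if j = 0 then jzero else B (j - 1)) 1 (if j < 2 then jzero else C (j - 2)))" for j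
  have JABC: "jet U (A j)" "jet U (B j)" "jet U (C j)" for j
    unfolding A_def B_def C_def by (intro jet_lin jet_dz jet_dzb H jet_jzero)+
  have J: "jet U (H' j)" for j unfolding H'_def by (intro jet_lin) (auto simp: JABC jet_jzero)
  have ABz: "A j = jzero" "B j = jzero" "C j = jzero" if "j > 2 * m" for j
    unfolding A_def B_def C_def H(2)[OF that] dz_jzero by (auto simp: fun_eq_iff lin_apply jzero_def)
  have Z0: "H' j = jzero" if "j > 2 * Suc m" for j
    using that ABz[of j] ABz[of "j - 1"] ABz[of "j - 2"]
    by (simp add: H'_def fun_eq_iff lin_apply jzero_def)
  have Top: "H' (2 * Suc m) = (\<lambda>a b x. of_real ((- r) ^ Suc m) * (dz ^^ Suc m) q a b x)"
  proof -
    have "H' (2 * Suc m) = C (2 * m)" by (auto simp: H'_def ABz fun_eq_iff lin_apply jzero_def)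
    moreover have "dz (H (2 * m)) a b x = of_real ((- r) ^ m) * dz ((dz ^^ m) q) a b x" for a b x
      unfolding dz_def H(3) by (simp add: algebra_simps diff_divide_distrib)
    ultimately show ?thesis by (intro ext) (simp add: C_def lin_apply jzero_def)
  qed
  have Sum: "(\<Sum>j\<le>2 * Suc m. cis \<theta> ^ j * H' j 0 0 (x + \<i> * of_real r * cis \<theta>))
     = (\<Sum>j\<le>2 * N. b x j * (\<Prod>l<Suc m. \<i> * of_int (int j - int l)) * cis ((real (Suc m) + real j - real N) * \<theta>))"
    if x: "x \<in> X" and \<theta>: "\<theta> \<in> I" for x \<theta>
  proof -
    define c where "c t = x + \<i> * of_real r * cis t" for t
    define \<beta> where "\<beta> j = b x j * (\<Prod>l<m. \<i> * of_int (int j - int l))" for j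
    define E where "E = cis \<theta>"
    have Dcis: "((\<lambda>t. cis (\<alpha> * t)) has_vector_derivative \<i> * of_real \<alpha> * cis (\<alpha> * t)) (at t)" for \<alpha> t
    proof -
      have "((\<lambda>z. exp (\<i> * of_real \<alpha> * z)) has_field_derivative
          exp (\<i> * of_real \<alpha> * of_real t) * (\<i> * of_real \<alpha>)) (at (of_real t))"
        by (auto intro!: derivative_eq_intros)
      from has_vector_derivative_real_field[OF this] show ?thesis
        by (simp add: cis_conv_exp algebra_simps)
    qed
    have Dc: "(c has_vector_derivative - of_real r * cis t) (at t)" for t
      unfolding c_def using Dcis[of 1 t]
      by (auto intro!: derivative_eq_intros simp: algebra_simps)
    have cU: "c \<theta> \<in> U" using XU x \<theta> by (simp add: c_def)
    have DH: "((\<lambda>t. H j 0 0 (c t)) has_vector_derivative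
        - of_real r * (E * dz (H j) 0 0 (c \<theta>) + cnj E * dzb (H j) 0 0 (c \<theta>))) (at \<theta>)" for j
    proof -
      have "((\<lambda>t. H j 0 0 (c t)) has_derivative (\<lambda>s. ddir (s *\<^sub>R (- of_real r * cis \<theta>)) (H j) 0 0 (c \<theta>))) (at \<theta>)"
        using has_derivative_compose[OF Dc[of \<theta>, unfolded has_vector_derivative_def] jetD[OF H(1) cU]] .
      moreover have "ddir (s *\<^sub>R (- of_real r * cis \<theta>)) (H j) 0 0 (c \<theta>)
         = s *\<^sub>R (- of_real r * (E * dz (H j) 0 0 (c \<theta>) + cnj E * dzb (H j) 0 0 (c \<theta>)))" for s
        unfolding ddir_def lin_apply E_def by (simp add: algebra_simps scaleR_conv_of_real)
      ultimately show ?thesis by (simp add: has_vector_derivative_def)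
    qed
    have D1: "((\<lambda>t. \<Sum>j\<le>2 * m. cis t ^ j * H j 0 0 (c t)) has_vector_derivative
       (\<Sum>j\<le>2 * m. E ^ j * (- of_real r * (E * dz (H j) 0 0 (c \<theta>) + cnj E * dzb (H j) 0 0 (c \<theta>)))
           + (\<i> * of_real (real j) * E ^ j) * H j 0 0 (c \<theta>))) (at \<theta>)"
    proof (intro has_vector_derivative_sum)
      fix j
      have "((\<lambda>t. cis t ^ j) has_vector_derivative \<i> * of_real (real j) * E ^ j) (at \<theta>)"
        using Dcis[of "real j" \<theta>] by (simp add: Complex.DeMoivre E_def)
      from has_vector_derivative_mult[OF this DH]
      show "((\<lambda>t. cis t ^ j * H j 0 0 (c t)) has_vector_derivative
        E ^ j * (- of_real r * (E * dz (H j) 0 0 (c \<theta>) + cnj E * dzb (H j) 0 0 (c \<theta>)))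
           + (\<i> * of_real (real j) * E ^ j) * H j 0 0 (c \<theta>)) (at \<theta>)"
        by (simp add: E_def)
    qed
    have D2: "((\<lambda>t. \<Sum>j\<le>2 * N. \<beta> j * cis ((real m + real j - real N) * t)) has_vector_derivative
       (\<Sum>j\<le>2 * N. \<beta> j * (\<i> * of_real (real m + real j - real N) * cis ((real m + real j - real N) * \<theta>)))) (at \<theta>)"
      by (intro has_vector_derivative_sum has_vector_derivative_mult_right Dcis)
    have "((\<lambda>t. \<Sum>j\<le>2 * m. cis t ^ j * H j 0 0 (c t)) has_vector_derivative
       (\<Sum>j\<le>2 * N. \<beta> j * (\<i> * of_real (real m + real j - real N) * cis ((real m + real j - real N) * \<theta>)))) (at \<theta>)"
      using sumH[OF x] by (intro has_vector_derivative_transform_within_open[OF D2 I \<theta>]) (simp add: c_def \<beta>_def)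
    from vector_derivative_unique_at[OF D1 this]
    have eq: "(\<Sum>j\<le>2 * m. E ^ j * (- of_real r * (E * dz (H j) 0 0 (c \<theta>) + cnj E * dzb (H j) 0 0 (c \<theta>)))
           + (\<i> * of_real (real j) * E ^ j) * H j 0 0 (c \<theta>))
      = (\<Sum>j\<le>2 * N. \<beta> j * (\<i> * of_real (real m + real j - real N) * cis ((real m + real j - real N) * \<theta>)))" .
    have S: "(\<Sum>j\<le>2 * m. E ^ j * H j 0 0 (c \<theta>)) = (\<Sum>j\<le>2 * N. \<beta> j * cis ((real m + real j - real N) * \<theta>))"
      unfolding E_def c_def \<beta>_def by (rule sumH[OF x \<theta>])
    have EE: "E * cnj E = 1" by (simp add: E_def complex_norm_square[symmetric] cis_cnj cis_mult)
    have "(\<Sum>j\<le>2 * Suc m. E ^ j * H' j 0 0 (c \<theta>)) = (\<Sum>j\<le>2 * m + 2. E ^ j * (A j 0 0 (c \<theta>)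
       + (if j = 0 then 0 else B (j - 1) 0 0 (c \<theta>)) + (if j < 2 then 0 else C (j - 2) 0 0 (c \<theta>))))"
      by (intro sum.cong) (auto simp: H'_def lin_apply jzero_def)
    also have "\<dots> = (\<Sum>j\<le>2 * m. E ^ j * (A j 0 0 (c \<theta>) + E * B j 0 0 (c \<theta>) + E\<^sup>2 * C j 0 0 (c \<theta>)))"
      by (rule sum_shift_two) (simp_all add: ABz jzero_def)
    also have "\<dots> = E * ((\<Sum>j\<le>2 * m. E ^ j * (- of_real r * (E * dz (H j) 0 0 (c \<theta>) + cnj E * dzb (H j) 0 0 (c \<theta>)))
           + (\<i> * of_real (real j) * E ^ j) * H j 0 0 (c \<theta>)) - \<i> * of_real \<kappa> * (\<Sum>j\<le>2 * m. E ^ j * H j 0 0 (c \<theta>)))"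
      unfolding sum_distrib_left right_diff_distrib sum_subtractf[symmetric]
    proof (intro sum.cong refl)
      fix j
      have A: "A j 0 0 (c \<theta>) = (E * cnj E) * (- of_real r * dzb (H j) 0 0 (c \<theta>))"
        unfolding EE by (simp add: A_def lin_apply)
      show "E ^ j * (A j 0 0 (c \<theta>) + E * B j 0 0 (c \<theta>) + E\<^sup>2 * C j 0 0 (c \<theta>))
       = E * (E ^ j * (- of_real r * (E * dz (H j) 0 0 (c \<theta>) + cnj E * dzb (H j) 0 0 (c \<theta>)))
           + (\<i> * of_real (real j) * E ^ j) * H j 0 0 (c \<theta>)) - E * (\<i> * of_real \<kappa> * (E ^ j * H j 0 0 (c \<theta>)))"
        unfolding A by (simp add: B_def C_def lin_apply jzero_def algebra_simps power2_eq_square)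
    qed
    also have "\<dots> = E * ((\<Sum>j\<le>2 * N. \<beta> j * (\<i> * of_real (real m + real j - real N) * cis ((real m + real j - real N) * \<theta>)))
         - \<i> * of_real \<kappa> * (\<Sum>j\<le>2 * N. \<beta> j * cis ((real m + real j - real N) * \<theta>)))"
      by (simp only: eq S)
    also have "\<dots> = (\<Sum>j\<le>2 * N. b x j * (\<Prod>l<Suc m. \<i> * of_int (int j - int l)) * cis ((real (Suc m) + real j - real N) * \<theta>))"
      unfolding sum_distrib_left right_diff_distrib sum_subtractf[symmetric]
    proof (intro sum.cong refl)
      fix j
      have Ec: "E * cis ((real m + real j - real N) * \<theta>) = cis ((real (Suc m) + real j - real N) * \<theta>)"
        by (simp add: E_def cis_mult algebra_simps)
      have gen: "E * (u * (\<i> * of_real v * W)) - E * (\<i> * of_real k * (u * W)) = u * (\<i> * of_real (v - k)) * (E * W)"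
        for u W :: complex and v k :: real by (simp add: algebra_simps)
      have "of_real (real m + real j - real N - \<kappa>) = (of_int (int j - int m) :: complex)"
        by (simp add: \<kappa>_def)
      then show "E * (\<beta> j * (\<i> * of_real (real m + real j - real N) * cis ((real m + real j - real N) * \<theta>)))
          - E * (\<i> * of_real \<kappa> * (\<beta> j * cis ((real m + real j - real N) * \<theta>)))
        = b x j * (\<Prod>l<Suc m. \<i> * of_int (int j - int l)) * cis ((real (Suc m) + real j - real N) * \<theta>)"
        unfolding gen Ec by (simp only: \<beta>_def prod.lessThan_Suc mult.assoc)
    qed
    finally show ?thesis by (simp add: E_def c_def)
  qed
  show ?case
    by (intro exI[of _ H'] conjI allI impI ballI J Z0 Top Sum)
qed

text \<open>After 2 N + 1 steps every harmonic has met its zero factor. Now P is held fixed and the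
  centre x = P - \<i> r cis \<theta> of the circle moves instead: the identity becomes a polynomial
  in cis \<theta> whose coefficients depend on P alone. It has infinitely many roots, so its leading
  coefficient, a non-zero multiple of the derivative in question, is zero.\<close>

lemma top_harmonic_zero:
  fixes b :: "complex \<Rightarrow> nat \<Rightarrow> complex"
  assumes q: "jet U q" and I: "open I" and XU: "\<forall>x\<in>X. \<forall>\<theta>\<in>I. x + \<i> * of_real r * cis \<theta> \<in> U"
    and trig: "\<forall>x\<in>X. \<forall>\<theta>\<in>I.
        q 0 0 (x + \<i> * of_real r * cis \<theta>) = (\<Sum>j\<le>2 * N. b x j * cis ((real j - real N) * \<theta>))"
    and r: "r \<noteq> 0" and inf: "infinite (cis ` {\<theta>\<in>I. P - \<i> * of_real r * cis \<theta> \<in> X})"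
  shows "(dz ^^ (2 * N + 1)) q 0 0 P = 0"
proof -
  define M where "M = 2 * N + 1"
  obtain H where H: "H (2 * M) = (\<lambda>a b x. of_real ((- r) ^ M) * (dz ^^ M) q a b x)"
    and sumH: "\<And>x \<theta>. x \<in> X \<Longrightarrow> \<theta> \<in> I \<Longrightarrow> (\<Sum>j\<le>2 * M. cis \<theta> ^ j * H j 0 0 (x + \<i> * of_real r * cis \<theta>))
         = (\<Sum>j\<le>2 * N. b x j * (\<Prod>l<M. \<i> * of_int (int j - int l)) * cis ((real M + real j - real N) * \<theta>))"
    using circle_harmonics[where m=M, OF q I XU trig]
    by (elim exE conjE) (rule that, assumption, blast)
  have P0: "(\<Prod>l<M. \<i> * of_int (int j - int l)) = (0::complex)" if "j \<le> 2 * N" for j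
    by (rule prod_zero[OF finite_lessThan], rule bexI[of _ j]) (use that in \<open>simp_all add: M_def\<close>)
  have z: "(\<Sum>j\<le>2 * M. H j 0 0 P * cis \<theta> ^ j) = 0"
    if "\<theta> \<in> I" "P - \<i> * of_real r * cis \<theta> \<in> X" for \<theta>
  proof -
    have "(\<Sum>j\<le>2 * M. H j 0 0 P * cis \<theta> ^ j) = (\<Sum>j\<le>2 * M. cis \<theta> ^ j * H j 0 0 (P - \<i> * of_real r * cis \<theta> + \<i> * of_real r * cis \<theta>))"
      by (simp add: mult.commute)
    also have "\<dots> = 0"
      unfolding sumH[OF that(2,1)] by (intro sum.neutral) (use P0 in auto)
    finally show ?thesis .
  qed
  have "H (2 * M) 0 0 P = 0"
  proof (rule ccontr)
    assume "H (2 * M) 0 0 P \<noteq> 0"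
    then have "finite {z. (\<Sum>j\<le>2 * M. H j 0 0 P * z ^ j) = 0}"
      by (subst polyfun_finite_roots) blast
    moreover have "cis ` {\<theta>\<in>I. P - \<i> * of_real r * cis \<theta> \<in> X} \<subseteq> {z. (\<Sum>j\<le>2 * M. H j 0 0 P * z ^ j) = 0}"
      using z by auto
    ultimately show False using inf finite_subset by blast
  qed
  then show ?thesis unfolding M_def[symmetric] using r by (simp only: H) simp
qed

section \<open>Smooth coefficients and local polynomiality\<close>

lemma cinf_on_pdir:
  assumes "cinf_on U f" "d \<in> {1, \<i>}"
  shows "cinf_on U (pdir d f)"
proof -
  have a: "ipart ds (pdir d f) = ipart (ds @ [d]) f" for ds
    by (induction ds) auto
  show ?thesis
    unfolding cinf_on_def a
  proof (intro allI impI)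
    fix ds assume "set ds \<subseteq> {1, \<i>}"
    then have "set (ds @ [d]) \<subseteq> {1, \<i>}" using assms(2) by simp
    with assms(1) show "continuous_on U (ipart (ds @ [d]) f) \<and>
      (\<forall>da\<in>{1, \<i>}. \<forall>x\<in>U. (\<lambda>t. ipart (ds @ [d]) f (x + of_real t * da)) differentiable at 0)"
      unfolding cinf_on_def by blast
  qed
qed

lemma cinf_on_subset: "cinf_on U f \<Longrightarrow> V \<subseteq> U \<Longrightarrow> cinf_on V f"
  unfolding cinf_on_def by (meson continuous_on_subset subsetD)

lemma cinf_on_cont: "cinf_on U f \<Longrightarrow> continuous_on U f"
  unfolding cinf_on_def by (elim allE[of _ "[]"]) auto

lemma cinf_on_line:
  assumes "cinf_on U f" "d \<in> {1, \<i>}" "z + of_real s * d \<in> U"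
  shows "((\<lambda>s. f (z + of_real s * d)) has_field_derivative pdir d f (z + of_real s * d)) (at s)"
proof -
  let ?x = "z + of_real s * d"
  have "(\<lambda>t. f (?x + of_real t * d)) differentiable at 0"
    using assms unfolding cinf_on_def by (elim allE[of _ "[]"]) auto
  then have "((\<lambda>t. f (?x + of_real t * d)) has_field_derivative pdir d f ?x) (at 0)"
    unfolding pdir_def real_differentiable_def using DERIV_imp_deriv by blast
  then have "((\<lambda>t. f (z + of_real (t + s) * d)) has_field_derivative pdir d f ?x) (at 0)"
    by (simp add: algebra_simps)
  then show ?thesis
    using DERIV_shift[of "\<lambda>t. f (z + of_real t * d)" _ 0 s] by simp
qed

lemma Complex_rect_in_ball:
  assumes "\<bar>a - Re x\<bar> < e / 2" "\<bar>b - Im x\<bar> < e / 2"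
  shows "Complex a b \<in> ball x e"
proof -
  have "norm (Complex a b - x) \<le> \<bar>a - Re x\<bar> + \<bar>b - Im x\<bar>"
    using cmod_le[of "Complex a b - x"] by simp
  with assms show ?thesis by (simp add: dist_norm norm_minus_commute)
qed

text \<open>\<open>cinf_on\<close> speaks of derivatives along the axes only; their continuity
  upgrades them to a total derivative.\<close>

lemma cinf_on_has_derivative:
  assumes f: "cinf_on U f" and U: "open U" and x: "x \<in> U"
  shows "(f has_derivative (\<lambda>h. Re h * pdir 1 f x + Im h * pdir \<i> f x)) (at x)"
proof -
  obtain e where e: "e > 0" "ball x e \<subseteq> U" using U x openE by blast
  define X where "X = ball (Re x) (e / 2)"
  define Y where "Y = ball (Im x) (e / 2)"
  have XY: "Complex a b \<in> U" if "a \<in> X" "b \<in> Y" for a b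
    using that e(2) Complex_rect_in_ball[of a x e b] by (auto simp: X_def Y_def dist_real_def abs_minus_commute)
  have xX: "Re x \<in> X" "Im x \<in> Y" using e by (auto simp: X_def Y_def)
  have oXY: "open (X \<times> Y)" by (auto simp: X_def Y_def intro: open_Times)
  define fy where "fy a b = (pdir \<i> f (Complex a b) *\<^sub>R id_blinfun :: real \<Rightarrow>\<^sub>L real)" for a b
  have "((\<lambda>(a, b). f (Complex a b)) has_derivative (\<lambda>(ta, tb). ta * pdir 1 f x + fy (Re x) (Im x) tb))
      (at (Re x, Im x) within X \<times> Y)"
  proof (rule has_derivative_partialsI)
    have "((\<lambda>s. f (of_real (Im x) * \<i> + of_real s * 1)) has_field_derivative pdir 1 f (of_real (Im x) * \<i> + of_real (Re x) * 1)) (at (Re x))"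
      by (rule cinf_on_line[OF f]) (use x in \<open>auto simp: complex_eq_iff intro: back_subst[of "\<lambda>z. z \<in> U"]\<close>)
    moreover have "of_real (Im x) * \<i> + of_real (Re x) * 1 = x" "\<And>s. of_real (Im x) * \<i> + of_real s * 1 = Complex s (Im x)"
      by (auto simp: complex_eq_iff)
    ultimately have "((\<lambda>s. f (Complex s (Im x))) has_field_derivative pdir 1 f x) (at (Re x))" by simp
    then show "((\<lambda>a. f (Complex a (Im x))) has_derivative (\<lambda>ta. ta * pdir 1 f x)) (at (Re x) within X)"
      by (simp add: has_field_derivative_def mult.commute[of _ "pdir 1 f x"] has_derivative_at_withinI)
  next
    fix a b assume ab: "a \<in> X" "b \<in> Y"
    have eq: "of_real a + of_real s * \<i> = Complex a s" for s by (simp add: complex_eq_iff)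
    have "((\<lambda>s. f (of_real a + of_real s * \<i>)) has_field_derivative pdir \<i> f (of_real a + of_real b * \<i>)) (at b)"
      by (rule cinf_on_line[OF f]) (use XY[OF ab] in \<open>auto simp: eq\<close>)
    then have "((\<lambda>s. f (Complex a s)) has_field_derivative pdir \<i> f (Complex a b)) (at b)" by (simp only: eq)
    then show "((\<lambda>b. f (Complex a b)) has_derivative blinfun_apply (fy a b)) (at b within Y)"
      by (simp add: fy_def has_field_derivative_def scaleR_blinfun.rep_eq has_derivative_at_withinI)
  next
    have "continuous_on U (pdir \<i> f)" by (rule cinf_on_cont[OF cinf_on_pdir[OF f]]) simp
    then have "continuous_on (X \<times> Y) (\<lambda>ab. pdir \<i> f (Complex (fst ab) (snd ab)))"
      by (rule continuous_on_compose2) (auto intro!: continuous_intros XY)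
    then have "continuous_on (X \<times> Y) (\<lambda>(a, b). fy a b)"
      unfolding fy_def case_prod_beta by (intro continuous_intros)
    then show "continuous (at (Re x, Im x) within X \<times> Y) (\<lambda>(a, b). fy a b)"
      using xX by (simp add: continuous_on_eq_continuous_within)
  qed (use xX in \<open>auto simp: Y_def\<close>)
  then have "((\<lambda>(a, b). f (Complex a b)) has_derivative (\<lambda>(ta, tb). ta * pdir 1 f x + fy (Re x) (Im x) tb)) (at (Re x, Im x))"
    using at_within_open[OF _ oXY, of "(Re x, Im x)"] xX by simp
  moreover have "((\<lambda>z. (Re z, Im z)) has_derivative (\<lambda>h. (Re h, Im h))) (at x)"
    by (intro has_derivative_Pair has_derivative_Re has_derivative_Im has_derivative_ident)
  ultimately have "((\<lambda>z. (\<lambda>(a, b). f (Complex a b)) (Re z, Im z)) has_derivative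
      (\<lambda>h. (\<lambda>(ta, tb). ta * pdir 1 f x + fy (Re x) (Im x) tb) (Re h, Im h))) (at x)"
    using has_derivative_compose by fastforce
  then show ?thesis by (simp add: fy_def scaleR_blinfun.rep_eq mult.commute)
qed

lemma pdir_cong:
  assumes "open U" "x \<in> U" "\<And>y. y \<in> U \<Longrightarrow> f y = g y"
  shows "pdir d f x = pdir d g x"
  unfolding pdir_def
proof (rule deriv_cong_ev)
  have "open ((\<lambda>t::real. x + of_real t * d) -` U)"
    by (intro open_vimage assms(1) continuous_intros)
  then have "\<forall>\<^sub>F t in nhds 0. t \<in> (\<lambda>t::real. x + of_real t * d) -` U"
    using assms(2) by (intro eventually_nhds_in_open) auto
  then show "\<forall>\<^sub>F t in nhds 0. f (x + of_real t * d) = g (x + of_real t * d)"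
    by (rule eventually_mono) (auto simp: assms(3))
qed simp

text \<open>Two mean value theorems: along d for the increment in direction d', and then along d'
  for the derivative so obtained.\<close>

lemma mixed_difference:
  assumes f: "cinf_on (ball x e) f" and d: "d \<in> {1, \<i>}" "d' \<in> {1, \<i>}" and h: "h > 0" "2 * h < e"
  shows "\<exists>s t. 0 < s \<and> s < h \<and> 0 < t \<and> t < h \<and>
    f (x + of_real h * d + of_real h * d') - f (x + of_real h * d) - f (x + of_real h * d') + f x
     = h * h * pdir d' (pdir d f) (x + of_real s * d + of_real t * d')"
proof -
  have nd: "norm d = 1" "norm d' = 1" using d by auto
  have B: "x + of_real s * d + of_real t * d' \<in> ball x e" if "0 \<le> s" "s \<le> h" "0 \<le> t" "t \<le> h" for s t
  proof -
    have "norm (of_real s * d + of_real t * d') \<le> s + t"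
      using norm_triangle_ineq[of "of_real s * d" "of_real t * d'"] that by (simp add: norm_mult nd)
    also have "\<dots> < e" using that h by linarith
    finally have "norm (of_real s * d + of_real t * d') < e" .
    moreover have "x - (x + of_real s * d + of_real t * d') = - (of_real s * d + of_real t * d')" by simp
    ultimately show ?thesis by (simp only: mem_ball dist_norm norm_minus_cancel)
  qed
  define \<phi> where "\<phi> s = f (x + of_real h * d' + of_real s * d) - f (x + of_real s * d)" for s
  have D\<phi>: "(\<phi> has_field_derivative
      pdir d f (x + of_real h * d' + of_real s * d) - pdir d f (x + of_real s * d)) (at s)" if "0 \<le> s" "s \<le> h" for s
    unfolding \<phi>_def using B[OF that, of h] B[OF that, of 0] h
    by (intro DERIV_diff cinf_on_line[OF f d(1)]) (auto simp: algebra_simps)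
  obtain s where s: "0 < s" "s < h" "\<phi> h - \<phi> 0 = (h - 0) * (pdir d f (x + of_real h * d' + of_real s * d) - pdir d f (x + of_real s * d))"
    using MVT2[OF h(1) D\<phi>] by blast
  define \<psi> where "\<psi> t = pdir d f (x + of_real s * d + of_real t * d')" for t
  have D\<psi>: "(\<psi> has_field_derivative pdir d' (pdir d f) (x + of_real s * d + of_real t * d')) (at t)"
    if "0 \<le> t" "t \<le> h" for t
    unfolding \<psi>_def using B[of s t] s that
    by (intro cinf_on_line[OF cinf_on_pdir[OF f d(1)] d(2)]) auto
  obtain t where t: "0 < t" "t < h" "\<psi> h - \<psi> 0 = (h - 0) * pdir d' (pdir d f) (x + of_real s * d + of_real t * d')"
    using MVT2[OF h(1) D\<psi>] by blast
  have "f (x + of_real h * d + of_real h * d') - f (x + of_real h * d) - f (x + of_real h * d') + f x = \<phi> h - \<phi> 0"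
    by (simp add: \<phi>_def algebra_simps)
  also have "\<dots> = h * (\<psi> h - \<psi> 0)" unfolding s(3) by (simp add: \<psi>_def algebra_simps)
  also have "\<dots> = h * h * pdir d' (pdir d f) (x + of_real s * d + of_real t * d')" unfolding t(3) by simp
  finally show ?thesis using s t by blast
qed

text \<open>The second difference over a small square is symmetric in the two directions. Each mixed
  derivative attains its normalised value somewhere in the square, so continuity equates
  them.\<close>

lemma pdir_commute:
  assumes f: "cinf_on U f" and U: "open U" and x: "x \<in> U"
  shows "pdir \<i> (pdir 1 f) x = pdir 1 (pdir \<i> f) x"
proof (rule ccontr)
  assume ne: "\<not> ?thesis"
  define \<epsilon> where "\<epsilon> = \<bar>pdir \<i> (pdir 1 f) x - pdir 1 (pdir \<i> f) x\<bar> / 2"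
  have \<epsilon>: "\<epsilon> > 0" using ne by (simp add: \<epsilon>_def)
  have c: "isCont (pdir \<i> (pdir 1 f)) x" "isCont (pdir 1 (pdir \<i> f)) x"
    using f by (auto intro!: continuous_on_interior[OF cinf_on_cont[OF cinf_on_pdir[OF cinf_on_pdir]]]
        simp: interior_open[OF U] x)
  obtain d1 where d1: "d1 > 0" "\<And>y. dist y x < d1 \<Longrightarrow> dist (pdir \<i> (pdir 1 f) y) (pdir \<i> (pdir 1 f) x) < \<epsilon>"
    using c(1) \<epsilon> unfolding continuous_at_eps_delta by blast
  obtain d2 where d2: "d2 > 0" "\<And>y. dist y x < d2 \<Longrightarrow> dist (pdir 1 (pdir \<i> f) y) (pdir 1 (pdir \<i> f) x) < \<epsilon>"
    using c(2) \<epsilon> unfolding continuous_at_eps_delta by blast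
  obtain e where e: "e > 0" "ball x e \<subseteq> U" using U x openE by blast
  define h where "h = min e (min d1 d2) / 3"
  have h: "h > 0" "2 * h < e" "2 * h < d1" "2 * h < d2" using e(1) d1(1) d2(1) by (auto simp: h_def)
  have f': "cinf_on (ball x e) f" by (rule cinf_on_subset[OF f e(2)])
  obtain s t where st: "0 < s" "s < h" "0 < t" "t < h"
    "f (x + of_real h * 1 + of_real h * \<i>) - f (x + of_real h * 1) - f (x + of_real h * \<i>) + f x
     = h * h * pdir \<i> (pdir 1 f) (x + of_real s * 1 + of_real t * \<i>)"
    using mixed_difference[OF f', of 1 \<i> h] h by auto
  obtain s' t' where st': "0 < s'" "s' < h" "0 < t'" "t' < h"
    "f (x + of_real h * \<i> + of_real h * 1) - f (x + of_real h * \<i>) - f (x + of_real h * 1) + f x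
     = h * h * pdir 1 (pdir \<i> f) (x + of_real s' * \<i> + of_real t' * 1)"
    using mixed_difference[OF f', of \<i> 1 h] h by auto
  have "h * h * pdir \<i> (pdir 1 f) (x + of_real s * 1 + of_real t * \<i>) = h * h * pdir 1 (pdir \<i> f) (x + of_real s' * \<i> + of_real t' * 1)"
    using st(5) st'(5) by (simp add: algebra_simps)
  then have eq: "pdir \<i> (pdir 1 f) (x + of_real s * 1 + of_real t * \<i>) = pdir 1 (pdir \<i> f) (x + of_real s' * \<i> + of_real t' * 1)"
    using h(1) by simp
  have n: "dist (x + of_real s * u + of_real t * v) x < 2 * h"
    if "norm u = 1" "norm v = 1" "0 < s" "s < h" "0 < t" "t < h" for u v s t
  proof -
    have "dist (x + of_real s * u + of_real t * v) x = norm (of_real s * u + of_real t * v)" by (simp add: dist_norm)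
    also have "\<dots> \<le> s + t"
      using norm_triangle_ineq[of "of_real s * u" "of_real t * v"] that by (simp add: norm_mult)
    finally show ?thesis using that by linarith
  qed
  have "dist (pdir \<i> (pdir 1 f) (x + of_real s * 1 + of_real t * \<i>)) (pdir \<i> (pdir 1 f) x) < \<epsilon>"
    using n[of 1 \<i> s t] st h by (intro d1(2)) auto
  moreover have "dist (pdir 1 (pdir \<i> f) (x + of_real s' * \<i> + of_real t' * 1)) (pdir 1 (pdir \<i> f) x) < \<epsilon>"
    using n[of \<i> 1 s' t'] st' h by (intro d2(2)) auto
  moreover have "False" if "\<bar>w - u\<bar> < \<bar>u - v\<bar> / 2" "\<bar>w - v\<bar> < \<bar>u - v\<bar> / 2" for u v w :: real
    using that by (auto simp: abs_if split: if_splits)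
  ultimately show False unfolding eq \<epsilon>_def dist_real_def by blast
qed

text \<open>One fixed order of differentiation, those along \<i> being applied first;
  \<open>ipart_commute\<close> reduces the other orders to it.\<close>

definition cinf_jet :: "(complex \<Rightarrow> real) \<Rightarrow> jet_family" where
  "cinf_jet f a b x = of_real (ipart (replicate a 1 @ replicate b \<i>) f x)"

lemma cinf_on_ipart: "cinf_on U f \<Longrightarrow> set ds \<subseteq> {1, \<i>} \<Longrightarrow> cinf_on U (ipart ds f)"
  by (induction ds) (auto intro!: cinf_on_pdir)

lemma ipart_commute:
  assumes f: "cinf_on U f" and U: "open U" and x: "x \<in> U"
  shows "ipart (\<i> # replicate a 1 @ replicate b \<i>) f x = ipart (replicate a 1 @ replicate (Suc b) \<i>) f x"
  using x
proof (induction a arbitrary: x)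
  case (Suc a)
  have c: "cinf_on U (ipart (replicate a 1 @ replicate b \<i>) f)"
    by (rule cinf_on_ipart[OF f]) auto
  have "ipart (\<i> # replicate (Suc a) 1 @ replicate b \<i>) f x
     = pdir 1 (pdir \<i> (ipart (replicate a 1 @ replicate b \<i>) f)) x"
    using pdir_commute[OF c U Suc.prems] by simp
  also have "\<dots> = pdir 1 (ipart (replicate a 1 @ replicate (Suc b) \<i>) f) x"
    by (rule pdir_cong[OF U Suc.prems]) (use Suc.IH in simp)
  finally show ?case by simp
qed simp

lemma jet_cinf_jet:
  assumes f: "cinf_on U f" and U: "open U"
  shows "jet U (cinf_jet f)"
  unfolding jet_def
proof (intro allI ballI)
  fix a b x assume x: "x \<in> U"
  let ?g = "ipart (replicate a 1 @ replicate b \<i>) f"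
  have "cinf_on U ?g" by (rule cinf_on_ipart[OF f]) auto
  from has_derivative_of_real[OF cinf_on_has_derivative[OF this U x]]
  have "((\<lambda>x. of_real (?g x)) has_derivative
     (\<lambda>h. of_real (Re h * pdir 1 ?g x + Im h * pdir \<i> ?g x) :: complex)) (at x)" .
  moreover have "pdir \<i> ?g x = ipart (replicate a 1 @ replicate (Suc b) \<i>) f x"
    using ipart_commute[OF f U x, of a b] by simp
  ultimately show "(cinf_jet f a b has_derivative
      (\<lambda>h. of_real (Re h) * cinf_jet f (Suc a) b x + of_real (Im h) * cinf_jet f a (Suc b) x)) (at x)"
    by (simp add: cinf_jet_def[abs_def])
qed

lemma jet_sum: "(\<And>i. i \<in> A \<Longrightarrow> jet U (q i)) \<Longrightarrow> jet U (\<lambda>a b x. \<Sum>i\<in>A. q i a b x)"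
proof (induction A rule: infinite_finite_induct)
  case (insert i A)
  have "jet U (lin 1 (q i) 1 (\<lambda>a b x. \<Sum>i\<in>A. q i a b x))"
    by (intro jet_lin insert.IH insert.prems) auto
  moreover have "lin 1 (q i) 1 (\<lambda>a b x. \<Sum>i\<in>A. q i a b x) = (\<lambda>a b x. \<Sum>i\<in>insert i A. q i a b x)"
    using insert.hyps by (auto simp: lin_def fun_eq_iff)
  ultimately show ?case by simp
qed (use jet_jzero in \<open>simp_all add: jzero_def[abs_def]\<close>)

lemma jet_translate:
  assumes "jet U q" "\<And>z. z \<in> V \<Longrightarrow> z - w \<in> U"
  shows "jet V (\<lambda>a b z. q a b (z - w))"
  unfolding jet_def
proof (intro allI ballI)
  fix a b x assume "x \<in> V"
  then have "(q a b has_derivative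
     (\<lambda>h. of_real (Re h) * q (Suc a) b (x - w) + of_real (Im h) * q a (Suc b) (x - w))) (at (x - w))"
    using assms unfolding jet_def by blast
  moreover have "((\<lambda>z. z - w) has_derivative (\<lambda>h. h)) (at x)"
    by (auto intro!: derivative_eq_intros)
  ultimately show "((\<lambda>z. q a b (z - w)) has_derivative
     (\<lambda>h. of_real (Re h) * q (Suc a) b (x - w) + of_real (Im h) * q a (Suc b) (x - w))) (at x)"
    using has_derivative_compose by fastforce
qed

section \<open>From trigonometric polynomials on circles to polynomials in the plane\<close>

lemma trig_polynomial_harmonics:
  fixes c :: "nat \<Rightarrow> nat \<Rightarrow> real"
  shows "\<exists>b. \<forall>\<theta>. of_real (\<Sum>k\<le>N. \<Sum>l\<le>N - k. c k l * cos \<theta> ^ k * sin \<theta> ^ l)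
     = (\<Sum>j\<le>2 * N. b j * cis ((real j - real N) * \<theta>))"
proof -
  \<comment> \<open>With E = cis \<theta>, E cos \<theta> = (1 + E^2) / 2 and E sin \<theta> = \<i>
    (1 - E^2) / 2. The monomial pads each term to the common factor E^N, so degree 2 N
    suffices.\<close>
  define p where "p k l = smult (of_real (c k l)) (monom 1 (N - k - l) * [:1/2, 0, 1/2:] ^ k * [:\<i>/2, 0, -\<i>/2:] ^ l)" for k l
  define q where "q = (\<Sum>k\<le>N. \<Sum>l\<le>N - k. p k l)"
  have dp: "degree (p k l) \<le> 2 * N" if "k \<le> N" "l \<le> N - k" for k l
  proof -
    have a: "degree ([:1/2, 0, 1/2::complex:] ^ k) \<le> 2 * k" "degree ([:\<i>/2, 0, -\<i>/2:] ^ l) \<le> 2 * l"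
      using degree_power_le[of "[:1/2, 0, 1/2::complex:]" k] degree_power_le[of "[:\<i>/2, 0, -\<i>/2:]" l] by auto
    have "degree (p k l) \<le> degree (monom (1::complex) (N - k - l) * [:1/2, 0, 1/2:] ^ k * [:\<i>/2, 0, -\<i>/2:] ^ l)"
      unfolding p_def by (rule degree_smult_le)
    also have "\<dots> \<le> degree (monom (1::complex) (N - k - l) * [:1/2, 0, 1/2:] ^ k) + degree ([:\<i>/2, 0, -\<i>/2:] ^ l)"
      by (rule degree_mult_le)
    also have "degree (monom (1::complex) (N - k - l) * [:1/2, 0, 1/2:] ^ k) \<le> degree (monom (1::complex) (N - k - l)) + degree ([:1/2, 0, 1/2::complex:] ^ k)"
      by (rule degree_mult_le)
    also have "degree (monom (1::complex) (N - k - l)) = N - k - l" by (simp add: degree_monom_eq)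
    finally show ?thesis using a that by linarith
  qed
  have dq: "degree q \<le> 2 * N"
    unfolding q_def by (intro degree_sum_le finite_atMost dp) auto
  have ev: "poly (p k l) (cis \<theta>) = cis (real N * \<theta>) * of_real (c k l * cos \<theta> ^ k * sin \<theta> ^ l)"
    if "k \<le> N" "l \<le> N - k" for k l \<theta>
  proof -
    have e: "cis \<theta> * cnj (cis \<theta>) = 1" by (simp add: cis_cnj cis_mult)
    have c1: "cis \<theta> * of_real (cos \<theta>) = poly [:1/2, 0, 1/2:] (cis \<theta>)"
    proof -
      have "of_real (cos \<theta>) = (cis \<theta> + cnj (cis \<theta>)) / 2" by (simp add: complex_eq_iff)
      then have "cis \<theta> * of_real (cos \<theta>) = (cis \<theta> * cis \<theta> + cis \<theta> * cnj (cis \<theta>)) / 2"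
        by (simp add: algebra_simps add_divide_distrib)
      then show ?thesis unfolding e by (simp add: algebra_simps add_divide_distrib)
    qed
    have c2: "cis \<theta> * of_real (sin \<theta>) = poly [:\<i>/2, 0, -\<i>/2:] (cis \<theta>)"
    proof -
      have "of_real (sin \<theta>) = \<i> * (cnj (cis \<theta>) - cis \<theta>) / 2" by (simp add: complex_eq_iff)
      then have "cis \<theta> * of_real (sin \<theta>) = \<i> * (cis \<theta> * cnj (cis \<theta>) - cis \<theta> * cis \<theta>) / 2"
        by (simp only: algebra_simps times_divide_eq_right)
      then show ?thesis unfolding e by (simp add: algebra_simps add_divide_distrib diff_divide_distrib)
    qed
    have "cis (real N * \<theta>) = cis \<theta> ^ (N - k - l) * cis \<theta> ^ k * cis \<theta> ^ l"
      using that by (simp add: Complex.DeMoivre[symmetric] power_add[symmetric])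
    then have "cis (real N * \<theta>) * of_real (c k l * cos \<theta> ^ k * sin \<theta> ^ l)
      = of_real (c k l) * (cis \<theta> ^ (N - k - l) * (cis \<theta> * of_real (cos \<theta>)) ^ k * (cis \<theta> * of_real (sin \<theta>)) ^ l)"
      by (simp add: power_mult_distrib)
    also have "\<dots> = poly (p k l) (cis \<theta>)" unfolding c1 c2 by (simp add: p_def poly_monom)
    finally show ?thesis by simp
  qed
  have "of_real (\<Sum>k\<le>N. \<Sum>l\<le>N - k. c k l * cos \<theta> ^ k * sin \<theta> ^ l)
     = (\<Sum>j\<le>2 * N. coeff q j * cis ((real j - real N) * \<theta>))" for \<theta>
  proof -
    have "cis (real N * \<theta>) * of_real (\<Sum>k\<le>N. \<Sum>l\<le>N - k. c k l * cos \<theta> ^ k * sin \<theta> ^ l) = poly q (cis \<theta>)"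
      unfolding q_def poly_sum of_real_sum sum_distrib_left by (intro sum.cong refl ev[symmetric]) auto
    also have "\<dots> = (\<Sum>j\<le>2 * N. coeff q j * cis \<theta> ^ j)" by (rule poly_sum_le[OF dq])
    finally have "cis (- (real N * \<theta>)) * (cis (real N * \<theta>) * of_real (\<Sum>k\<le>N. \<Sum>l\<le>N - k. c k l * cos \<theta> ^ k * sin \<theta> ^ l))
      = cis (- (real N * \<theta>)) * (\<Sum>j\<le>2 * N. coeff q j * cis \<theta> ^ j)" by simp
    moreover have "cis (- (real N * \<theta>)) * (cis (real N * \<theta>) * z) = z" for z
      by (simp add: mult.assoc[symmetric] cis_mult)
    moreover have "cis (- (real N * \<theta>)) * (coeff q j * cis \<theta> ^ j) = coeff q j * cis ((real j - real N) * \<theta>)" for j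
      by (simp add: Complex.DeMoivre cis_mult algebra_simps)
    ultimately show ?thesis by (simp add: sum_distrib_left)
  qed
  then show ?thesis by blast
qed


lemma infinite_cis_interval:
  assumes "a < b"
  shows "infinite (cis ` {a<..<b})"
proof -
  \<comment> \<open>Cutting at one full turn makes \<open>cis\<close> injective.\<close>
  define c where "c = min b (a + 2 * pi)"
  have "inj_on cis {a<..<c}"
  proof
    fix s t assume st: "s \<in> {a<..<c}" "t \<in> {a<..<c}" "cis s = cis t"
    then have "sin s = sin t \<and> cos s = cos t" by (simp add: complex_eq_iff)
    then obtain n :: int where n: "s = t + 2 * pi * of_int n" by (auto simp: sin_cos_eq_iff)
    have "\<bar>s - t\<bar> < 2 * pi" using st by (auto simp: c_def)
    then have "2 * pi * \<bar>of_int n\<bar> < 2 * pi * 1" using n by (simp add: abs_mult)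
    then have "\<bar>of_int n :: real\<bar> < 1" by (subst (asm) mult_less_cancel_left_pos) auto
    then have "n = 0" by linarith
    then show "s = t" using n by simp
  qed
  moreover have "infinite {a<..<c}" using assms pi_gt_zero by (simp add: c_def infinite_Ioo)
  ultimately have "infinite (cis ` {a<..<c})" using finite_imageD by blast
  moreover have "cis ` {a<..<c} \<subseteq> cis ` {a<..<b}" by (auto simp: c_def)
  ultimately show ?thesis using finite_subset by blast
qed

lemma norm_cis_diff_le: "norm (cis s - cis t) \<le> \<bar>s - t\<bar>"
proof -
  have "norm (cis s - cis t) \<le> 1 * norm (s - t)"
  proof (rule differentiable_bound[of UNIV cis "\<lambda>t h. h *\<^sub>R (\<i> * cis t)"])
    fix t :: real
    have "((\<lambda>z. exp (\<i> * z)) has_field_derivative exp (\<i> * of_real t) * \<i>) (at (of_real t))"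
      by (auto intro!: derivative_eq_intros)
    from has_vector_derivative_real_field[OF this]
    show "(cis has_derivative (\<lambda>h. h *\<^sub>R (\<i> * cis t))) (at t within UNIV)"
      by (simp add: cis_conv_exp[abs_def] has_vector_derivative_def mult.commute)
    show "onorm (\<lambda>h. h *\<^sub>R (\<i> * cis t)) \<le> 1"
      by (rule onorm_le) (simp add: norm_mult)
  qed auto
  then show ?thesis by simp
qed

text \<open>With the direction frozen at \<theta>0, the formula writes F as a sum of translated
  smooth coefficients, so F carries a jet. Letting x and \<theta> vary then supplies the harmonics
  to which \<open>top_harmonic_zero\<close> applies.\<close>

lemma local_polynomial:
  fixes F :: "complex \<Rightarrow> real" and a :: "nat \<Rightarrow> nat \<Rightarrow> complex \<Rightarrow> real"
  assumes r: "r > 0" and e: "e > 0"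
    and a: "\<And>k l. k \<le> N \<Longrightarrow> l \<le> N - k \<Longrightarrow> cinf_on (ball x0 e) (a k l)"
    and F: "\<And>x \<theta>. x \<in> ball x0 e \<Longrightarrow> \<bar>\<theta> - \<theta>0\<bar> < e \<Longrightarrow>
      F (x + \<i> * of_real r * cis \<theta>) = (\<Sum>k\<le>N. \<Sum>l\<le>N - k. a k l x * cos \<theta> ^ k * sin \<theta> ^ l)"
  shows "\<exists>R>0. \<exists>p. \<forall>z\<in>ball (x0 + \<i> * of_real r * cis \<theta>0) R. F z = ev p (Re z) (Im z)"
proof -
  define w where "w = \<i> * of_real r * cis \<theta>0"
  define P0 where "P0 = x0 + w"
  define q where "q A B z = (\<Sum>k\<le>N. \<Sum>l\<le>N - k. lin (of_real (cos \<theta>0 ^ k * sin \<theta>0 ^ l)) (\<lambda>A B z. cinf_jet (a k l) A B (z - w)) 0 jzero A B z)" for A B z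
  have tr: "z - w \<in> ball x0 e" if "z \<in> ball P0 e" for z
    using that by (simp add: P0_def dist_norm algebra_simps)
  have jq: "jet (ball P0 e) q"
    unfolding q_def[abs_def]
    by (intro jet_sum jet_lin jet_jzero jet_translate[OF jet_cinf_jet[OF a open_ball]] tr) auto
  have q0: "q 0 0 z = of_real (F z)" if "z \<in> ball P0 e" for z
  proof -
    have "F z = (\<Sum>k\<le>N. \<Sum>l\<le>N - k. a k l (z - w) * cos \<theta>0 ^ k * sin \<theta>0 ^ l)"
      using F[OF tr[OF that], of \<theta>0] e by (simp add: w_def)
    then show ?thesis by (simp add: q_def lin_apply jzero_def cinf_jet_def mult.commute mult.left_commute)
  qed
  have qreal: "cnj (q A B z) = q A B z" for A B z
    by (simp add: q_def lin_apply jzero_def cinf_jet_def)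
  define X where "X = ball x0 (e / 2)"
  \<comment> \<open>Angles in \<open>I\<close> displace the end point by less than e / 4. Circles
    centred in \<open>X\<close> thus stay where the jet lives, and each P within e / 4 of
    \<open>P0\<close> is reached from \<open>X\<close> at every angle of \<open>I\<close>.\<close>
  define \<eta> where "\<eta> = min e (e / (4 * r))"
  have \<eta>: "\<eta> > 0" "\<eta> \<le> e" "r * \<eta> \<le> e / 4"
  proof -
    show "\<eta> > 0" "\<eta> \<le> e" using e r by (auto simp: \<eta>_def)
    have "r * \<eta> \<le> r * (e / (4 * r))" using r by (intro mult_left_mono) (auto simp: \<eta>_def)
    then show "r * \<eta> \<le> e / 4" using r by simp
  qed
  define I where "I = {\<theta>0 - \<eta><..<\<theta>0 + \<eta>}"
  have I: "\<bar>\<theta> - \<theta>0\<bar> < \<eta>" if "\<theta> \<in> I" for \<theta> using that by (auto simp: I_def)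
  have wd: "norm (\<i> * of_real r * cis \<theta> - w) < e / 4" if "\<theta> \<in> I" for \<theta>
  proof -
    have "norm (\<i> * of_real r * cis \<theta> - w) = r * norm (cis \<theta> - cis \<theta>0)"
      using r unfolding w_def by (simp add: right_diff_distrib[symmetric] norm_mult)
    also have "\<dots> \<le> r * \<bar>\<theta> - \<theta>0\<bar>" using r norm_cis_diff_le by (intro mult_left_mono) auto
    also have "\<dots> < r * \<eta>" using I[OF that] r by simp
    finally show ?thesis using \<eta>(3) by linarith
  qed
  have XU: "\<forall>x\<in>X. \<forall>\<theta>\<in>I. x + \<i> * of_real r * cis \<theta> \<in> ball P0 e"
  proof (intro ballI)
    fix x \<theta> assume x: "x \<in> X" and \<theta>: "\<theta> \<in> I"
    have "x + \<i> * of_real r * cis \<theta> - P0 = (x - x0) + (\<i> * of_real r * cis \<theta> - w)" by (simp add: P0_def)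
    then have "norm (x + \<i> * of_real r * cis \<theta> - P0) \<le> norm (x - x0) + norm (\<i> * of_real r * cis \<theta> - w)"
      by (metis norm_triangle_ineq)
    moreover have "norm (x - x0) < e / 2" using x by (simp add: X_def dist_norm norm_minus_commute)
    ultimately have "norm (x + \<i> * of_real r * cis \<theta> - P0) < e" using wd[OF \<theta>] e by linarith
    then show "x + \<i> * of_real r * cis \<theta> \<in> ball P0 e" by (simp add: dist_norm norm_minus_commute)
  qed
  have "\<forall>x. \<exists>b. \<forall>\<theta>. of_real (\<Sum>k\<le>N. \<Sum>l\<le>N - k. a k l x * cos \<theta> ^ k * sin \<theta> ^ l)
     = (\<Sum>j\<le>2 * N. b j * cis ((real j - real N) * \<theta>))"
    by (intro allI trig_polynomial_harmonics)
  from choice[OF this] obtain b where b': "\<forall>x \<theta>. of_real (\<Sum>k\<le>N. \<Sum>l\<le>N - k. a k l x * cos \<theta> ^ k * sin \<theta> ^ l)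
     = (\<Sum>j\<le>2 * N. b x j * cis ((real j - real N) * \<theta>))"
    by (elim exE)
  note b = b'[rule_format]
  have trig: "\<forall>x\<in>X. \<forall>\<theta>\<in>I. q 0 0 (x + \<i> * of_real r * cis \<theta>)
      = (\<Sum>j\<le>2 * N. b x j * cis ((real j - real N) * \<theta>))"
  proof (intro ballI)
    fix x \<theta> assume x: "x \<in> X" and \<theta>: "\<theta> \<in> I"
    have xe: "x \<in> ball x0 e" using x e by (simp add: X_def)
    have "\<bar>\<theta> - \<theta>0\<bar> < e" using I[OF \<theta>] \<eta>(2) by linarith
    from F[OF xe this] show "q 0 0 (x + \<i> * of_real r * cis \<theta>)
      = (\<Sum>j\<le>2 * N. b x j * cis ((real j - real N) * \<theta>))"
      unfolding b[symmetric] by (subst q0) (use XU x \<theta> in auto)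
  qed
  have z: "(dz ^^ (2 * N + 1)) q 0 0 P = 0" if P: "P \<in> ball P0 (e / 4)" for P
  proof (rule top_harmonic_zero[OF jq _ XU trig])
    show "open I" by (simp add: I_def)
    show "r \<noteq> 0" using r by simp
    have "P - \<i> * of_real r * cis \<theta> \<in> X" if "\<theta> \<in> I" for \<theta>
    proof -
      have "P - \<i> * of_real r * cis \<theta> - x0 = (P - P0) - (\<i> * of_real r * cis \<theta> - w)" by (simp add: P0_def)
      then have "norm (P - \<i> * of_real r * cis \<theta> - x0) \<le> norm (P - P0) + norm (\<i> * of_real r * cis \<theta> - w)"
        by (metis norm_triangle_ineq4)
      moreover have "norm (P - P0) < e / 4" using P by (simp add: dist_norm norm_minus_commute)
      ultimately have "norm (P - \<i> * of_real r * cis \<theta> - x0) < e / 2" using wd[OF that] by linarith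
      then show ?thesis by (simp add: X_def dist_norm norm_minus_commute)
    qed
    then have "{\<theta> \<in> I. P - \<i> * of_real r * cis \<theta> \<in> X} = I" by auto
    then show "infinite (cis ` {\<theta> \<in> I. P - \<i> * of_real r * cis \<theta> \<in> X})"
      using infinite_cis_interval[of "\<theta>0 - \<eta>" "\<theta>0 + \<eta>"] \<eta> by (simp add: I_def)
  qed
  have sub: "ball P0 (e / 4) \<subseteq> ball P0 e" using e by (intro subset_ball) simp
  have "jet (ball P0 (e / 4)) q" using jq sub unfolding jet_def by blast
  then obtain p where p: "\<And>z. z \<in> ball P0 (e / 4) \<Longrightarrow> Re (q 0 0 z) = ev p (Re z) (Im z)"
    using jet_polynomial_on_ball[OF _ qreal z] by metis
  have "\<forall>z\<in>ball P0 (e / 4). F z = ev p (Re z) (Im z)"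
  proof
    fix z assume zb: "z \<in> ball P0 (e / 4)"
    then have "q 0 0 z = of_real (F z)" using sub by (intro q0) auto
    with p[OF zb] show "F z = ev p (Re z) (Im z)" by simp
  qed
  then show ?thesis using e unfolding P0_def w_def by (intro exI[of _ "e / 4"] conjI exI[of _ p]) auto
qed

lemma ev_eq_on_ball:
  assumes "R > 0" "\<And>z. z \<in> ball c R \<Longrightarrow> ev p (Re z) (Im z) = (ev q (Re z) (Im z) :: real)"
  shows "p = q"
proof -
  have "p - q = 0"
  proof (rule ev_zero_infinite)
    show "infinite (ball (Re c) (R / 2))" "infinite (ball (Im c) (R / 2))"
      using assms(1) by (simp_all add: ball_eq_greaterThanLessThan infinite_Ioo)
    fix x y assume "x \<in> ball (Re c) (R / 2)" "y \<in> ball (Im c) (R / 2)"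
    then have "Complex x y \<in> ball c R"
      by (intro Complex_rect_in_ball) (auto simp: dist_real_def abs_minus_commute)
    from assms(2)[OF this] show "ev (p - q) x y = 0" by simp
  qed
  then show ?thesis by simp
qed

text \<open>Polynomials agreeing on a ball are equal. So the balls on which F is given by p and
  those on which it is given by some other polynomial form two disjoint open sets that cover
  A.\<close>

lemma polynomial_on_connected:
  fixes F :: "complex \<Rightarrow> real"
  assumes A: "connected A" "A \<noteq> {}"
    and loc: "\<And>z. z \<in> A \<Longrightarrow> \<exists>R>0. \<exists>p. \<forall>y\<in>ball z R. F y = ev p (Re y) (Im y)"
  shows "\<exists>p. \<forall>z\<in>A. F z = ev p (Re z) (Im z)"
proof -
  obtain z0 where z0: "z0 \<in> A" using A by blast
  obtain R0 p where p: "R0 > 0" "\<forall>y\<in>ball z0 R0. F y = ev p (Re y) (Im y)" using loc[OF z0] by blast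
  define S where "S = \<Union>{ball z R | z R. R > 0 \<and> (\<forall>y\<in>ball z R. F y = ev p (Re y) (Im y))}"
  define T where "T = \<Union>{ball z R | z R p'. R > 0 \<and> p' \<noteq> p \<and> (\<forall>y\<in>ball z R. F y = ev p' (Re y) (Im y))}"
  have oS: "open S" and oT: "open T" unfolding S_def T_def by (auto intro!: open_Union)
  have "S \<inter> T = {}"
  proof (rule ccontr)
    assume "S \<inter> T \<noteq> {}"
    then obtain y z R z' R' p' where *: "y \<in> ball z R" "y \<in> ball z' R'" "p' \<noteq> p"
      "\<forall>y\<in>ball z R. F y = ev p (Re y) (Im y)" "\<forall>y\<in>ball z' R'. F y = ev p' (Re y) (Im y)"
      unfolding S_def T_def by blast
    have "open (ball z R \<inter> ball z' R')" by blast
    then obtain d where d: "d > 0" "ball y d \<subseteq> ball z R \<inter> ball z' R'"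
      using *(1,2) open_contains_ball by (metis IntI)
    have "p' = p"
    proof (rule ev_eq_on_ball[OF d(1)])
      fix x assume "x \<in> ball y d"
      then have "F x = ev p (Re x) (Im x)" "F x = ev p' (Re x) (Im x)" using *(4,5) d(2) by blast+
      then show "ev p' (Re x) (Im x) = ev p (Re x) (Im x)" by simp
    qed
    with *(3) show False by simp
  qed
  moreover have "A \<subseteq> S \<union> T"
  proof
    fix z assume "z \<in> A"
    then obtain R p' where R: "R > 0" "\<forall>y\<in>ball z R. F y = ev p' (Re y) (Im y)" using loc by blast
    show "z \<in> S \<union> T"
    proof (cases "p' = p")
      case True
      with R have "z \<in> S" unfolding S_def by (intro UnionI[of "ball z R"]) auto
      then show ?thesis ..
    next
      case False
      with R have "z \<in> T" unfolding T_def by (intro UnionI[of "ball z R"]) auto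
      then show ?thesis ..
    qed
  qed
  moreover have "z0 \<in> S" unfolding S_def using p by (intro UnionI[of "ball z0 R0"]) auto
  ultimately have "A \<subseteq> S" using connectedD[OF A(1) oS oT] z0 by blast
  then have "\<forall>z\<in>A. F z = ev p (Re z) (Im z)" unfolding S_def by blast
  then show ?thesis by (rule exI)
qed

section \<open>Plane curves and tubular neighbourhoods\<close>

lemma perp_unit_complex:
  fixes u v :: complex
  assumes "norm v = 1" "inner u v = 0"
  shows "u = inner u (\<i> * v) *\<^sub>R (\<i> * v)"
proof -
  have v: "(Re v)\<^sup>2 + (Im v)\<^sup>2 = 1" using assms(1) by (metis cmod_power2 one_power2)
  have o: "Re u * Re v + Im u * Im v = 0" using assms(2) by (simp add: inner_complex_def)
  define c where "c = Im u * Re v - Re u * Im v"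
  have "Re u = Re u * ((Re v)\<^sup>2 + (Im v)\<^sup>2) - Re v * (Re u * Re v + Im u * Im v)" by (simp add: v o)
  also have "\<dots> = - c * Im v" by (simp add: c_def algebra_simps power2_eq_square)
  finally have 1: "Re u = - c * Im v" .
  have "Im u = Im u * ((Re v)\<^sup>2 + (Im v)\<^sup>2) - Im v * (Re u * Re v + Im u * Im v)" by (simp add: v o)
  also have "\<dots> = c * Re v" by (simp add: c_def algebra_simps power2_eq_square)
  finally have 2: "Im u = c * Re v" .
  have "inner u (\<i> * v) = c" by (simp add: inner_complex_def c_def)
  then show ?thesis by (intro complex_eqI) (simp_all add: 1 2)
qed

locale plane_curve =
  fixes g :: "real \<Rightarrow> complex" and L :: real
  assumes curve: "simple_closed_arclength g L"
begin

lemma L0: "L > 0" using curve by (simp add: simple_closed_arclength_def)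

lemma per: "g (s + L) = g s" using curve by (simp add: simple_closed_arclength_def)

lemma inj: "inj_on g {0..<L}" using curve by (simp add: simple_closed_arclength_def)

lemma unit: "norm (vd g s) = 1" using curve by (simp add: simple_closed_arclength_def)

lemma unit_nrm: "norm (nrm g s) = 1" by (simp add: nrm_def norm_mult unit)

lemma D_vd: "((vd ^^ m) g has_vector_derivative (vd ^^ Suc m) g t) (at t)"
proof -
  have "(vd ^^ m) g differentiable (at t)"
    using curve by (simp add: simple_closed_arclength_def smooth_curve_def)
  then show ?thesis by (simp add: vd_def vector_derivative_works)
qed

lemma Dg: "(g has_vector_derivative vd g t) (at t)"
  using D_vd[of 0 t] by simp

lemma smooth1_Re_Im: "smooth1 (\<lambda>t. Re ((vd ^^ m) g t))" "smooth1 (\<lambda>t. Im ((vd ^^ m) g t))"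
proof -
  have D: "((\<lambda>t. Re ((vd ^^ m) g t)) has_field_derivative Re ((vd ^^ Suc m) g t)) (at t)"
    "((\<lambda>t. Im ((vd ^^ m) g t)) has_field_derivative Im ((vd ^^ Suc m) g t)) (at t)" for m t
    using D_vd[of m t] unfolding has_vector_derivative_complex_iff by (auto simp: comp_def)
  have "times_differentiable n (\<lambda>t. Re ((vd ^^ m) g t)) \<and> times_differentiable n (\<lambda>t. Im ((vd ^^ m) g t))" for n m
  proof (induction n arbitrary: m)
    case (Suc n)
    show ?case
      unfolding times_differentiable.simps
      by (intro conjI exI[of _ "\<lambda>t. Re ((vd ^^ Suc m) g t)"] exI[of _ "\<lambda>t. Im ((vd ^^ Suc m) g t)"] allI D)
        (use Suc.IH[of "Suc m"] in blast)+
  qed simp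
  then show "smooth1 (\<lambda>t. Re ((vd ^^ m) g t))" "smooth1 (\<lambda>t. Im ((vd ^^ m) g t))"
    by (auto simp: smooth1_def)
qed

lemma vd_vd: "vd (vd g) t = curv g t *\<^sub>R nrm g t"
proof -
  have D: "(vd g has_vector_derivative vd (vd g) t) (at t)" using D_vd[of 1 t] by simp
  have "((\<lambda>s. inner (vd g s) (vd g s)) has_derivative
      (\<lambda>h. inner (vd g t) (h *\<^sub>R vd (vd g) t) + inner (h *\<^sub>R vd (vd g) t) (vd g t))) (at t)"
    using D unfolding has_vector_derivative_def by (intro has_derivative_inner)
  moreover have "(\<lambda>s. inner (vd g s) (vd g s)) = (\<lambda>s. 1)"
    using unit by (simp add: norm_eq_1 fun_eq_iff)
  ultimately have "(\<lambda>h. inner (vd g t) (h *\<^sub>R vd (vd g) t) + inner (h *\<^sub>R vd (vd g) t) (vd g t)) = (\<lambda>h. 0)"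
    using has_derivative_unique[OF _ has_derivative_const] by fastforce
  from fun_cong[OF this, of 1] have "inner (vd (vd g) t) (vd g t) = 0"
    by (simp add: inner_commute)
  from perp_unit_complex[OF unit this] show ?thesis by (simp add: curv_def nrm_def)
qed

lemma Dtau: "(vd g has_vector_derivative curv g t *\<^sub>R nrm g t) (at t)"
  using D_vd[of 1 t] vd_vd by simp

lemma Dn: "(nrm g has_vector_derivative - curv g t *\<^sub>R vd g t) (at t)"
proof -
  have "((\<lambda>s. \<i> * vd g s) has_vector_derivative \<i> * (curv g t *\<^sub>R nrm g t)) (at t)"
    by (rule has_vector_derivative_mult_right[OF Dtau])
  then show ?thesis by (simp add: nrm_def[abs_def] mult.assoc[symmetric])
qed

lemma smooth1_curv: "smooth1 (curv g)"
proof -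
  have "smooth1 (\<lambda>t. Im ((vd ^^ 2) g t) * Re ((vd ^^ 1) g t) - Re ((vd ^^ 2) g t) * Im ((vd ^^ 1) g t))"
    by (intro smooth1_diff smooth1_mult smooth1_Re_Im)
  moreover have "curv g = (\<lambda>t. Im ((vd ^^ 2) g t) * Re ((vd ^^ 1) g t) - Re ((vd ^^ 2) g t) * Im ((vd ^^ 1) g t))"
    by (auto simp: curv_def nrm_def inner_complex_def fun_eq_iff numeral_2_eq_2)
  ultimately show ?thesis by simp
qed

lemma cont: "continuous_on S g" "continuous_on S (vd g)" "continuous_on S (nrm g)" "continuous_on S (curv g)"
  using Dg Dtau Dn smooth1_cont[OF smooth1_curv]
  by (meson continuous_at_imp_continuous_on has_vector_derivative_continuous)+

lemma vd_per: "vd g (s + L) = vd g s"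
proof -
  have "((\<lambda>s. s + L) has_vector_derivative 1) (at s)" by (auto intro!: derivative_eq_intros)
  from vector_diff_chain_at[OF this, of g "vd g (s + L)"] Dg[of "s + L"]
  have "(g has_vector_derivative vd g (s + L)) (at s)" by (simp add: comp_def per)
  with Dg[of s] show ?thesis by (simp add: vector_derivative_unique_at)
qed

lemma nrm_per: "nrm g (s + L) = nrm g s" by (simp add: nrm_def vd_per)

lemma curv_per: "curv g (s + L) = curv g s"
proof -
  have "((\<lambda>s. s + L) has_vector_derivative 1) (at s)" by (auto intro!: derivative_eq_intros)
  from vector_diff_chain_at[OF this, of "vd g" "vd (vd g) (s + L)"] D_vd[of 1 "s + L"]
  have "(vd g has_vector_derivative vd (vd g) (s + L)) (at s)" by (simp add: comp_def vd_per)
  then have "vd (vd g) (s + L) = vd (vd g) s"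
    using D_vd[of 1 s] by (simp add: vector_derivative_unique_at)
  then show ?thesis by (simp add: curv_def nrm_per)
qed

lemma small_period_multiple:
  assumes "\<bar>of_int n * L\<bar> < L"
  shows "n = (0::int)"
proof -
  have "\<bar>of_int n\<bar> * L < 1 * L" using assms L0 by (simp add: abs_mult)
  then have "\<bar>of_int n :: real\<bar> < 1" using L0 by (simp only: mult_less_cancel_right_pos)
  then show ?thesis by linarith
qed

lemma per_int:
  assumes "\<And>s. f (s + L) = f s"
  shows "f (s + of_int n * L) = f s"
proof -
  have N: "f (s + of_nat k * L) = f s" for k s
  proof (induction k)
    case (Suc k)
    have "f (s + of_nat (Suc k) * L) = f ((s + of_nat k * L) + L)" by (simp add: algebra_simps)
    with Suc assms show ?case by simp
  qed simp
  show ?thesis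
  proof (cases "n \<ge> 0")
    case True
    then show ?thesis using N[of s "nat n"] by simp
  next
    case False
    then show ?thesis using N[of "s + of_int n * L" "nat (- n)"] by simp
  qed
qed

lemma reduce: "\<exists>s'\<in>{0..<L}. \<exists>n::int. s = s' + of_int n * L"
proof -
  let ?n = "\<lfloor>s / L\<rfloor>"
  have "of_int ?n * L \<le> s"
    using of_int_floor_le[of "s / L"] L0 by (subst (asm) pos_le_divide_eq) auto
  moreover have "s / L < of_int ?n + 1" by linarith
  then have "s < (of_int ?n + 1) * L"
    using L0 by (subst (asm) pos_divide_less_eq) auto
  ultimately have "0 \<le> s - of_int ?n * L" "s - of_int ?n * L < L"
    by (simp_all add: algebra_simps)
  then show ?thesis by (intro bexI[of _ "s - of_int ?n * L"] exI[of _ ?n]) auto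
qed

lemma par_per: "par g t (s + of_int n * L) = par g t s"
  by (rule per_int) (simp add: par_def per nrm_per)

lemma range_per:
  assumes "\<And>s. f (s + L) = f s"
  shows "range f = f ` {0..L}"
proof
  show "range f \<subseteq> f ` {0..L}"
  proof clarify
    fix s obtain s' and n :: int where "s' \<in> {0..<L}" "s = s' + of_int n * L" using reduce by blast
    then show "f s \<in> f ` {0..L}" using per_int[of f, OF assms, of s' n] by auto
  qed
qed auto

definition img where "img = range g"

lemma img_eq: "img = g ` {0..L}" unfolding img_def by (rule range_per[of g, OF per])

lemma compact_img: "compact img" unfolding img_eq by (intro compact_continuous_image cont compact_Icc)

lemma img_ne: "img \<noteq> {}" by (auto simp: img_def)

lemma g_eq_iff: "g s = g s' \<longleftrightarrow> (\<exists>n::int. s = s' + of_int n * L)"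
proof
  assume eq: "g s = g s'"
  obtain u m where u: "u \<in> {0..<L}" "s = u + of_int m * L" using reduce by blast
  obtain u' m' where u': "u' \<in> {0..<L}" "s' = u' + of_int m' * L" using reduce by blast
  have "g u = g u'" using eq u u' per_int[of g, OF per] by simp
  then have "u = u'" using inj u u' by (auto dest: inj_onD)
  then have "s = s' + of_int (m - m') * L" using u u' by (simp add: algebra_simps)
  then show "\<exists>n::int. s = s' + of_int n * L" by blast
qed (use per_int[of g, OF per] in auto)

lemma critical_distance:
  assumes "inner (z - g s) (vd g s) = 0"
  shows "z = par g (inner (z - g s) (nrm g s)) s" "\<bar>inner (z - g s) (nrm g s)\<bar> = norm (z - g s)"
proof -
  have e: "z - g s = inner (z - g s) (nrm g s) *\<^sub>R nrm g s"
    using perp_unit_complex[OF unit assms] by (simp add: nrm_def)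
  then show "z = par g (inner (z - g s) (nrm g s)) s"
    by (simp add: par_def scaleR_conv_of_real algebra_simps)
  have "norm (z - g s) = norm (inner (z - g s) (nrm g s) *\<^sub>R nrm g s)" using e by simp
  then show "\<bar>inner (z - g s) (nrm g s)\<bar> = norm (z - g s)" by (simp add: unit_nrm)
qed

lemma D_dist_sq: "((\<lambda>s. (norm (z - g s))\<^sup>2) has_field_derivative - 2 * inner (z - g s) (vd g s)) (at s)"
proof -
  have "((\<lambda>s. inner (z - g s) (z - g s)) has_derivative
     (\<lambda>h. inner (z - g s) (- (h *\<^sub>R vd g s)) + inner (- (h *\<^sub>R vd g s)) (z - g s))) (at s)"
    using Dg[of s] unfolding has_vector_derivative_def by (auto intro!: derivative_eq_intros)
  moreover have "(\<lambda>h. inner (z - g s) (- (h *\<^sub>R vd g s)) + inner (- (h *\<^sub>R vd g s)) (z - g s))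
     = (*) (- 2 * inner (z - g s) (vd g s))"
    by (auto simp: inner_commute algebra_simps)
  ultimately show ?thesis by (simp add: has_field_derivative_def power2_norm_eq_inner)
qed

text \<open>A nearest point of the compact curve is critical for the distance, so the segment to it
  is normal. These coordinates exist for every point of the plane; only their uniqueness needs the
  tube.\<close>

lemma foot: "\<exists>s t. z = par g t s \<and> \<bar>t\<bar> = infdist z img"
proof -
  obtain q where q: "q \<in> img" "infdist z img = dist z q"
    using infdist_attains_inf[OF compact_imp_closed[OF compact_img] img_ne] by blast
  obtain s where s: "q = g s" using q(1) by (auto simp: img_def)
  have le: "(norm (z - g s))\<^sup>2 \<le> (norm (z - g t))\<^sup>2" for t
  proof -
    have "infdist z img \<le> dist z (g t)" by (rule infdist_le) (simp add: img_def)
    then show ?thesis using q s by (simp add: dist_norm)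
  qed
  have "- 2 * inner (z - g s) (vd g s) = 0"
    by (rule DERIV_local_min[OF D_dist_sq zero_less_one]) (simp add: le)
  then have "inner (z - g s) (vd g s) = 0" by simp
  from critical_distance[OF this] q(2) s show ?thesis by (metis dist_norm)
qed

lemma dist_par: "norm (par g t s - g s) = \<bar>t\<bar>"
  by (simp add: par_def norm_mult unit_nrm)

section \<open>Existence of an injective tube\<close>

lemma curv_bounded: "\<exists>K>0. \<forall>s. \<bar>curv g s\<bar> \<le> K"
proof -
  have "compact (curv g ` {0..L})" by (intro compact_continuous_image cont compact_Icc)
  then have "bounded (range (curv g))"
    unfolding range_per[of "curv g", OF curv_per] by (rule compact_imp_bounded)
  then obtain K where K: "\<forall>k\<in>range (curv g). norm k \<le> K" unfolding bounded_iff by blast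
  then have "\<bar>curv g s\<bar> \<le> max 1 K" for s by (auto simp: le_max_iff_disj)
  then show ?thesis by (intro exI[of _ "max 1 K"]) auto
qed

lemma frame_lipschitz:
  assumes K: "\<And>s. \<bar>curv g s\<bar> \<le> K"
  shows "norm (vd g s - vd g s') \<le> K * \<bar>s - s'\<bar>" "norm (nrm g s - nrm g s') \<le> K * \<bar>s - s'\<bar>"
proof -
  have "norm (vd g s - vd g s') \<le> K * norm (s - s')"
  proof (rule differentiable_bound[of UNIV "vd g" "\<lambda>t h. h *\<^sub>R (curv g t *\<^sub>R nrm g t)"])
    show "(vd g has_derivative (\<lambda>h. h *\<^sub>R (curv g t *\<^sub>R nrm g t))) (at t within UNIV)" for t
      using Dtau[of t] by (simp add: has_vector_derivative_def)
    show "onorm (\<lambda>h. h *\<^sub>R (curv g t *\<^sub>R nrm g t)) \<le> K" for t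
    proof (rule onorm_le)
      fix h
      have "norm (h *\<^sub>R (curv g t *\<^sub>R nrm g t)) = \<bar>h\<bar> * \<bar>curv g t\<bar>" by (simp add: unit_nrm abs_mult)
      also have "\<dots> \<le> \<bar>h\<bar> * K" using K[of t] by (intro mult_left_mono) auto
      finally show "norm (h *\<^sub>R (curv g t *\<^sub>R nrm g t)) \<le> K * norm h" by (simp add: mult.commute)
    qed
  qed auto
  then show 1: "norm (vd g s - vd g s') \<le> K * \<bar>s - s'\<bar>" by simp
  have "nrm g s - nrm g s' = \<i> * (vd g s - vd g s')" by (simp add: nrm_def algebra_simps)
  with 1 show "norm (nrm g s - nrm g s') \<le> K * \<bar>s - s'\<bar>" by (simp add: norm_mult)
qed

text \<open>While the tangent has changed by at most 1/2, its component along the initial tangent is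
  at least 1/2; the mean value theorem integrates this.\<close>

lemma tangential_growth:
  assumes K: "\<And>s. \<bar>curv g s\<bar> \<le> K" and d: "K * \<bar>s' - s\<bar> \<le> 1 / 2"
  shows "\<bar>inner (g s' - g s) (vd g s)\<bar> \<ge> \<bar>s' - s\<bar> / 2"
proof -
  define h where "h u = inner (g u - g s) (vd g s)" for u
  have D: "(h has_field_derivative inner (vd g u) (vd g s)) (at u)" for u
  proof -
    have "(h has_derivative (\<lambda>k. inner (k *\<^sub>R vd g u) (vd g s))) (at u)"
      unfolding h_def using Dg[of u] unfolding has_vector_derivative_def
      by (auto intro!: derivative_eq_intros)
    moreover have "(\<lambda>k. inner (k *\<^sub>R vd g u) (vd g s)) = (*) (inner (vd g u) (vd g s))" by auto
    ultimately show ?thesis by (simp add: has_field_derivative_def)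
  qed
  have K0: "K \<ge> 0" using K[of 0] by linarith
  have lo: "inner (vd g u) (vd g s) \<ge> 1 / 2" if "\<bar>u - s\<bar> \<le> \<bar>s' - s\<bar>" for u
  proof -
    have "\<bar>inner (vd g u - vd g s) (vd g s)\<bar> \<le> norm (vd g u - vd g s) * norm (vd g s)"
      by (rule Cauchy_Schwarz_ineq2)
    also have "\<dots> \<le> K * \<bar>u - s\<bar>" using frame_lipschitz(1)[OF K] by (simp add: unit)
    also have "\<dots> \<le> K * \<bar>s' - s\<bar>" using that K0 by (rule mult_left_mono)
    finally have "\<bar>inner (vd g u - vd g s) (vd g s)\<bar> \<le> 1 / 2" using d by linarith
    moreover have "inner (vd g s) (vd g s) = 1" using unit by (simp add: norm_eq_1)
    ultimately show ?thesis unfolding inner_diff_left by linarith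
  qed
  have hs: "h s = 0" by (simp add: h_def)
  consider "s' = s" | "s < s'" | "s' < s" by linarith
  then have "\<bar>h s'\<bar> \<ge> \<bar>s' - s\<bar> / 2"
  proof cases
    case 2
    obtain u where u: "s < u" "u < s'" "h s' - h s = (s' - s) * inner (vd g u) (vd g s)"
      using MVT2[OF 2 D] by blast
    have "(s' - s) * (1 / 2) \<le> h s' - h s"
      unfolding u(3) using 2 u by (intro mult_left_mono lo) auto
    then show ?thesis using 2 hs by linarith
  next
    case 3
    obtain u where u: "s' < u" "u < s" "h s - h s' = (s - s') * inner (vd g u) (vd g s)"
      using MVT2[OF 3 D] by blast
    have "(s - s') * (1 / 2) \<le> h s - h s'"
      unfolding u(3) using 3 u by (intro mult_left_mono lo) auto
    then show ?thesis using 3 hs abs_ge_minus_self[of "h s'"] abs_of_neg[of "s' - s"] by simp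
  qed simp
  then show ?thesis by (simp add: h_def)
qed

text \<open>On the compact set of parameter pairs at least \<delta> apart modulo the period, the
  distance of the curve points has a positive minimum. The last alternative is closeness across the
  seam at 0 and L.\<close>

lemma separated:
  assumes "\<delta> > 0"
  shows "\<exists>\<eta>>0. \<forall>s\<in>{0..L}. \<forall>s'\<in>{0..L}. norm (g s - g s') < \<eta> \<longrightarrow> \<bar>s - s'\<bar> < \<delta> \<or> L - \<delta> < \<bar>s - s'\<bar>"
proof -
  define C where "C = ({0..L} \<times> {0..L}) \<inter> {p. \<delta> \<le> \<bar>fst p - snd p\<bar>} \<inter> {p. \<bar>fst p - snd p\<bar> \<le> L - \<delta>}"
  have cC: "compact C" unfolding C_def
    by (intro compact_Int_closed compact_Times compact_Icc closed_Collect_le continuous_intros)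
  have pos: "norm (g (fst p) - g (snd p)) > 0" if "p \<in> C" for p
  proof -
    obtain s s' where p: "p = (s, s')" by (cases p)
    have "g s \<noteq> g s'"
    proof
      assume "g s = g s'"
      then obtain n :: int where n: "s = s' + of_int n * L" using g_eq_iff by blast
      have b: "\<bar>of_int n * L\<bar> < L" "\<bar>of_int n * L\<bar> > 0"
        using that assms n by (auto simp: C_def p)
      from small_period_multiple[OF b(1)] b(2) show False by simp
    qed
    then show ?thesis by (simp add: p)
  qed
  show ?thesis
  proof (cases "C = {}")
    case True
    then have "\<bar>s - s'\<bar> < \<delta> \<or> L - \<delta> < \<bar>s - s'\<bar>" if "s \<in> {0..L}" "s' \<in> {0..L}" for s s'
      using that unfolding C_def by (auto simp: set_eq_iff not_le)
    then show ?thesis by (intro exI[of _ 1]) auto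
  next
    case False
    have "continuous_on C (\<lambda>p. norm (g (fst p) - g (snd p)))"
      by (intro continuous_intros continuous_on_compose2[OF cont(1)[of UNIV]]) auto
    from continuous_attains_inf[OF cC False this]
    obtain p where p: "p \<in> C" "\<And>q. q \<in> C \<Longrightarrow> norm (g (fst p) - g (snd p)) \<le> norm (g (fst q) - g (snd q))"
      by blast
    show ?thesis
    proof (intro exI[of _ "norm (g (fst p) - g (snd p))"] conjI ballI impI pos[OF p(1)])
      fix s s' assume s: "s \<in> {0..L}" "s' \<in> {0..L}" "norm (g s - g s') < norm (g (fst p) - g (snd p))"
      then have "(s, s') \<notin> C" using p(2)[of "(s, s')"] by auto
      then show "\<bar>s - s'\<bar> < \<delta> \<or> L - \<delta> < \<bar>s - s'\<bar>" using s by (auto simp: C_def)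
    qed
  qed
qed

text \<open>\<open>r0\<close> is a supremum, which is informative only over a non-empty set. If two
  normals meet at short distance, their base points and hence their parameters are close. The
  tangential part of the chord is then at least half the parameter difference, but, arising only
  from the turning of the normal, at most a quarter of it.\<close>

lemma tube_ok_exists: "\<exists>\<rho>>0. tube_ok g L \<rho>"
proof -
  obtain K where K: "K > 0" "\<And>s. \<bar>curv g s\<bar> \<le> K" using curv_bounded by blast
  define \<delta> where "\<delta> = 1 / (2 * K)"
  have \<delta>: "\<delta> > 0" using K by (simp add: \<delta>_def)
  obtain \<eta> where \<eta>: "\<eta> > 0" "\<And>s s'. s \<in> {0..L} \<Longrightarrow> s' \<in> {0..L} \<Longrightarrow> norm (g s - g s') < \<eta> \<Longrightarrow> \<bar>s - s'\<bar> < \<delta> \<or> L - \<delta> < \<bar>s - s'\<bar>"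
    using separated[OF \<delta>] by blast
  define \<rho> where "\<rho> = min (1 / (4 * K)) (\<eta> / 2)"
  have \<rho>: "\<rho> > 0" "K * \<rho> \<le> 1 / 4" "2 * \<rho> \<le> \<eta>"
  proof -
    show "\<rho> > 0" using K \<eta> by (simp add: \<rho>_def)
    have "K * \<rho> \<le> K * (1 / (4 * K))" using K by (intro mult_left_mono) (auto simp: \<rho>_def)
    then show "K * \<rho> \<le> 1 / 4" using K by simp
    show "2 * \<rho> \<le> \<eta>" by (simp add: \<rho>_def)
  qed
  have jac: "1 - t * curv g s \<noteq> 0" if "\<bar>t\<bar> < \<rho>" for s t
  proof -
    have "\<bar>t * curv g s\<bar> \<le> \<rho> * K" using that K(2)[of s] unfolding abs_mult by (intro mult_mono) auto
    then show ?thesis using \<rho>(2) by (auto simp: mult.commute)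
  qed
  have key: "s = s' \<and> t = t'"
    if s: "s \<in> {0..<L}" "s' \<in> {0..<L}" and t: "\<bar>t\<bar> < \<rho>" "\<bar>t'\<bar> < \<rho>" and eq: "par g t s = par g t' s'" for s s' t t'
  proof -
    have "g s - g s' = of_real t' * nrm g s' - of_real t * nrm g s" using eq by (simp add: par_def algebra_simps)
    then have "norm (g s - g s') \<le> \<bar>t'\<bar> + \<bar>t\<bar>"
      using norm_triangle_ineq4[of "of_real t' * nrm g s'" "of_real t * nrm g s"]
      by (simp add: norm_mult unit_nrm)
    then have "norm (g s - g s') < \<eta>" using t \<rho>(3) by linarith
    then have "\<bar>s - s'\<bar> < \<delta> \<or> L - \<delta> < \<bar>s - s'\<bar>" using \<eta>(2)[of s s'] s by auto
    then have "\<exists>n::int. \<bar>s' + of_int n * L - s\<bar> < \<delta>"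
    proof
      assume "\<bar>s - s'\<bar> < \<delta>" then show ?thesis by (intro exI[of _ 0]) auto
    next
      assume a: "L - \<delta> < \<bar>s - s'\<bar>"
      show ?thesis
      proof (cases "s \<ge> s'")
        case True with a s show ?thesis by (intro exI[of _ 1]) auto
      next
        case False with a s show ?thesis by (intro exI[of _ "-1"]) auto
      qed
    qed
    then obtain n :: int where n: "\<bar>s' + of_int n * L - s\<bar> < \<delta>" by blast
    \<comment> \<open>The representative of s' modulo the period that lies within \<delta> of
      s.\<close>
    define u where "u = s' + of_int n * L"
    have equ: "par g t s = par g t' u" using eq par_per by (simp add: u_def)
    have gd: "g u - g s = t *\<^sub>R nrm g s - t' *\<^sub>R nrm g u"
      using equ by (simp add: par_def scaleR_conv_of_real algebra_simps)
    have ns: "inner (nrm g s) (vd g s) = 0" by (simp add: nrm_def inner_complex_def)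
    have "inner (g u - g s) (vd g s) = - t' * inner (nrm g u - nrm g s) (vd g s)"
      unfolding gd by (simp add: inner_diff_left ns)
    then have "\<bar>inner (g u - g s) (vd g s)\<bar> \<le> \<bar>t'\<bar> * (norm (nrm g u - nrm g s) * norm (vd g s))"
      using Cauchy_Schwarz_ineq2[of "nrm g u - nrm g s" "vd g s"] by (simp add: abs_mult mult_left_mono)
    also have "\<dots> \<le> \<bar>t'\<bar> * (K * \<bar>u - s\<bar>)"
      using frame_lipschitz(2)[OF K(2)] by (simp add: unit mult_left_mono)
    also have "\<dots> \<le> \<rho> * (K * \<bar>u - s\<bar>)" using t K(1) by (intro mult_right_mono) auto
    also have "\<dots> = (K * \<rho>) * \<bar>u - s\<bar>" by simp
    also have "\<dots> \<le> 1 / 4 * \<bar>u - s\<bar>" using \<rho>(2) by (intro mult_right_mono) auto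
    finally have up: "\<bar>inner (g u - g s) (vd g s)\<bar> \<le> 1 / 4 * \<bar>u - s\<bar>" .
    have "K * \<bar>u - s\<bar> \<le> K * \<delta>" using n K(1) by (simp add: u_def)
    then have "\<bar>inner (g u - g s) (vd g s)\<bar> \<ge> \<bar>u - s\<bar> / 2"
      using K(1) by (intro tangential_growth[OF K(2)]) (simp add: \<delta>_def)
    with up have us: "u = s" by auto
    then have "g s = g s'" using g_eq_iff u_def by metis
    then have ss: "s = s'" using inj s by (auto dest: inj_onD)
    have "t *\<^sub>R nrm g s = t' *\<^sub>R nrm g s" using gd us by simp
    moreover have "nrm g s \<noteq> 0" using unit_nrm[of s] by auto
    ultimately show ?thesis using ss by simp
  qed
  have "inj_on (\<lambda>(s, t). par g t s) ({0..<L} \<times> {- \<rho><..<\<rho>})"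
  proof (rule inj_onI, clarify)
    fix s t s' t'
    assume "s \<in> {0..<L}" "t \<in> {- \<rho><..<\<rho>}" "s' \<in> {0..<L}" "t' \<in> {- \<rho><..<\<rho>}" "par g t s = par g t' s'"
    then show "s = s' \<and> t = t'" by (intro key) auto
  qed
  then show ?thesis using \<rho>(1) jac unfolding tube_ok_def by (intro exI[of _ \<rho>]) simp
qed

lemma tube_radius:
  assumes "r < r0 g L / 2"
  shows "\<exists>\<rho>. 2 * r < \<rho> \<and> \<rho> > 0 \<and> tube_ok g L \<rho>"
proof -
  let ?S = "{\<rho>. \<rho> > 0 \<and> tube_ok g L \<rho>}"
  have "?S \<noteq> {}" using tube_ok_exists by blast
  moreover have "2 * r < Sup ?S" using assms by (simp add: r0_def)
  ultimately obtain \<rho> where "\<rho> \<in> ?S" "2 * r < \<rho>" using less_cSupE by metis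
  then show ?thesis by (intro exI[of _ \<rho>]) simp
qed

end

section \<open>Orientation and Larmor circles\<close>

text \<open>\<open>p\<close> is a chord and \<open>q\<close> a tangent, both divided by the tangent
  at the base point. For a straight line p = x and q = 1, and the real part is exactly 1 / (x^2 +
  e^2); the tolerances leave a quarter of it.\<close>

lemma kernel_near:
  fixes p q :: complex and x e :: real
  assumes q: "norm (q - 1) \<le> 1 / 4" and p: "norm (p - of_real x) \<le> \<bar>x\<bar> / 10" and e: "e > 0"
  shows "Re (q / (p\<^sup>2 + of_real (e\<^sup>2))) \<ge> 1 / (4 * (x\<^sup>2 + e\<^sup>2))"
proof -
  define A where "A = x\<^sup>2 + e\<^sup>2"
  define D where "D = p\<^sup>2 + of_real (e\<^sup>2)"
  have A: "A > 0" using e by (simp add: A_def add_nonneg_pos)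
  have "p\<^sup>2 - of_real (x\<^sup>2) = (p - of_real x) * ((p - of_real x) + 2 * of_real x)"
    by (simp add: algebra_simps power2_eq_square)
  then have "norm (p\<^sup>2 - of_real (x\<^sup>2)) = norm (p - of_real x) * norm ((p - of_real x) + 2 * of_real x)"
    by (simp only: norm_mult)
  also have "\<dots> \<le> (\<bar>x\<bar> / 10) * (\<bar>x\<bar> / 10 + 2 * \<bar>x\<bar>)"
  proof (intro mult_mono p)
    have "norm ((p - of_real x) + 2 * of_real x) \<le> norm (p - of_real x) + norm (2 * of_real x :: complex)"
      by (rule norm_triangle_ineq)
    then show "norm ((p - of_real x) + 2 * of_real x) \<le> \<bar>x\<bar> / 10 + 2 * \<bar>x\<bar>"
      using p by (simp add: norm_mult)
  qed auto
  also have "\<dots> = 21 / 100 * (\<bar>x\<bar> * \<bar>x\<bar>)" by (simp add: algebra_simps)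
  also have "\<dots> = 21 / 100 * x\<^sup>2" by (simp add: power2_eq_square)
  also have "\<dots> \<le> A / 4" unfolding A_def using zero_le_power2[of x] zero_le_power2[of e] by argo
  finally have "norm (p\<^sup>2 - of_real (x\<^sup>2)) \<le> A / 4" .
  moreover have "D - of_real A = p\<^sup>2 - of_real (x\<^sup>2)" by (simp add: D_def A_def)
  ultimately have DA: "norm (D - of_real A) \<le> A / 4" by simp
  have nD: "norm D \<le> 5 / 4 * A"
    using norm_triangle_ineq[of "D - of_real A" "of_real A"] DA A by simp
  have D0: "D \<noteq> 0" using DA A by auto
  have "norm (q * cnj D - of_real A) \<le> norm ((q - 1) * cnj D) + norm (cnj D - of_real A)"
    using norm_triangle_ineq[of "(q - 1) * cnj D" "cnj D - of_real A"] by (simp add: algebra_simps)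
  also have "norm (cnj D - of_real A) = norm (D - of_real A)"
    using complex_mod_cnj[of "D - of_real A"] by simp
  also have "norm ((q - 1) * cnj D) \<le> 1 / 4 * (5 / 4 * A)"
    unfolding norm_mult complex_mod_cnj by (intro mult_mono q nD) auto
  finally have "norm (q * cnj D - of_real A) \<le> 9 / 16 * A" using DA by linarith
  then have "\<bar>Re (q * cnj D - of_real A)\<bar> \<le> 9 / 16 * A" using abs_Re_le_cmod order_trans by blast
  from abs_le_D2[OF this] have "A - Re (q * cnj D) \<le> 9 / 16 * A"
    by (simp only: minus_complex.sel Re_complex_of_real minus_diff_eq)
  then have R: "Re (q * cnj D) \<ge> 7 / 16 * A" by argo
  have "Re (q / D) = Re (q * cnj D) / (norm D)\<^sup>2" by (simp add: complex_div_cnj[of q D])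
  also have "\<dots> \<ge> (7 / 16 * A) / (5 / 4 * A)\<^sup>2"
    using R A nD D0 by (intro frac_le power_mono) auto
  also (xtrans) have "(7 / 16 * A) / (5 / 4 * A)\<^sup>2 = 7 / 25 / A"
    using A by (simp add: power2_eq_square field_simps)
  also (xtrans) have "7 / 25 / A \<ge> 1 / (4 * A)" using A by (simp add: field_simps)
  finally (xtrans) show ?thesis by (simp add: D_def A_def)
qed

text \<open>Two Cauchy kernels with poles at distance e on either side of the curve combine to a
  kernel of Poisson type, which concentrates at the base point.\<close>

lemma kernel_split:
  fixes \<Delta> \<sigma> T :: complex and e :: real
  assumes s: "norm \<sigma> = 1" and z: "\<Delta> - of_real e * (\<i> * \<sigma>) \<noteq> 0" "\<Delta> + of_real e * (\<i> * \<sigma>) \<noteq> 0"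
  shows "Im (T / (\<Delta> - of_real e * (\<i> * \<sigma>)) - T / (\<Delta> + of_real e * (\<i> * \<sigma>)))
     = 2 * e * Re ((T / \<sigma>) / ((\<Delta> / \<sigma>)\<^sup>2 + of_real (e\<^sup>2)))"
proof -
  have s0: "\<sigma> \<noteq> 0" using s by auto
  have m: "(\<Delta> - of_real e * (\<i> * \<sigma>)) * (\<Delta> + of_real e * (\<i> * \<sigma>)) = \<sigma>\<^sup>2 * ((\<Delta> / \<sigma>)\<^sup>2 + of_real (e\<^sup>2))"
    using s0 by (simp add: field_simps power2_eq_square)
  have "T / (\<Delta> - of_real e * (\<i> * \<sigma>)) - T / (\<Delta> + of_real e * (\<i> * \<sigma>))
     = 2 * of_real e * \<i> * \<sigma> * T / ((\<Delta> - of_real e * (\<i> * \<sigma>)) * (\<Delta> + of_real e * (\<i> * \<sigma>)))"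
    using z by (simp add: diff_frac_eq algebra_simps)
  also have "\<dots> = \<i> * of_real (2 * e) * ((T / \<sigma>) / ((\<Delta> / \<sigma>)\<^sup>2 + of_real (e\<^sup>2)))"
    unfolding m using s0 by (simp add: power2_eq_square)
  finally have "T / (\<Delta> - of_real e * (\<i> * \<sigma>)) - T / (\<Delta> + of_real e * (\<i> * \<sigma>))
     = \<i> * of_real (2 * e) * ((T / \<sigma>) / ((\<Delta> / \<sigma>)\<^sup>2 + of_real (e\<^sup>2)))" .
  moreover have "Im (\<i> * of_real (2 * e) * X) = 2 * e * Re X" for X by simp
  ultimately show ?thesis by (simp only:)
qed

text \<open>Away from the base point the two poles nearly cancel, leaving a contribution of order
  e.\<close>

lemma kernel_far:
  fixes \<Delta> \<sigma> T :: complex and e m :: real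
  assumes s: "norm \<sigma> = 1" "norm T = 1" and m: "m > 0" "m \<le> norm \<Delta>" and e: "0 < e" "e \<le> m / 2"
  shows "\<bar>2 * e * Re ((T / \<sigma>) / ((\<Delta> / \<sigma>)\<^sup>2 + of_real (e\<^sup>2)))\<bar> \<le> 4 * e / m\<^sup>2"
proof -
  have "m\<^sup>2 \<le> (norm \<Delta>)\<^sup>2" using m by (intro power_mono) auto
  moreover have "e\<^sup>2 \<le> (m / 2)\<^sup>2" using e by (intro power_mono) auto
  then have "4 * e\<^sup>2 \<le> m\<^sup>2" by (simp add: power_divide)
  moreover have "norm ((\<Delta> / \<sigma>)\<^sup>2 + of_real (e\<^sup>2)) \<ge> (norm \<Delta>)\<^sup>2 - e\<^sup>2"
    using norm_diff_ineq[of "(\<Delta> / \<sigma>)\<^sup>2" "of_real (e\<^sup>2)"] s by (simp add: norm_divide norm_power)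
  ultimately have lo: "norm ((\<Delta> / \<sigma>)\<^sup>2 + of_real (e\<^sup>2)) \<ge> m\<^sup>2 / 2"
    using zero_le_power2[of m] by argo
  have "\<bar>Re ((T / \<sigma>) / ((\<Delta> / \<sigma>)\<^sup>2 + of_real (e\<^sup>2)))\<bar> \<le> norm ((T / \<sigma>) / ((\<Delta> / \<sigma>)\<^sup>2 + of_real (e\<^sup>2)))"
    by (rule abs_Re_le_cmod)
  also have "\<dots> = 1 / norm ((\<Delta> / \<sigma>)\<^sup>2 + of_real (e\<^sup>2))" by (simp only: norm_divide s)
  also have "\<dots> \<le> 1 / (m\<^sup>2 / 2)" using lo m by (intro divide_left_mono mult_pos_pos) auto
  finally have "\<bar>Re ((T / \<sigma>) / ((\<Delta> / \<sigma>)\<^sup>2 + of_real (e\<^sup>2)))\<bar> \<le> 2 / m\<^sup>2" by simp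
  then have "(2 * e) * \<bar>Re ((T / \<sigma>) / ((\<Delta> / \<sigma>)\<^sup>2 + of_real (e\<^sup>2)))\<bar> \<le> (2 * e) * (2 / m\<^sup>2)"
    using e by (intro mult_left_mono) auto
  then show ?thesis using e by (simp add: abs_mult)
qed

lemma connected_inside:
  fixes S C :: "complex set"
  assumes "connected S" "closed C" "S \<inter> C = {}" "z \<in> S" "z \<in> inside C"
  shows "S \<subseteq> inside C"
proof -
  have "inside C \<inter> S = {} \<or> outside C \<inter> S = {}"
    using connectedD[OF assms(1) open_inside[OF assms(2)] open_outside[OF assms(2)]]
      inside_Int_outside[of C] inside_Un_outside[of C] assms(3) by blast
  then show ?thesis using assms inside_Un_outside[of C] by blast
qed

section \<open>The two sides of the curve\<close>

locale tube_curve = plane_curve +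
  fixes \<rho> :: real
  assumes rho: "\<rho> > 0" and tube: "tube_ok g L \<rho>" and orient: "ccw g L"
begin

lemma tube_inj:
  assumes "\<bar>t\<bar> < \<rho>" "\<bar>t'\<bar> < \<rho>" "par g t s = par g t' s'"
  shows "t = t'" "g s = g s'"
proof -
  obtain u n where u: "u \<in> {0..<L}" "s = u + of_int n * L" using reduce by blast
  obtain u' n' where u': "u' \<in> {0..<L}" "s' = u' + of_int n' * L" using reduce by blast
  have e: "par g t u = par g t' u'" using assms(3) u u' par_per by simp
  have I: "inj_on (\<lambda>(s, t). par g t s) ({0..<L} \<times> {- \<rho><..<\<rho>})" using tube by (simp add: tube_ok_def)
  have "(u, t) \<in> {0..<L} \<times> {- \<rho><..<\<rho>}" "(u', t') \<in> {0..<L} \<times> {- \<rho><..<\<rho>}"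
    using u u' assms by auto
  from inj_onD[OF I _ this] e have "u = u'" "t = t'" by simp_all
  then show "t = t'" "g s = g s'" using u u' per_int[of g, OF per] by simp_all
qed

text \<open>A nearest point provides tube coordinates with |t'| at most |t|, and injectivity
  identifies them with the given ones.\<close>

lemma infdist_par: "\<bar>t\<bar> < \<rho> \<Longrightarrow> infdist (par g t s) img = \<bar>t\<bar>"
proof -
  assume t: "\<bar>t\<bar> < \<rho>"
  obtain s' t' where f: "par g t s = par g t' s'" "\<bar>t'\<bar> = infdist (par g t s) img" using foot by blast
  have "infdist (par g t s) img \<le> dist (par g t s) (g s)" by (rule infdist_le) (simp add: img_def)
  then have "\<bar>t'\<bar> \<le> \<bar>t\<bar>" using f(2) dist_par[of t s] by (simp add: dist_norm)
  then have "t = t'" using tube_inj[OF t _ f(1)] t by simp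
  then show ?thesis using f by simp
qed

definition dom where "dom = inside img"

lemma dom_of_eq: "dom_of g L = dom" by (simp add: dom_of_def dom_def img_eq)

lemma closed_img: "closed img" using compact_img by (rule compact_imp_closed)

lemma open_dom: "open dom" unfolding dom_def by (rule open_inside[OF closed_img])

lemma dom_img: "dom \<inter> img = {}" unfolding dom_def by (rule inside_no_overlap)

lemma closure_dom: "closure dom \<subseteq> dom \<union> img"
  unfolding dom_def using closure_inside_subset[OF closed_img] by (simp add: Un_commute)

lemma path_image_loop: "path_image (loop g L) = img"
proof -
  have "(\<lambda>t. L * t) ` {0..1} = {0..L}" using L0 by (simp add: image_mult_atLeastAtMost)
  then show ?thesis unfolding path_image_def loop_def[abs_def] img_eq by (metis image_image)
qed

lemma Dloop: "(loop g L has_vector_derivative L *\<^sub>R vd g (L * x)) (at x)"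
proof -
  have "((\<lambda>x. L * x) has_vector_derivative L) (at x)" by (auto intro!: derivative_eq_intros)
  from vector_diff_chain_at[OF this Dg] show ?thesis by (simp add: comp_def loop_def[abs_def])
qed

lemma valid_loop: "valid_path (loop g L)"
proof -
  have "loop g L C1_differentiable_on {0..1}"
    unfolding C1_differentiable_on_def
    by (intro exI[of _ "\<lambda>x. L *\<^sub>R vd g (L * x)"] conjI ballI Dloop continuous_intros
        continuous_on_compose2[OF cont(2)[of UNIV]]) auto
  then show ?thesis unfolding valid_path_def by (rule C1_differentiable_imp_piecewise)
qed

lemma winding_cases:
  assumes "z \<notin> img"
  shows "winding_number (loop g L) z = (if z \<in> dom then 1 else 0)"
proof (cases "z \<in> dom")
  case True
  then show ?thesis using orient by (simp add: ccw_def dom_of_eq)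
next
  case False
  then have "z \<in> outside (path_image (loop g L))"
    using assms inside_Un_outside[of img] unfolding dom_def path_image_loop by blast
  moreover have "pathfinish (loop g L) = pathstart (loop g L)"
    using per[of 0] by (simp add: pathfinish_def pathstart_def loop_def)
  ultimately have "winding_number (loop g L) z = 0"
    using winding_number_zero_in_outside[OF valid_path_imp_path[OF valid_loop]] by blast
  then show ?thesis using False by simp
qed

lemma winding_integral:
  assumes "z \<notin> img"
  shows "((\<lambda>x. of_real L * vd g (L * x) / (g (L * x) - z)) has_integral
     2 * pi * \<i> * winding_number (loop g L) z) {0..1}"
proof -
  have z: "z \<notin> path_image (loop g L)" using assms by (simp add: path_image_loop)
  have "((\<lambda>w. 1 / (w - z)) has_contour_integral contour_integral (loop g L) (\<lambda>w. 1 / (w - z))) (loop g L)"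
    by (intro has_contour_integral_integral contour_integrable_inversediff valid_loop z)
  moreover have "contour_integral (loop g L) (\<lambda>w. 1 / (w - z)) = 2 * pi * \<i> * winding_number (loop g L) z"
    using winding_number_valid_path[OF valid_loop z] by simp
  ultimately have "((\<lambda>x. 1 / (loop g L x - z) * vector_derivative (loop g L) (at x within {0..1}))
     has_integral 2 * pi * \<i> * winding_number (loop g L) z) {0..1}"
    by (simp add: has_contour_integral_def)
  then show ?thesis
  proof (rule has_integral_eq[rotated])
    fix x :: real assume "x \<in> {0..1}"
    then have "vector_derivative (loop g L) (at x within {0..1}) = L *\<^sub>R vd g (L * x)"
      by (intro vector_derivative_at_within_ivl[OF Dloop]) auto
    then show "1 / (loop g L x - z) * vector_derivative (loop g L) (at x within {0..1})
       = of_real L * vd g (L * x) / (g (L * x) - z)"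
      by (simp add: loop_def scaleR_conv_of_real)
  qed
qed

text \<open>\<open>ccw\<close> says nothing local about the normal. The winding numbers at the
  points e to the left and to the right differ by the integral of the Poisson-type kernel over 2 pi,
  which is positive for small e. As only the values 0 and 1 occur, the left point is inside and the
  right one is not.\<close>

lemma orientation_at: "\<exists>e. 0 < e \<and> e < \<rho> \<and> par g e (L / 2) \<in> dom \<and> par g (- e) (L / 2) \<notin> dom"
proof -
  \<comment> \<open>The midpoint keeps the near arc away from the seam of the parameter
    interval.\<close>
  define s where "s = L / 2"
  define \<sigma> where "\<sigma> = vd g s"
  have \<sigma>: "norm \<sigma> = 1" by (simp add: \<sigma>_def unit)
  have "isCont (vd g) s" using cont(2)[of UNIV] by (simp add: continuous_on_eq_continuous_at)
  then obtain d1 where d1': "d1 > 0" "\<And>u. dist u s < d1 \<Longrightarrow> dist (vd g u) (vd g s) < 1 / 4"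
    unfolding continuous_at_eps_delta using zero_less_divide_1_iff zero_less_numeral by blast
  then have d1: "d1 > 0" "\<And>u. \<bar>u - s\<bar> < d1 \<Longrightarrow> norm (vd g u - \<sigma>) \<le> 1 / 4"
    by (auto simp: dist_norm \<sigma>_def intro: less_imp_le)
  have "(g has_derivative (\<lambda>h. h *\<^sub>R \<sigma>)) (at s)" using Dg[of s] by (simp add: has_vector_derivative_def \<sigma>_def)
  then obtain d2 where d2: "d2 > 0" "\<And>u. norm (u - s) < d2 \<Longrightarrow> norm (g u - g s - (u - s) *\<^sub>R \<sigma>) \<le> 1 / 10 * norm (u - s)"
    unfolding has_derivative_at_alt by (metis divide_pos_pos zero_less_numeral zero_less_one)
  define d where "d = min d1 d2"
  have d: "d > 0" using d1 d2 by (simp add: d_def)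
  define Far where "Far = {0..L} \<inter> {u. d \<le> \<bar>u - s\<bar>}"
  have cF: "compact Far" unfolding Far_def
    by (intro compact_Int_closed compact_Icc closed_Collect_le continuous_intros)
  have "\<exists>m>0. \<forall>u\<in>Far. m \<le> norm (g u - g s)"
  proof (cases "Far = {}")
    case True then show ?thesis by (intro exI[of _ 1]) auto
  next
    case False
    have "\<exists>u\<in>Far. \<forall>v\<in>Far. norm (g u - g s) \<le> norm (g v - g s)"
      by (intro continuous_attains_inf cF False continuous_intros cont)
    then obtain u where u: "u \<in> Far" "\<forall>v\<in>Far. norm (g u - g s) \<le> norm (g v - g s)" by blast
    have "g u \<noteq> g s"
    proof
      assume "g u = g s"
      then obtain n :: int where n: "u = s + of_int n * L" using g_eq_iff by blast
      have "\<bar>of_int n * L\<bar> < L" using u(1) n L0 by (auto simp: Far_def s_def)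
      then have "n = 0" by (rule small_period_multiple)
      then show False using u(1) n d by (simp add: Far_def)
    qed
    then show ?thesis using u(2) by (intro exI[of _ "norm (g u - g s)"]) auto
  qed
  then obtain m where m: "m > 0" "\<And>u. u \<in> Far \<Longrightarrow> m \<le> norm (g u - g s)" by blast
  \<comment> \<open>The entries serve in turn the tube, \<open>kernel_far\<close>, the near arc, the
    inclusion of \<open>I\<close> in the unit interval, and a far contribution of at most 1/8, below
    the near contribution 1/4.\<close>
  define e where "e = min (\<rho> / 2) (min (m / 2) (min (d / 2) (min (L / 2) (m\<^sup>2 / (32 * L)))))"
  have e: "e > 0" "e < \<rho>" "e \<le> m / 2" "e < d" "e \<le> L / 2" "4 * e * L / m\<^sup>2 \<le> 1 / 8"
  proof -
    show "e > 0" using rho m d L0 by (simp add: e_def)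
    show "e < \<rho>" "e \<le> m / 2" "e < d" "e \<le> L / 2" using rho d by (auto simp: e_def)
    have "e \<le> m\<^sup>2 / (32 * L)" by (simp add: e_def)
    then show "4 * e * L / m\<^sup>2 \<le> 1 / 8" using m L0 by (simp add: field_simps)
  qed
  have ni: "par g t s \<notin> img" if "\<bar>t\<bar> = e" for t
  proof
    assume "par g t s \<in> img"
    then have "infdist (par g t s) img = 0" by simp
    then show False using infdist_par[of t s] that e by simp
  qed
  define W where "W t = winding_number (loop g L) (par g t s)" for t
  define F where "F x = Im (of_real L * vd g (L * x) / (g (L * x) - par g e s) - of_real L * vd g (L * x) / (g (L * x) - par g (- e) s))" for x
  have iF: "(F has_integral Im (2 * pi * \<i> * W e - 2 * pi * \<i> * W (- e))) {0..1}"
    unfolding F_def W_def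
    by (intro has_integral_Im has_integral_diff winding_integral ni) (use e in auto)
  have Fk: "F x = L * (2 * e * Re ((vd g (L * x) / \<sigma>) / (((g (L * x) - g s) / \<sigma>)\<^sup>2 + of_real (e\<^sup>2))))" for x
  proof -
    have eq: "g (L * x) - par g e s = (g (L * x) - g s) - of_real e * (\<i> * \<sigma>)"
      "g (L * x) - par g (- e) s = (g (L * x) - g s) + of_real e * (\<i> * \<sigma>)"
      by (simp_all add: par_def nrm_def \<sigma>_def)
    have "g (L * x) \<noteq> par g e s" "g (L * x) \<noteq> par g (- e) s"
      using ni[of e] ni[of "- e"] e by (auto simp: img_def) (metis rangeI)+
    then have nz: "(g (L * x) - g s) - of_real e * (\<i> * \<sigma>) \<noteq> 0" "(g (L * x) - g s) + of_real e * (\<i> * \<sigma>) \<noteq> 0"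
      unfolding eq[symmetric] by simp_all
    have "F x = L * Im (vd g (L * x) / (g (L * x) - par g e s) - vd g (L * x) / (g (L * x) - par g (- e) s))"
      unfolding F_def by (simp add: right_diff_distrib flip: times_divide_eq_right)
    then show ?thesis unfolding eq kernel_split[OF \<sigma> nz] .
  qed
  have near: "F x \<ge> L * (2 * e * (1 / (4 * ((L * x - s)\<^sup>2 + e\<^sup>2))))" if "\<bar>L * x - s\<bar> < d" for x
    unfolding Fk
  proof (intro mult_left_mono kernel_near)
    have s0: "\<sigma> \<noteq> 0" using \<sigma> by auto
    have "vd g (L * x) / \<sigma> - 1 = (vd g (L * x) - \<sigma>) / \<sigma>" using s0 by (simp add: field_simps)
    then show "norm (vd g (L * x) / \<sigma> - 1) \<le> 1 / 4"
      using d1(2)[of "L * x"] that by (simp add: norm_divide \<sigma> d_def)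
    have "(g (L * x) - g s) / \<sigma> - of_real (L * x - s) = (g (L * x) - g s - (L * x - s) *\<^sub>R \<sigma>) / \<sigma>"
      using s0 by (simp add: field_simps scaleR_conv_of_real)
    then show "norm ((g (L * x) - g s) / \<sigma> - of_real (L * x - s)) \<le> \<bar>L * x - s\<bar> / 10"
      using d2(2)[of "L * x"] that by (simp add: norm_divide \<sigma> d_def)
  qed (use e L0 in auto)
  define K where "K = 4 * e * L / m\<^sup>2"
  have K0: "K \<ge> 0" using e L0 by (simp add: K_def)
  have lo: "F x \<ge> - K" if x: "x \<in> {0..1}" for x
  proof (cases "\<bar>L * x - s\<bar> < d")
    case True
    have "0 \<le> L * (2 * e * (1 / (4 * ((L * x - s)\<^sup>2 + e\<^sup>2))))"
      using L0 e by (intro mult_nonneg_nonneg) auto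
    then show ?thesis using near[OF True] K0 by linarith
  next
    case False
    have "L * x \<in> {0..L}" using x L0 by (auto simp: mult_left_le)
    then have "L * x \<in> Far" using False by (auto simp: Far_def)
    from kernel_far[OF \<sigma> unit[of "L * x"] m(1) m(2)[OF this] e(1,3)]
    have "- (4 * e / m\<^sup>2) \<le> 2 * e * Re ((vd g (L * x) / \<sigma>) / (((g (L * x) - g s) / \<sigma>)\<^sup>2 + of_real (e\<^sup>2)))"
      by linarith
    then have "L * - (4 * e / m\<^sup>2) \<le> F x" unfolding Fk using L0 by (intro mult_left_mono) auto
    then show ?thesis by (simp add: K_def mult.commute)
  qed
  \<comment> \<open>On this one-sided piece of length e / L the integrand is at least L / (4 e),
    which already contributes 1/4.\<close>
  define I where "I = {1 / 2 .. 1 / 2 + e / L}"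
  have I01: "I \<subseteq> {0..1}"
  proof -
    have "e / L \<le> 1 / 2" using e(5) L0 by (simp add: field_simps)
    then have "1 / 2 + e / L \<le> 1" by argo
    then show ?thesis using e L0 by (auto simp: I_def)
  qed
  have hi: "F x \<ge> L / (4 * e)" if x: "x \<in> I" for x
  proof -
    have b: "0 \<le> L * x - s" "L * x - s \<le> e" using x L0 by (auto simp: I_def s_def field_simps)
    have "(L * x - s)\<^sup>2 \<le> e\<^sup>2" using b by (intro power_mono) auto
    then have "4 * ((L * x - s)\<^sup>2 + e\<^sup>2) \<le> 8 * e\<^sup>2" by simp
    moreover have "0 < 4 * ((L * x - s)\<^sup>2 + e\<^sup>2)" using e by (simp add: add_nonneg_pos)
    ultimately have "1 / (8 * e\<^sup>2) \<le> 1 / (4 * ((L * x - s)\<^sup>2 + e\<^sup>2))" by (intro frac_le) auto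
    then have "L * (2 * e * (1 / (8 * e\<^sup>2))) \<le> L * (2 * e * (1 / (4 * ((L * x - s)\<^sup>2 + e\<^sup>2))))"
      using L0 e by (intro mult_left_mono) auto
    also have "\<dots> \<le> F x" by (rule near) (use b e in auto)
    finally show ?thesis using e by (simp add: power2_eq_square)
  qed
  have "((\<lambda>x. - K + (if x \<in> I then L / (4 * e) else 0)) has_integral (- K + 1 / 4)) {0..1}"
  proof -
    have "((\<lambda>x::real. - K) has_integral - K) {0..1}" using has_integral_const_real[of "- K" 0 1] by simp
    moreover have "((\<lambda>x. L / (4 * e)) has_integral 1 / 4) I"
      using has_integral_const_real[of "L / (4 * e)" "1 / 2" "1 / 2 + e / L"] e L0 by (simp add: I_def)
    then have "((\<lambda>x. if x \<in> I then L / (4 * e) else 0) has_integral 1 / 4) {0..1}"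
      by (subst has_integral_restrict[OF I01])
    ultimately show ?thesis by (rule has_integral_add)
  qed
  from has_integral_le[OF this iF]
  have "- K + 1 / 4 \<le> Im (2 * pi * \<i> * W e - 2 * pi * \<i> * W (- e))"
    using lo hi K0 by fastforce
  moreover have "K \<le> 1 / 8" using e(6) by (simp only: K_def)
  ultimately have "0 < Im (2 * pi * \<i> * W e - 2 * pi * \<i> * W (- e))" by argo
  then have "par g e s \<in> dom \<and> par g (- e) s \<notin> dom"
    using winding_cases[OF ni[of e]] winding_cases[OF ni[of "- e"]] e by (auto simp: W_def split: if_splits)
  then show ?thesis using e unfolding s_def by blast
qed

lemma dist_par_ge: "\<bar>t\<bar> < \<rho> \<Longrightarrow> \<bar>t\<bar> \<le> norm (par g t s - g u)"
proof -
  assume t: "\<bar>t\<bar> < \<rho>"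
  have "infdist (par g t s) img \<le> dist (par g t s) (g u)" by (rule infdist_le) (simp add: img_def)
  then show ?thesis using infdist_par[OF t] by (simp add: dist_norm)
qed

lemma par_notin_img:
  assumes "\<bar>t\<bar> < \<rho>" "t \<noteq> 0"
  shows "par g t s \<notin> img"
proof
  assume "par g t s \<in> img"
  then have "infdist (par g t s) img = 0" by simp
  then show False using infdist_par assms by simp
qed

lemma connected_par_strip: "connected ((\<lambda>(t, s). par g t s) ` ({a<..<b} \<times> UNIV))"
proof (intro connected_continuous_image)
  show "continuous_on ({a<..<b} \<times> UNIV) (\<lambda>(t, s). par g t s)"
    unfolding par_def case_prod_beta
    by (intro continuous_intros continuous_on_compose2[OF cont(1)[of UNIV]] continuous_on_compose2[OF cont(3)[of UNIV]]) auto
  show "connected ({a<..<b} \<times> (UNIV :: real set))"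
    by (intro connected_Times connected_Ioo connected_UNIV)
qed

text \<open>Each open half of the tube is connected and avoids the curve, so a single point,
  supplied by \<open>orientation_at\<close>, decides for all.\<close>

lemma left_tube: "0 < t \<Longrightarrow> t < \<rho> \<Longrightarrow> par g t s \<in> dom"
  and right_tube: "- \<rho> < t \<Longrightarrow> t \<le> 0 \<Longrightarrow> par g t s \<notin> dom"
proof -
  obtain e where e: "0 < e" "e < \<rho>" "par g e (L / 2) \<in> dom" "par g (- e) (L / 2) \<notin> dom"
    using orientation_at by blast
  let ?S = "\<lambda>a b. (\<lambda>(t, s). par g t s) ` ({a<..<b} \<times> UNIV)"
  have l: "?S 0 \<rho> \<subseteq> dom" unfolding dom_def
  proof (rule connected_inside[OF connected_par_strip closed_img])
    show "?S 0 \<rho> \<inter> img = {}" using par_notin_img by auto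
    show "par g e (L / 2) \<in> ?S 0 \<rho>" using e by (intro image_eqI[of _ _ "(e, L / 2)"]) auto
    show "par g e (L / 2) \<in> inside img" using e(3) by (simp add: dom_def)
  qed
  show "par g t s \<in> dom" if "0 < t" "t < \<rho>"
    by (rule subsetD[OF l], rule image_eqI[of _ _ "(t, s)"]) (use that in auto)
  show "par g t s \<notin> dom" if t: "- \<rho> < t" "t \<le> 0"
  proof (cases "t = 0")
    case True
    have "g s \<in> img" by (simp add: img_def)
    then show ?thesis using True dom_img by (auto simp: par_def)
  next
    case False
    show ?thesis
    proof
      assume d: "par g t s \<in> dom"
      have "?S (- \<rho>) 0 \<subseteq> dom" unfolding dom_def
      proof (rule connected_inside[OF connected_par_strip closed_img])
        show "?S (- \<rho>) 0 \<inter> img = {}" using par_notin_img by auto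
        show "par g t s \<in> ?S (- \<rho>) 0" using t False by (intro image_eqI[of _ _ "(t, s)"]) auto
        show "par g t s \<in> inside img" using d by (simp add: dom_def)
      qed
      moreover have "par g (- e) (L / 2) \<in> ?S (- \<rho>) 0"
        using e by (intro image_eqI[of _ _ "(- e, L / 2)"]) auto
      ultimately show False using e(4) by blast
    qed
  qed
qed

section \<open>How arcs enter, leave and cross the curve\<close>

lemma ball_disjoint_img:
  assumes "\<bar>t\<bar> < \<rho>"
  shows "ball (par g t s) \<bar>t\<bar> \<inter> img = {}"
proof -
  have "\<not> dist (par g t s) (g u) < \<bar>t\<bar>" for u using dist_par_ge[OF assms, of s u] by (simp add: dist_norm)
  then show ?thesis by (auto simp: img_def)
qed

lemma ball_left:
  assumes "0 < t" "t < \<rho>"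
  shows "ball (par g t s) t \<subseteq> dom"
  unfolding dom_def
proof (rule connected_inside[OF _ closed_img])
  show "ball (par g t s) t \<inter> img = {}" using ball_disjoint_img[of t s] assms by simp
  show "par g t s \<in> inside img" using left_tube[OF assms, of s] by (simp add: dom_def)
qed (use assms in auto)

lemma ball_right:
  assumes "0 < t" "t < \<rho>"
  shows "ball (par g (- t) s) t \<inter> dom = {}"
proof (rule ccontr)
  assume "\<not> ?thesis"
  then obtain z where z: "z \<in> ball (par g (- t) s) t" "z \<in> inside img" by (auto simp: dom_def)
  have "ball (par g (- t) s) t \<subseteq> inside img"
  proof (rule connected_inside[OF _ closed_img _ z])
    show "ball (par g (- t) s) t \<inter> img = {}" using ball_disjoint_img[of "- t" s] assms by simp
  qed simp
  moreover have "par g (- t) s \<in> ball (par g (- t) s) t" using assms by simp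
  ultimately have "par g (- t) s \<in> dom" unfolding dom_def by blast
  moreover have "par g (- t) s \<notin> dom" using assms by (intro right_tube) auto
  ultimately show False by simp
qed

text \<open>The ball touches the curve at \<open>g s\<close> from the side given by the sign of t,
  and a velocity towards that side at first decreases the squared distance to its centre. Touching
  balls on both sides replace a local graph of the curve.\<close>

lemma approach_ball:
  assumes c: "(c has_vector_derivative v) (at 0)" "c 0 = g s" and t: "t \<noteq> 0" "t * inner v (nrm g s) > 0"
  shows "\<exists>\<eta>>0. \<forall>\<tau>. 0 < \<tau> \<and> \<tau> < \<eta> \<longrightarrow> c \<tau> \<in> ball (par g t s) \<bar>t\<bar>"
proof -
  define h where "h \<tau> = inner (c \<tau> - par g t s) (c \<tau> - par g t s)" for \<tau>
  have c0: "c 0 - par g t s = - t *\<^sub>R nrm g s" using c(2) by (simp add: par_def scaleR_conv_of_real)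
  have "(h has_derivative (\<lambda>k. inner (c 0 - par g t s) (k *\<^sub>R v) + inner (k *\<^sub>R v) (c 0 - par g t s))) (at 0)"
    unfolding h_def using c(1) unfolding has_vector_derivative_def by (auto intro!: derivative_eq_intros)
  moreover have "(\<lambda>k. inner (c 0 - par g t s) (k *\<^sub>R v) + inner (k *\<^sub>R v) (c 0 - par g t s)) = (*) (- 2 * (t * inner v (nrm g s)))"
    unfolding c0 by (auto simp: inner_commute algebra_simps)
  ultimately have "DERIV h 0 :> - 2 * (t * inner v (nrm g s))" by (simp add: has_field_derivative_def)
  moreover have "- 2 * (t * inner v (nrm g s)) < 0" using t by simp
  ultimately obtain d where d: "d > 0" "\<And>k. 0 < k \<Longrightarrow> k < d \<Longrightarrow> h (0 + k) < h 0"
    using DERIV_neg_dec_right by blast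
  have h0: "h 0 = t\<^sup>2" unfolding h_def c0 by (simp add: power2_norm_eq_inner[symmetric] unit_nrm power_mult_distrib)
  have "c \<tau> \<in> ball (par g t s) \<bar>t\<bar>" if "0 < \<tau>" "\<tau> < d" for \<tau>
  proof -
    have "(norm (c \<tau> - par g t s))\<^sup>2 < \<bar>t\<bar>\<^sup>2"
      using d(2)[OF that] h0 by (simp add: h_def power2_norm_eq_inner)
    then have "norm (c \<tau> - par g t s) < \<bar>t\<bar>" by (rule power2_less_imp_less) simp
    then show ?thesis by (simp add: dist_norm norm_minus_commute)
  qed
  then show ?thesis using d(1) by blast
qed

lemma enter:
  assumes "(c has_vector_derivative v) (at 0)" "c 0 = g s" "inner v (nrm g s) > 0"
  shows "\<exists>\<eta>>0. \<forall>\<tau>. 0 < \<tau> \<and> \<tau> < \<eta> \<longrightarrow> c \<tau> \<in> dom"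
proof -
  obtain \<eta> where \<eta>: "\<eta> > 0" "\<And>\<tau>. 0 < \<tau> \<and> \<tau> < \<eta> \<Longrightarrow> c \<tau> \<in> ball (par g (\<rho> / 2) s) \<bar>\<rho> / 2\<bar>"
    using approach_ball[OF assms(1,2), of "\<rho> / 2"] rho assms(3) by auto
  have "ball (par g (\<rho> / 2) s) \<bar>\<rho> / 2\<bar> \<subseteq> dom" using ball_left[of "\<rho> / 2" s] rho by simp
  with \<eta> show ?thesis by blast
qed

lemma leave:
  assumes "(c has_vector_derivative v) (at 0)" "c 0 = g s" "inner v (nrm g s) < 0"
  shows "\<exists>\<eta>>0. \<forall>\<tau>. 0 < \<tau> \<and> \<tau> < \<eta> \<longrightarrow> c \<tau> \<notin> dom"
proof -
  have "- (\<rho> / 2) * inner v (nrm g s) > 0" using rho assms(3) by (simp add: mult_pos_neg)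
  then obtain \<eta> where \<eta>: "\<eta> > 0" "\<And>\<tau>. 0 < \<tau> \<and> \<tau> < \<eta> \<Longrightarrow> c \<tau> \<in> ball (par g (- (\<rho> / 2)) s) \<bar>- (\<rho> / 2)\<bar>"
    using approach_ball[OF assms(1,2), of "- (\<rho> / 2)"] rho by auto
  have "ball (par g (- (\<rho> / 2)) s) \<bar>- (\<rho> / 2)\<bar> \<inter> dom = {}" using ball_right[of "\<rho> / 2" s] rho by simp
  with \<eta> show ?thesis by blast
qed

lemma near_curve:
  assumes "infdist z img < \<rho>"
  shows "\<exists>s t. z = par g t s \<and> \<bar>t\<bar> = infdist z img \<and> (0 < t \<longleftrightarrow> z \<in> dom)"
proof -
  obtain s t where st: "z = par g t s" "\<bar>t\<bar> = infdist z img" using foot by blast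
  have "0 < t \<longleftrightarrow> z \<in> dom" using left_tube[of t s] right_tube[of t s] st assms by force
  then show ?thesis using st by blast
qed

text \<open>At a tangency P - g s would be normal of length r, within the tube, so P would be at
  distance exactly r from the curve.\<close>

lemma transversal:
  assumes "infdist P img < r" "r < \<rho>" "norm (P - g s) = r"
  shows "inner (P - g s) (vd g s) \<noteq> 0"
proof
  assume z: "inner (P - g s) (vd g s) = 0"
  let ?t = "inner (P - g s) (nrm g s)"
  have "infdist P img = \<bar>?t\<bar>"
    using critical_distance[OF z] infdist_par[of ?t s] assms by simp
  with critical_distance(2)[OF z] assms show False by simp
qed

text \<open>The sign condition says that the curve leaves the disc about P. Start the period at the
  point nearest to P, which is strictly inside the disc. Between a point on the circle and a later
  exit, the squared distance has an interior minimum below r^2; this critical point would give P a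
  second foot in the tube.\<close>

lemma crossing_unique:
  assumes P: "infdist P img < r" "r < \<rho>"
    and s1: "norm (P - g s1) = r" "inner (P - g s1) (vd g s1) < 0"
    and s2: "norm (P - g s2) = r" "inner (P - g s2) (vd g s2) < 0"
  shows "g s1 = g s2"
proof -
  obtain s t where st: "P = par g t s" "\<bar>t\<bar> = infdist P img" using foot by blast
  have rep: "\<exists>u. s < u \<and> u < s + L \<and> g u = g w \<and> vd g u = vd g w" if "norm (P - g w) = r" for w
  proof -
    obtain u n where u: "u \<in> {0..<L}" "w - s = u + of_int n * L" using reduce by blast
    have w: "w = (s + u) + of_int n * L" using u by simp
    have gw: "g w = g (s + u)" "vd g w = vd g (s + u)"
      unfolding w using per_int[of g, OF per] per_int[of "vd g", OF vd_per] by simp_all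
    have "u \<noteq> 0"
    proof
      assume "u = 0"
      then have "norm (P - g w) = \<bar>t\<bar>" using gw st(1) dist_par by simp
      with that st(2) P show False by simp
    qed
    then show ?thesis using u gw by (intro exI[of _ "s + u"]) auto
  qed
  obtain u1 where u1: "s < u1" "u1 < s + L" "g u1 = g s1" "vd g u1 = vd g s1" using rep[OF s1(1)] by blast
  obtain u2 where u2: "s < u2" "u2 < s + L" "g u2 = g s2" "vd g u2 = vd g s2" using rep[OF s2(1)] by blast
  define h where "h u = (norm (P - g u))\<^sup>2" for u
  have Dh: "DERIV h u :> - 2 * inner (P - g u) (vd g u)" for u unfolding h_def by (rule D_dist_sq)
  have key: False if w: "s < w1" "w1 < w2" "w2 < s + L" "norm (P - g w1) = r" "norm (P - g w2) = r"
      "inner (P - g w2) (vd g w2) < 0" for w1 w2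
  proof -
    have "0 < - 2 * inner (P - g w2) (vd g w2)" using w(6) by simp
    from DERIV_pos_inc_left[OF Dh this]
    obtain d where "0 < d \<and> (\<forall>k>0. k < d \<longrightarrow> h (w2 - k) < h w2)" by (elim exE)
    then have d: "0 < d" "\<And>k. 0 < k \<Longrightarrow> k < d \<Longrightarrow> h (w2 - k) < h w2" by simp_all
    obtain k where k0: "0 < k" "k < min d (w2 - w1)" using dense[of 0 "min d (w2 - w1)"] d(1) w(2) by auto
    then have k: "0 < k" "k < d" "w1 < w2 - k" by auto
    have low: "h (w2 - k) < r\<^sup>2" using d(2)[OF k(1,2)] w(5) by (simp add: h_def)
    have "continuous_on {w1..w2} h" using Dh DERIV_isCont by (blast intro: continuous_at_imp_continuous_on)
    then have "\<exists>u\<in>{w1..w2}. \<forall>v\<in>{w1..w2}. h u \<le> h v"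
      using w(2) by (intro continuous_attains_inf) auto
    then obtain u where u: "u \<in> {w1..w2}" "\<And>v. v \<in> {w1..w2} \<Longrightarrow> h u \<le> h v" by blast
    have "h u < r\<^sup>2" using u(2)[of "w2 - k"] k low by simp
    then have ne: "u \<noteq> w1" "u \<noteq> w2" using w(4,5) by (auto simp: h_def)
    then have ub: "w1 < u" "u < w2" using u(1) by auto
    have "- 2 * inner (P - g u) (vd g u) = 0"
    proof (rule DERIV_local_min[OF Dh])
      show "0 < min (u - w1) (w2 - u)" using ub by simp
      show "\<forall>y. \<bar>u - y\<bar> < min (u - w1) (w2 - u) \<longrightarrow> h u \<le> h y"
      proof (intro allI impI)
        fix y assume "\<bar>u - y\<bar> < min (u - w1) (w2 - u)"
        then have "u - y < u - w1" "- (u - y) < w2 - u" unfolding min_less_iff_conj abs_less_iff by blast+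
        then have "y \<in> {w1..w2}" by simp
        then show "h u \<le> h y" by (rule u(2))
      qed
    qed
    then have z: "inner (P - g u) (vd g u) = 0" by simp
    have "norm (P - g u) < r" using \<open>h u < r\<^sup>2\<close> w(4) by (intro power2_less_imp_less[of _ r]) (auto simp: h_def)
    then have "\<bar>inner (P - g u) (nrm g u)\<bar> < \<rho>" using critical_distance(2)[OF z] P(2) by linarith
    moreover have "\<bar>t\<bar> < \<rho>" using st(2) P by linarith
    moreover have "par g t s = par g (inner (P - g u) (nrm g u)) u"
      using critical_distance(1)[OF z] unfolding st(1)[symmetric] .
    ultimately have "g s = g u" using tube_inj(2) by blast
    then obtain n :: int where n: "s = u + of_int n * L" using g_eq_iff by blast
    have m: "\<bar>of_int n * L\<bar> < L" "of_int n * L \<noteq> 0" using n ub w by auto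
    from small_period_multiple[OF m(1)] m(2) show False by simp
  qed
  have "u1 = u2"
    using key[of u1 u2] key[of u2 u1] u1 u2 s1 s2 by (cases u1 u2 rule: linorder_cases) auto
  then show ?thesis using u1 u2 by simp
qed

end

section \<open>The integral as a function of the Larmor centre\<close>

text \<open>The centre of the Larmor circle is conserved between collisions.\<close>

lemma larmor_center: "larmor_pos r x v t + \<i> * of_real r * larmor_vel r v t = x + \<i> * of_real r * v"
  by (simp add: larmor_pos_def larmor_vel_def algebra_simps)

lemma larmor_vel_add: "larmor_vel r (larmor_vel r v a) b = larmor_vel r v (a + b)"
  by (simp add: larmor_vel_def add_divide_distrib distrib_left exp_add)

lemma larmor_pos_add: "larmor_pos r (larmor_pos r x v a) (larmor_vel r v a) b = larmor_pos r x v (a + b)"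
proof -
  have "larmor_pos r y u t = (y + \<i> * of_real r * u) - \<i> * of_real r * larmor_vel r u t" for y u t
    by (simp add: larmor_pos_def larmor_vel_def algebra_simps)
  then show ?thesis by (simp only: larmor_vel_add) simp
qed

lemma larmor_0 [simp]: "larmor_pos r x v 0 = x" "larmor_vel r v 0 = v"
  by (simp_all add: larmor_pos_def larmor_vel_def)

lemma norm_larmor_vel: "norm (larmor_vel r v t) = norm v"
  by (simp add: larmor_vel_def norm_mult)

lemma larmor_pos_deriv:
  assumes "r \<noteq> 0"
  shows "(larmor_pos r x v has_vector_derivative larmor_vel r v t) (at t)"
proof -
  have "((\<lambda>z. x - \<i> * of_real r * v * (exp (\<i> * (z / of_real r)) - 1)) has_field_derivative v * exp (\<i> * (of_real t / of_real r))) (at (of_real t))"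
    using assms by (auto intro!: derivative_eq_intros simp: field_simps)
  from has_vector_derivative_real_field[OF this] show ?thesis
    by (simp add: larmor_pos_def[abs_def] larmor_vel_def)
qed

lemma poly_mom_cis: "poly_mom N a x (cis \<theta>) = (\<Sum>k\<le>N. \<Sum>l\<le>N - k. a k l x * cos \<theta> ^ k * sin \<theta> ^ l)"
  by (simp add: poly_mom_def)

text \<open>On unit vectors a polynomial in momenta is a trigonometric polynomial of the angle, so
  any interval of directions determines it.\<close>

lemma poly_mom_constant:
  assumes "s < t" "\<And>\<theta>. \<theta> \<in> {s<..<t} \<Longrightarrow> poly_mom N a x (cis \<theta>) = c"
  shows "poly_mom N a x (cis \<theta>) = c"
proof -
  obtain b where b: "\<And>\<theta>. of_real (\<Sum>k\<le>N. \<Sum>l\<le>N - k. a k l x * cos \<theta> ^ k * sin \<theta> ^ l)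
     = (\<Sum>j\<le>2 * N. b j * cis ((real j - real N) * \<theta>))"
    using trig_polynomial_harmonics[of "\<lambda>k l. a k l x" N] by blast
  define d where "d j = b j - (if j = N then of_real c else 0)" for j
  have eq: "(\<Sum>j\<le>2 * N. d j * cis \<theta> ^ j) = cis (real N * \<theta>) * of_real (poly_mom N a x (cis \<theta>) - c)" for \<theta>
  proof -
    have "(\<Sum>j\<le>2 * N. d j * cis \<theta> ^ j) = (\<Sum>j\<le>2 * N. b j * cis \<theta> ^ j) - (\<Sum>j\<le>2 * N. if j = N then of_real c * cis \<theta> ^ j else 0)"
      unfolding sum_subtractf[symmetric] by (intro sum.cong) (auto simp: d_def algebra_simps)
    also have "(\<Sum>j\<le>2 * N. if j = N then of_real c * cis \<theta> ^ j else 0) = of_real c * cis \<theta> ^ N"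
      by (subst sum.delta) auto
    also have "(\<Sum>j\<le>2 * N. b j * cis \<theta> ^ j) = cis (real N * \<theta>) * (\<Sum>j\<le>2 * N. b j * cis ((real j - real N) * \<theta>))"
      unfolding sum_distrib_left
      by (intro sum.cong refl) (simp add: Complex.DeMoivre cis_mult mult.left_commute algebra_simps)
    finally show ?thesis unfolding b[symmetric] poly_mom_cis[symmetric]
      by (simp add: Complex.DeMoivre algebra_simps)
  qed
  have "\<forall>j\<le>2 * N. d j = 0"
  proof (rule ccontr)
    assume "\<not> ?thesis"
    then have "finite {z. (\<Sum>j\<le>2 * N. d j * z ^ j) = 0}"
      by (subst polyfun_finite_roots) blast
    moreover have "cis ` {s<..<t} \<subseteq> {z. (\<Sum>j\<le>2 * N. d j * z ^ j) = 0}"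
      using assms(2) eq by auto
    ultimately show False using infinite_cis_interval[OF assms(1)] finite_subset by blast
  qed
  then have "cis (real N * \<theta>) * of_real (poly_mom N a x (cis \<theta>) - c) = 0"
    unfolding eq[symmetric] by (intro sum.neutral) auto
  then have "complex_of_real (poly_mom N a x (cis \<theta>) - c) = 0"
    using cis_neq_zero mult_eq_0_iff by blast
  then show ?thesis by (simp only: of_real_eq_0_iff right_minus_eq)
qed

lemma unit_cis: "norm v = 1 \<Longrightarrow> \<exists>\<theta>. v = cis \<theta>"
  using rcis_cmod_Arg[of v] by (metis mult_1 of_real_1 rcis_def)

locale billiard = tube_curve +
  fixes r :: real and N :: nat and a :: "nat \<Rightarrow> nat \<Rightarrow> complex \<Rightarrow> real"
  assumes r0: "r > 0" and r2: "2 * r < \<rho>" and pint: "poly_integral g L r N a"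
begin

abbreviation \<Phi> where "\<Phi> \<equiv> poly_mom N a"

text \<open>Distance r itself is left out: there the circle only touches the curve.\<close>

definition centers where "centers = {P. infdist P img < r}"

lemma flow_invariance:
  assumes "norm v = 1" "inner v (nrm g s) > 0" "t > 0" "\<And>\<tau>. 0 < \<tau> \<Longrightarrow> \<tau> < t \<Longrightarrow> larmor_pos r (g s) v \<tau> \<in> dom"
  shows "\<Phi> (larmor_pos r (g s) v t) (larmor_vel r v t) = \<Phi> (g s) v"
  using pint assms unfolding poly_integral_def dom_of_eq by simp

lemma reflection_invariance:
  assumes "norm v = 1"
  shows "\<Phi> (g s) v = \<Phi> (g s) (v - 2 * of_real (inner (nrm g s) v) * nrm g s)"
  using pint assms unfolding poly_integral_def by blast

lemma coeff_smooth: "k + l \<le> N \<Longrightarrow> cinf_closed (omega_plus g r) (a k l)"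
  using pint unfolding poly_integral_def by blast

lemma inner_center: "inner (\<i> * of_real r * v) (vd g s) = - r * inner v (nrm g s)"
  by (simp add: inner_complex_def nrm_def algebra_simps)

text \<open>By \<open>inner_center\<close> the negative sign selects inward velocities, and
  \<open>crossing_unique\<close> makes the choice of s immaterial. The second argument of
  \<open>\<Phi>\<close> recovers the velocity from the centre.\<close>

definition F :: "complex \<Rightarrow> real" where
  "F P = (let s = (SOME s. norm (P - g s) = r \<and> inner (P - g s) (vd g s) < 0)
          in \<Phi> (g s) (- \<i> * (P - g s) / of_real r))"

lemma F_inward:
  assumes v: "norm v = 1" "inner v (nrm g s) > 0" and P: "g s + \<i> * of_real r * v \<in> centers"
  shows "F (g s + \<i> * of_real r * v) = \<Phi> (g s) v"
proof -
  define P where "P = g s + \<i> * of_real r * v"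
  let ?Q = "\<lambda>s. norm (P - g s) = r \<and> inner (P - g s) (vd g s) < 0"
  have s: "?Q s"
    using v r0 inner_center[of v s] by (simp add: P_def norm_mult mult_pos_pos)
  then have s': "?Q (SOME s. ?Q s)" by (rule someI)
  have "g (SOME s. ?Q s) = g s"
    using s s' P r0 r2 by (intro crossing_unique[of P r]) (auto simp: centers_def P_def)
  moreover have "- \<i> * (P - g s) / of_real r = v" using r0 by (simp add: P_def)
  ultimately show ?thesis unfolding F_def Let_def P_def[symmetric] by simp
qed

text \<open>The circle meets the normal through its centre at coordinate t - r, which is negative
  and within the tube, hence outside the domain.\<close>

lemma circle_leaves:
  assumes v: "norm v = 1" and P: "x + \<i> * of_real r * v \<in> centers"
  shows "\<exists>T>0. larmor_pos r x v (- T) \<notin> dom"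
proof -
  obtain s t where st: "x + \<i> * of_real r * v = par g t s" "\<bar>t\<bar> = infdist (x + \<i> * of_real r * v) img" using foot by blast
  have t: "\<bar>t\<bar> < r" using st(2) P by (simp add: centers_def)
  have "norm (- \<i> * nrm g s / v) = 1" using v by (simp add: norm_divide norm_mult unit_nrm)
  then obtain \<theta> where \<theta>: "- \<i> * nrm g s / v = cis \<theta>" using unit_cis by blast
  \<comment> \<open>Whole turns are added to make the travelling time positive.\<close>
  obtain n :: nat where n: "\<theta> / (2 * pi) < of_nat n" using reals_Archimedean2 by blast
  define T where "T = r * (2 * pi * of_nat n - \<theta>)"
  have "T > 0" using n r0 by (simp add: T_def field_simps)
  have "larmor_vel r v (- T) = v * cis (\<theta> - 2 * pi * of_nat n)"
    using r0 by (simp add: larmor_vel_def T_def cis_conv_exp)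
  also have "cis (\<theta> - 2 * pi * of_nat n) = cis \<theta>"
    by (simp add: cis_divide[symmetric] cis_multiple_2pi)
  also have "v * cis \<theta> = - \<i> * nrm g s" unfolding \<theta>[symmetric] using v by auto
  finally have V: "larmor_vel r v (- T) = - \<i> * nrm g s" .
  have "larmor_pos r x v (- T) = par g t s - \<i> * of_real r * larmor_vel r v (- T)"
    using larmor_center[of r x v "- T"] st(1) by (simp add: algebra_simps)
  also have "\<dots> = par g (t - r) s" unfolding V by (simp add: par_def algebra_simps)
  also have "\<dots> \<notin> dom" using t r2 by (intro right_tube) auto
  finally show ?thesis using \<open>T > 0\<close> by blast
qed

text \<open>Running the arc through \<open>x\<close> backwards, its first exit from the domain is an inward
  crossing of the boundary.\<close>

lemma F_arc:
  assumes v: "norm v = 1" and P: "x + \<i> * of_real r * v \<in> centers"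
    and \<eta>: "\<eta> > 0" "\<And>\<tau>. 0 < \<tau> \<Longrightarrow> \<tau> < \<eta> \<Longrightarrow> larmor_pos r x v (- \<tau>) \<in> dom"
  shows "F (x + \<i> * of_real r * v) = \<Phi> x v"
proof -
  define X where "X \<tau> = larmor_pos r x v \<tau>" for \<tau>
  define V where "V \<tau> = larmor_vel r v \<tau>" for \<tau>
  have DX: "(X has_vector_derivative V t) (at t)" for t
    unfolding X_def[abs_def] V_def using r0 by (intro larmor_pos_deriv) simp
  have cX: "continuous_on S (\<lambda>\<tau>. X (- \<tau>))" for S
  proof (rule continuous_on_compose2[of UNIV X])
    show "continuous_on UNIV X"
      using DX has_vector_derivative_continuous by (blast intro: continuous_at_imp_continuous_on)
  qed (auto intro: continuous_intros)
  obtain T0 where T0: "T0 > 0" "X (- T0) \<notin> dom" using circle_leaves[OF v P] by (auto simp: X_def)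
  \<comment> \<open>Starting at \<eta> / 2 makes the set compact, so that a first exit time exists
    and is positive.\<close>
  define C where "C = {\<eta> / 2..T0} \<inter> (\<lambda>\<tau>. X (- \<tau>)) -` (- dom)"
  have "\<eta> \<le> T0" using \<eta>(2)[of T0] T0 by (auto simp: X_def not_le[symmetric])
  then have C0: "T0 \<in> C" using T0 \<eta>(1) by (simp add: C_def)
  have "closed ((\<lambda>\<tau>. X (- \<tau>)) -` (- dom))"
    using cX[of UNIV] open_dom by (intro closed_vimage) (auto simp: closed_Compl)
  then have cC: "compact C" unfolding C_def by (intro compact_Int_closed compact_Icc)
  obtain T where T: "T \<in> C" "\<And>\<tau>. \<tau> \<in> C \<Longrightarrow> T \<le> \<tau>" using compact_attains_inf[OF cC] C0 by blast
  have Tp: "T > 0" "T \<le> T0" "X (- T) \<notin> dom" using T(1) \<eta>(1) by (auto simp: C_def)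
  have ins: "X (- \<tau>) \<in> dom" if \<tau>: "0 < \<tau>" "\<tau> < T" for \<tau>
  proof (rule ccontr)
    assume n: "X (- \<tau>) \<notin> dom"
    then have "\<not> \<tau> < \<eta>" using \<eta>(2)[OF \<tau>(1)] by (auto simp: X_def)
    then have "\<tau> \<in> C" using n \<tau> Tp(2) \<eta>(1) by (auto simp: C_def)
    then show False using T(2) \<tau>(2) by fastforce
  qed
  have "(\<lambda>\<tau>. X (- \<tau>)) ` closure {0<..<T} \<subseteq> closure dom"
  proof (rule image_closure_subset)
    show "(\<lambda>\<tau>. X (- \<tau>)) ` {0<..<T} \<subseteq> closure dom"
      using ins closure_subset[of dom] by auto
  qed (auto intro: cX)
  then have "X (- T) \<in> closure dom" using Tp(1) by auto
  then have "X (- T) \<in> img" using closure_dom Tp(3) by blast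
  then obtain s where s: "X (- T) = g s" by (auto simp: img_def)
  have cen: "g s + \<i> * of_real r * V (- T) = x + \<i> * of_real r * v"
    using larmor_center[of r x v "- T"] s by (simp add: X_def V_def)
  have V1: "norm (V (- T)) = 1" using v by (simp add: V_def norm_larmor_vel)
  have ne: "inner (V (- T)) (nrm g s) \<noteq> 0"
  proof
    assume z: "inner (V (- T)) (nrm g s) = 0"
    have "inner (x + \<i> * of_real r * v - g s) (vd g s) \<noteq> 0"
    proof (rule transversal)
      show "infdist (x + \<i> * of_real r * v) img < r" using P by (simp add: centers_def)
      show "r < \<rho>" using r0 r2 by simp
      show "norm (x + \<i> * of_real r * v - g s) = r"
        unfolding cen[symmetric] using r0 V1 by (simp add: norm_mult)
    qed
    then show False unfolding cen[symmetric] using z inner_center[of "V (- T)" s] by simp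
  qed
  \<comment> \<open>An outward velocity at the exit point would put the arc outside the domain just
    after time - T, where it is known to be inside.\<close>
  have "\<not> inner (V (- T)) (nrm g s) < 0"
  proof
    assume neg: "inner (V (- T)) (nrm g s) < 0"
    have "((\<lambda>\<tau>. X (\<tau> + - T)) has_vector_derivative V (- T)) (at 0)"
    proof -
      have "((\<lambda>\<tau>. \<tau> + - T) has_vector_derivative 1) (at 0)" by (auto intro!: derivative_eq_intros)
      from vector_diff_chain_at[OF this, of X "V (- T)"] DX[of "- T"] show ?thesis by (simp add: comp_def)
    qed
    then obtain \<delta> where \<delta>: "\<delta> > 0" "\<And>\<tau>. 0 < \<tau> \<and> \<tau> < \<delta> \<Longrightarrow> X (\<tau> + - T) \<notin> dom"
      using leave[of "\<lambda>\<tau>. X (\<tau> + - T)" "V (- T)" s] s neg by auto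
    obtain \<tau> where \<tau>: "0 < \<tau>" "\<tau> < min \<delta> T" using dense[of 0 "min \<delta> T"] \<delta>(1) Tp(1) by auto
    then have "X (- (T - \<tau>)) \<in> dom" by (intro ins) auto
    then show False using \<delta>(2)[of \<tau>] \<tau> by (simp add: algebra_simps)
  qed
  with ne have pos: "inner (V (- T)) (nrm g s) > 0" by simp
  have step: "larmor_pos r (g s) (V (- T)) \<tau> = X (\<tau> - T)" "larmor_vel r (V (- T)) \<tau> = V (\<tau> - T)" for \<tau>
    unfolding s[symmetric] X_def V_def larmor_pos_add larmor_vel_add by (simp_all add: add.commute)
  have "\<Phi> (larmor_pos r (g s) (V (- T)) T) (larmor_vel r (V (- T)) T) = \<Phi> (g s) (V (- T))"
  proof (rule flow_invariance[OF V1 pos Tp(1)])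
    fix \<tau> assume "0 < \<tau>" "\<tau> < T"
    then show "larmor_pos r (g s) (V (- T)) \<tau> \<in> dom" unfolding step using ins[of "T - \<tau>"] by simp
  qed
  then have "\<Phi> x v = \<Phi> (g s) (V (- T))" unfolding step by (simp add: X_def V_def)
  moreover have "F (g s + \<i> * of_real r * V (- T)) = \<Phi> (g s) (V (- T))"
    by (rule F_inward[OF V1 pos]) (simp only: cen P)
  ultimately show ?thesis unfolding cen by simp
qed

lemma F_interior:
  assumes v: "norm v = 1" and P: "x + \<i> * of_real r * v \<in> centers" and x: "x \<in> dom"
  shows "F (x + \<i> * of_real r * v) = \<Phi> x v"
proof -
  have "isCont (larmor_pos r x v) 0"
    using larmor_pos_deriv[of r x v 0] r0 has_vector_derivative_continuous by blast
  then have "(larmor_pos r x v \<longlongrightarrow> x) (at 0)" by (simp add: isCont_def)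
  from topological_tendstoD[OF this open_dom x]
  obtain d where d: "d > 0" "\<And>t. t \<noteq> 0 \<Longrightarrow> dist t 0 < d \<Longrightarrow> larmor_pos r x v t \<in> dom"
    unfolding eventually_at by auto
  show ?thesis by (rule F_arc[OF v P d(1)]) (auto intro!: d(2))
qed

text \<open>At distance exactly r the point g s would be nearest to the centre, so the radius would
  be normal and v tangent.\<close>

lemma boundary_center:
  assumes v: "norm v = 1" "inner v (nrm g s) \<noteq> 0"
  shows "g s + \<i> * of_real r * v \<in> centers"
proof -
  let ?P = "g s + \<i> * of_real r * v"
  have n: "norm (?P - g s) = r" using v r0 by (simp add: norm_mult)
  have "infdist ?P img \<le> dist ?P (g s)" by (rule infdist_le) (simp add: img_def)
  then have le: "infdist ?P img \<le> r" using n by (simp add: dist_norm)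
  moreover have "infdist ?P img \<noteq> r"
  proof
    assume eq: "infdist ?P img = r"
    have "(norm (?P - g s))\<^sup>2 \<le> (norm (?P - g u))\<^sup>2" for u
    proof -
      have "infdist ?P img \<le> dist ?P (g u)" by (rule infdist_le) (simp add: img_def)
      then show ?thesis unfolding n eq dist_norm using r0 by (intro power_mono) auto
    qed
    then have "- 2 * inner (?P - g s) (vd g s) = 0"
      by (intro DERIV_local_min[OF D_dist_sq zero_less_one]) blast
    then show False using v(2) r0 inner_center[of v s] by simp
  qed
  ultimately show ?thesis by (simp add: centers_def)
qed

text \<open>For outward v the reversed motion enters the domain, so \<open>F_arc\<close> applies.
  Both velocities of a reflection are thereby expressed through F.\<close>

lemma F_boundary:
  assumes v: "norm v = 1" "inner v (nrm g s) \<noteq> 0"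
  shows "F (g s + \<i> * of_real r * v) = \<Phi> (g s) v"
proof (cases "inner v (nrm g s) > 0")
  case True
  then show ?thesis using F_inward boundary_center v by blast
next
  case False
  then have neg: "inner (- v) (nrm g s) > 0" using v(2) by simp
  have "((\<lambda>\<tau>. larmor_pos r (g s) v (- \<tau>)) has_vector_derivative - v) (at 0)"
  proof -
    have "((\<lambda>\<tau>::real. - \<tau>) has_vector_derivative - 1) (at 0)" by (auto intro!: derivative_eq_intros)
    from vector_diff_chain_at[OF this, of "larmor_pos r (g s) v" v] larmor_pos_deriv[of r "g s" v 0] r0
    show ?thesis by (simp add: comp_def)
  qed
  then obtain \<eta> where \<eta>: "\<eta> > 0" "\<And>\<tau>. 0 < \<tau> \<and> \<tau> < \<eta> \<Longrightarrow> larmor_pos r (g s) v (- \<tau>) \<in> dom"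
    using enter[of "\<lambda>\<tau>. larmor_pos r (g s) v (- \<tau>)" "- v" s] neg by auto
  show ?thesis by (rule F_arc[OF v(1) boundary_center[OF v] \<eta>(1)]) (use \<eta>(2) in blast)
qed

definition circ :: "real \<Rightarrow> real \<Rightarrow> complex" where
  "circ s t = g s + of_real r * (of_real (cos t) * nrm g s + of_real (sin t) * vd g s)"

text \<open>Multiplication by \<i> turns the reflection of the velocity into the reflection of the
  centre in the normal line, t -> - t. The excluded angles are tangential velocities, whose centres
  lie on the parallel curves.\<close>

lemma F_circ:
  assumes "sin t \<noteq> 0"
  shows "circ s t \<in> centers" "F (circ s t) = F (circ s (- t))"
proof -
  define v where "v t = of_real (cos t) * vd g s - of_real (sin t) * nrm g s" for t
  have c: "circ s t = g s + \<i> * of_real r * v t" for t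
    by (simp add: circ_def v_def nrm_def algebra_simps)
  have vc: "v t = vd g s * cnj (cis t)" for t
    by (simp add: v_def nrm_def complex_eq_iff algebra_simps)
  have n: "norm (v t) = 1" for t by (simp add: vc norm_mult unit)
  have sq: "(Re (vd g s))\<^sup>2 + (Im (vd g s))\<^sup>2 = 1" using unit[of s] by (metis cmod_power2 one_power2)
  have i: "inner (v t) (nrm g s) = - sin t" for t
  proof -
    have "inner (v t) (nrm g s) = - sin t * ((Re (vd g s))\<^sup>2 + (Im (vd g s))\<^sup>2)"
      by (simp add: v_def nrm_def inner_complex_def power2_eq_square algebra_simps)
    then show ?thesis by (simp add: sq)
  qed
  show "circ s t \<in> centers" unfolding c by (rule boundary_center[OF n]) (simp add: i assms)
  have R: "v t - 2 * of_real (inner (nrm g s) (v t)) * nrm g s = v (- t)"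
    unfolding inner_commute[of "nrm g s"] i by (simp add: v_def)
  have "F (circ s t) = \<Phi> (g s) (v t)" unfolding c by (rule F_boundary[OF n]) (simp add: i assms)
  also have "\<dots> = \<Phi> (g s) (v (- t))" using reflection_invariance[OF n, of s t] unfolding R .
  also have "\<dots> = F (circ s (- t))" unfolding c by (rule F_boundary[OF n, symmetric]) (simp add: i assms)
  finally show "F (circ s t) = F (circ s (- t))" .
qed

section \<open>Polynomiality and non-constancy of the centre function\<close>

lemma omega_plusI: "x \<in> dom \<Longrightarrow> infdist x img < 2 * r \<Longrightarrow> x \<in> omega_plus g r"
proof -
  assume x: "x \<in> dom" "infdist x img < 2 * r"
  then obtain s t where "x = par g t s" "\<bar>t\<bar> = infdist x img" "0 < t"
    using near_curve[of x] r2 by auto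
  then show ?thesis using x(2) unfolding omega_plus_def by (intro CollectI exI[of _ s] exI[of _ t]) auto
qed

lemma open_centers: "open centers"
  unfolding centers_def by (intro open_Collect_less continuous_intros)

lemma centers_eq: "centers = (\<lambda>(t, s). par g t s) ` ({- r<..<r} \<times> UNIV)"
proof
  show "centers \<subseteq> (\<lambda>(t, s). par g t s) ` ({- r<..<r} \<times> UNIV)"
  proof
    fix P assume P: "P \<in> centers"
    obtain s t where st: "P = par g t s" "\<bar>t\<bar> = infdist P img" using foot by blast
    have "\<bar>t\<bar> < r" using st(2) P by (simp add: centers_def)
    then show "P \<in> (\<lambda>(t, s). par g t s) ` ({- r<..<r} \<times> UNIV)"
      using st(1) by (intro image_eqI[of _ _ "(t, s)"]) auto
  qed
  show "(\<lambda>(t, s). par g t s) ` ({- r<..<r} \<times> UNIV) \<subseteq> centers"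
  proof clarify
    fix t s assume "t \<in> {- r<..<r}"
    then have "\<bar>t\<bar> < r" by auto
    then show "par g t s \<in> centers" using infdist_par[of t s] r0 r2 by (simp add: centers_def)
  qed
qed

lemma connected_centers: "connected centers"
  unfolding centers_eq by (rule connected_par_strip)

lemma centers_ne: "centers \<noteq> {}"
  using r0 by (auto simp: centers_eq)

text \<open>The velocity \<i> n places the centre on the same normal, shifted by - r.\<close>

lemma opposite_velocity:
  "\<exists>\<theta>. par g t s + \<i> * of_real r * cis \<theta> = par g (t - r) s"
proof -
  have "norm (\<i> * nrm g s) = 1" by (simp add: norm_mult unit_nrm)
  then obtain \<theta> where "\<i> * nrm g s = cis \<theta>" using unit_cis by blast
  then have "\<i> * cis \<theta> = - nrm g s" by (metis complex_i_mult_minus)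
  then have "par g t s + of_real r * (\<i> * cis \<theta>) = par g (t - r) s"
    by (simp add: par_def algebra_simps)
  then show ?thesis by (intro exI[of _ \<theta>]) (simp add: mult.left_commute mult.assoc)
qed

lemma F_locally_polynomial:
  assumes P: "P0 \<in> centers"
  shows "\<exists>R>0. \<exists>p. \<forall>y\<in>ball P0 R. F y = ev p (Re y) (Im y)"
proof -
  obtain s t where st: "P0 = par g t s" "\<bar>t\<bar> = infdist P0 img" using foot by blast
  have t: "\<bar>t\<bar> < r" using st(2) P by (simp add: centers_def)
  \<comment> \<open>The innermost point of the circle about \<open>P0\<close>: its normal coordinate
    t + r lies strictly between 0 and 2 r, so all nearby positions are in the domain and in the
    annulus.\<close>
  define x0 where "x0 = par g (t + r) s"
  have x0: "x0 \<in> dom" "infdist x0 img < 2 * r"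
  proof -
    show "x0 \<in> dom" unfolding x0_def using t r2 by (intro left_tube) auto
    show "infdist x0 img < 2 * r" unfolding x0_def using t r2 infdist_par[of "t + r" s] by auto
  qed
  obtain \<theta>0 where \<theta>0: "x0 + \<i> * of_real r * cis \<theta>0 = P0"
    using opposite_velocity[of "t + r" s] by (auto simp: x0_def st(1))
  have "open (dom \<inter> {x. infdist x img < 2 * r})"
    by (intro open_Int open_dom open_Collect_less continuous_intros)
  then obtain e1 where e1: "e1 > 0" "ball x0 e1 \<subseteq> dom \<inter> {x. infdist x img < 2 * r}"
    using x0 open_contains_ball by (metis (no_types, lifting) IntI mem_Collect_eq)
  obtain e2 where e2: "e2 > 0" "ball P0 e2 \<subseteq> centers"
    using P open_centers open_contains_ball by blast
  \<comment> \<open>Errors below e in position and angle move the centre by less than e (1 +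
    r).\<close>
  define e where "e = min e1 (e2 / (1 + r))"
  have e: "e > 0" "e \<le> e1" "e * (1 + r) \<le> e2"
  proof -
    show "e > 0" "e \<le> e1" using e1 e2 r0 by (auto simp: e_def)
    have "e \<le> e2 / (1 + r)" by (simp add: e_def)
    then show "e * (1 + r) \<le> e2" using r0 by (simp add: pos_le_divide_eq)
  qed
  have sub: "ball x0 e \<subseteq> dom" "ball x0 e \<subseteq> omega_plus g r"
    using e1(2) e(2) subset_ball[of e e1 x0] omega_plusI by blast+
  have "\<forall>k l. \<exists>h. k + l \<le> N \<longrightarrow> cinf_on (ball x0 e) h \<and> (\<forall>x\<in>ball x0 e. h x = a k l x)"
  proof (intro allI)
    fix k l
    show "\<exists>h. k + l \<le> N \<longrightarrow> cinf_on (ball x0 e) h \<and> (\<forall>x\<in>ball x0 e. h x = a k l x)"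
    proof (cases "k + l \<le> N")
      case True
      then obtain U h where h: "omega_plus g r \<subseteq> U" "cinf_on U h" "\<forall>x\<in>omega_plus g r. h x = a k l x"
        using coeff_smooth unfolding cinf_closed_def by blast
      have "cinf_on (ball x0 e) h" using cinf_on_subset[OF h(2)] h(1) sub(2) by blast
      then show ?thesis using h(3) sub(2) by blast
    qed blast
  qed
  then obtain h where h: "\<And>k l. k + l \<le> N \<Longrightarrow> cinf_on (ball x0 e) (h k l)"
    "\<And>k l x. k + l \<le> N \<Longrightarrow> x \<in> ball x0 e \<Longrightarrow> h k l x = a k l x"
    by metis
  have "\<exists>R>0. \<exists>p. \<forall>z\<in>ball (x0 + \<i> * of_real r * cis \<theta>0) R. F z = ev p (Re z) (Im z)"
  proof (rule local_polynomial[OF r0 e(1)])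
    show "cinf_on (ball x0 e) (h k l)" if "k \<le> N" "l \<le> N - k" for k l
      using that by (intro h(1)) auto
    fix x \<theta> assume x: "x \<in> ball x0 e" and \<theta>: "\<bar>\<theta> - \<theta>0\<bar> < e"
    have "x + \<i> * of_real r * cis \<theta> - P0 = (x - x0) + \<i> * of_real r * (cis \<theta> - cis \<theta>0)"
      unfolding \<theta>0[symmetric] by (simp add: algebra_simps)
    then have "norm (x + \<i> * of_real r * cis \<theta> - P0) \<le> norm (x - x0) + norm (\<i> * of_real r * (cis \<theta> - cis \<theta>0))"
      by (metis norm_triangle_ineq)
    moreover have "norm (\<i> * of_real r * (cis \<theta> - cis \<theta>0)) = r * norm (cis \<theta> - cis \<theta>0)"
      using r0 by (simp add: norm_mult)
    moreover have "r * norm (cis \<theta> - cis \<theta>0) \<le> r * e"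
      using norm_cis_diff_le[of \<theta> \<theta>0] \<theta> r0 by (intro mult_left_mono) auto
    moreover have "norm (x - x0) < e" using x by (simp add: dist_norm norm_minus_commute)
    moreover have "e * (1 + r) = e + r * e" by (simp add: algebra_simps)
    ultimately have "norm (x + \<i> * of_real r * cis \<theta> - P0) < e2" using e(3) by linarith
    then have "x + \<i> * of_real r * cis \<theta> \<in> centers"
      using e2(2) by (auto simp: dist_norm norm_minus_commute)
    then have "F (x + \<i> * of_real r * cis \<theta>) = \<Phi> x (cis \<theta>)"
      using x sub(1) by (intro F_interior) auto
    also have "\<dots> = (\<Sum>k\<le>N. \<Sum>l\<le>N - k. h k l x * cos \<theta> ^ k * sin \<theta> ^ l)"
      unfolding poly_mom_cis using x by (intro sum.cong refl) (simp add: h(2))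
    finally show "F (x + \<i> * of_real r * cis \<theta>) = (\<Sum>k\<le>N. \<Sum>l\<le>N - k. h k l x * cos \<theta> ^ k * sin \<theta> ^ l)" .
  qed
  then show ?thesis unfolding \<theta>0 .
qed

lemma F_polynomial: "\<exists>p. \<forall>P\<in>centers. F P = ev p (Re P) (Im P)"
  by (rule polynomial_on_connected[OF connected_centers centers_ne F_locally_polynomial])

text \<open>This transfers non-constancy from \<open>\<Phi>\<close> to F. At an interior point of
  the annulus an interval of directions has its centres in \<open>centers\<close>, which fixes
  \<open>\<Phi>\<close> there in all directions; the two boundary curves follow by continuity of the
  coefficients.\<close>

lemma constant_if_F_constant:
  assumes c: "\<And>P. P \<in> centers \<Longrightarrow> F P = c" and x: "x \<in> omega_plus g r" and v: "norm v = 1"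
  shows "\<Phi> x v = c"
proof -
  obtain \<theta>v where \<theta>v: "v = cis \<theta>v" using unit_cis[OF v] by blast
  obtain s t where st: "x = par g t s" "0 \<le> t" "t \<le> 2 * r" using x by (auto simp: omega_plus_def)
  have "\<Phi> (par g u s) v = c" if u: "u \<in> {0<..<2 * r}" for u
  proof -
    have xd: "par g u s \<in> dom" using u r2 by (intro left_tube) auto
    obtain \<theta>0 where \<theta>0: "par g u s + \<i> * of_real r * cis \<theta>0 = par g (u - r) s"
      using opposite_velocity by blast
    have "isCont (\<lambda>\<theta>. par g u s + \<i> * of_real r * cis \<theta>) \<theta>0"
      unfolding cis_conv_exp by (intro continuous_intros)
    moreover have "par g (u - r) s \<in> centers" unfolding centers_eq
      by (rule image_eqI[of _ _ "(u - r, s)"]) (use u in auto)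
    ultimately have "\<forall>\<^sub>F \<theta> in at \<theta>0. par g u s + \<i> * of_real r * cis \<theta> \<in> centers"
      using topological_tendstoD[OF _ open_centers] by (simp add: isCont_def \<theta>0)
    then obtain d where d: "d > 0" "\<And>\<theta>. \<theta> \<noteq> \<theta>0 \<Longrightarrow> dist \<theta> \<theta>0 < d \<Longrightarrow> par g u s + \<i> * of_real r * cis \<theta> \<in> centers"
      unfolding eventually_at by auto
    show ?thesis unfolding \<theta>v
    proof (rule poly_mom_constant)
      show "\<theta>0 < \<theta>0 + d" using d(1) by simp
      fix \<theta> assume "\<theta> \<in> {\<theta>0<..<\<theta>0 + d}"
      then have P: "par g u s + \<i> * of_real r * cis \<theta> \<in> centers" by (intro d(2)) (auto simp: dist_real_def)
      show "\<Phi> (par g u s) (cis \<theta>) = c" using F_interior[OF _ P xd] c[OF P] by simp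
    qed
  qed
  moreover have "continuous_on {0..2 * r} (\<lambda>u. \<Phi> (par g u s) v)"
    unfolding poly_mom_def
  proof (intro continuous_on_sum continuous_on_mult continuous_on_const)
    fix k l assume "k \<in> {..N}" "l \<in> {..N - k}"
    then have "k + l \<le> N" by auto
    then obtain U h where h: "omega_plus g r \<subseteq> U" "cinf_on U h" "\<forall>x\<in>omega_plus g r. h x = a k l x"
      using coeff_smooth unfolding cinf_closed_def by blast
    have om: "par g u s \<in> omega_plus g r" if "u \<in> {0..2 * r}" for u
      using that unfolding omega_plus_def by auto
    have "continuous_on {0..2 * r} (\<lambda>u. h (par g u s))"
    proof (rule continuous_on_compose2[OF cinf_on_cont[OF h(2)]])
      show "continuous_on {0..2 * r} (\<lambda>u. par g u s)" unfolding par_def by (intro continuous_intros)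
      show "(\<lambda>u. par g u s) ` {0..2 * r} \<subseteq> U" using om h(1) by blast
    qed
    then show "continuous_on {0..2 * r} (\<lambda>u. a k l (par g u s))"
      by (rule continuous_on_eq) (use om h(3) in auto)
  qed
  moreover have "closure {0<..<2 * r} = {0..2 * r}" using r0 by simp
  ultimately have "\<Phi> (par g t s) v = c"
    using continuous_constant_on_closure[of "{0<..<2 * r}" "\<lambda>u. \<Phi> (par g u s) v" c t] st by auto
  then show ?thesis by (simp add: st(1))
qed

theorem parallel_curve_oval:
  assumes nonconst: "nonconstant_on_phase (omega_plus g r) \<Phi>" and q: "q = r \<or> q = - r"
  shows "nonsing_alg_oval (par g q ` {0..L})"
proof -
  obtain p where p: "\<And>P. P \<in> centers \<Longrightarrow> F P = ev p (Re P) (Im P)" using F_polynomial by blast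
  have pn: "p \<noteq> [:[:c:]:]" for c
  proof
    assume "p = [:[:c:]:]"
    then have "\<And>P. P \<in> centers \<Longrightarrow> F P = c" using p by simp
    from constant_if_F_constant[OF this] show False
      using nonconst unfolding nonconstant_on_phase_def by metis
  qed
  have symr: "ev p (Re (circ s t)) (Im (circ s t)) = ev p (Re (circ s (- t))) (Im (circ s (- t)))" for s t
  proof (cases "sin t = 0")
    case True
    then have "circ s (- t) = circ s t" by (simp add: circ_def)
    then show ?thesis by simp
  next
    case False
    then show ?thesis
      using F_circ[of t s] F_circ(1)[of "- t" s] p[of "circ s t"] p[of "circ s (- t)"] by simp
  qed
  have qr: "\<bar>q\<bar> < \<rho>" "q \<noteq> 0" using q r0 r2 by auto
  interpret parallel_frame "\<lambda>t. Re (g t)" "\<lambda>t. Im (g t)" "\<lambda>t. Re (vd g t)" "\<lambda>t. Im (vd g t)" "curv g" q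
  proof
    fix t
    show "((\<lambda>t. Re (g t)) has_field_derivative Re (vd g t)) (at t)"
      "((\<lambda>t. Im (g t)) has_field_derivative Im (vd g t)) (at t)"
      using Dg[of t] unfolding has_vector_derivative_complex_iff by (auto simp: comp_def)
    show "((\<lambda>t. Re (vd g t)) has_field_derivative - curv g t * Im (vd g t)) (at t)"
      "((\<lambda>t. Im (vd g t)) has_field_derivative curv g t * Re (vd g t)) (at t)"
      using Dtau[of t] unfolding has_vector_derivative_complex_iff by (auto simp: comp_def nrm_def)
    show "(Re (vd g t))\<^sup>2 + (Im (vd g t))\<^sup>2 = 1" using unit[of t] by (metis cmod_power2 one_power2)
    show "1 - q * curv g t \<noteq> 0" using tube qr unfolding tube_ok_def by blast
  next
    show "smooth1 (\<lambda>t. Re (vd g t))" "smooth1 (\<lambda>t. Im (vd g t))" using smooth1_Re_Im[of 1] by simp_all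
    show "smooth1 (curv g)" by (rule smooth1_curv)
    show "q \<noteq> 0" by (rule qr(2))
  qed
  have pc: "pc t = par g q t" for t
    by (simp add: pc_def x_def y_def par_def nrm_def complex_eq_iff)
  have cc: "cx s t = Re (circ s t)" "cy s t = Im (circ s t)" if "q = r" for s t
    unfolding cx_def cy_def circ_def nrm_def using that by (simp_all add: algebra_simps)
  \<comment> \<open>For the outer parallel curve the same circle is parametrised from the opposite
    point; a shift by pi preserves the symmetry because \<open>circ\<close> has period 2 pi.\<close>
  have cm: "cx s t = Re (circ s (t + pi))" "cy s t = Im (circ s (t + pi))" if "q = - r" for s t
    unfolding cx_def cy_def circ_def nrm_def using that by (simp_all add: algebra_simps)
  have sym: "sym_poly p"
    unfolding sym_poly_def
  proof (intro allI)
    fix s t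
    from q show "ev p (cx s t) (cy s t) = ev p (cx s (- t)) (cy s (- t))"
    proof
      assume eq: "q = r"
      show ?thesis unfolding cc[OF eq] by (rule symr)
    next
      assume eq: "q = - r"
      have c: "circ s (- (t + pi)) = circ s (- t + pi)"
        by (simp add: circ_def)
      show ?thesis unfolding cm[OF eq] c[symmetric] by (rule symr)
    qed
  qed
  have "range pc = pc ` {0..L}"
    unfolding pc by (rule range_per) (simp add: par_def per nrm_per)
  from sym_poly_oval[OF sym pn L0 this] show ?thesis unfolding pc .
qed

end

theorem theorem1p1:
  fixes \<gamma> :: "real \<Rightarrow> complex" and L \<beta> r :: real
    and N :: nat and a :: "nat \<Rightarrow> nat \<Rightarrow> complex \<Rightarrow> real"
  assumes curve: "simple_closed_arclength \<gamma> L"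
    and orient: "ccw \<gamma> L"
    and beta: "\<beta> > 0" and rdef: "r = 1 / \<beta>"
    and small: "r < r0 \<gamma> L / 2"
    and integral: "poly_integral \<gamma> L r N a"
    and nonconst: "nonconstant_on_phase (omega_plus \<gamma> r) (poly_mom N a)"
  shows "nonsing_alg_oval (par \<gamma> r ` {0..L}) \<and> nonsing_alg_oval (par \<gamma> (- r) ` {0..L})"
proof -
  interpret plane_curve \<gamma> L by standard (rule curve)
  \<comment> \<open>2 r lies below the supremum of admissible radii, so some admissible radius
    exceeds it.\<close>
  obtain \<rho> where \<rho>: "2 * r < \<rho>" "\<rho> > 0" "tube_ok \<gamma> L \<rho>" using tube_radius[OF small] by blast
  interpret billiard \<gamma> L \<rho> r N a
    by standard (use \<rho> orient beta rdef integral in auto)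
  show ?thesis using parallel_curve_oval[OF nonconst] by blast
qed

end
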